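(* Let $L$ be a nondegenerate even lattice with dual lattice $L^\circ$. For any $\beta\in L^\circ$, the graded $\mathbb{Z}$-dual $V_{-\beta+L,\mathbb{Z}}'$ is the integral form of $V_{\beta+L}$ spanned over $\mathbb{Z}$ by the coefficients of products of the form $$E^-(-\beta_1,x_1)\cdots E^-(-\beta_k,x_k)\,\iota(e_\alpha e_\beta),$$ where $k\ge0$, $\beta_1,\dots,\beta_k\in L^\circ$ and $\alpha\in L$.
   Context: Lattice vertex algebras. $L$ is a nondegenerate even lattice with form $\langle\cdot,\cdot\rangle$, $\mathfrak{h}=\mathbb{C}\otimes_{\mathbb{Z}}L$, and $M(1)$ is the level one Heisenberg vertex operator algebra of $\mathfrak{h}$ (operators $h(n)$, $h\in\mathfrak{h}$, $[h(m),h'(n)]=m\langle h,h'\rangle\delta_{m+n,0}$). $\mathbb{C}\{L^\circ\}$ is the twisted group algebra with basis $e_\beta$ ($\beta\in L^\circ$), identity $e_0$, product $e_\beta e_\gamma=\varepsilon(\beta,\gamma)e_{\beta+\gamma}$, where $\varepsilon$ is a bimultiplicative map from $L^\circ\times L^\circ$ to roots of unity; $c(\beta,\gamma)=\varepsilon(\beta,\gamma)\varepsilon(\gamma,\beta)^{-1}$ satisfies $c(\alpha,\alpha')=(-1)^{\langle\alpha,\alpha'\rangle}$ for $\alpha,\alpha'\in L$, and $\varepsilon(\alpha,\alpha')=\pm1$ for $\alpha,\alpha'\in L$. Put $V_{\beta+L}=M(1)\otimes\mathbb{C}\{\beta+L\}$ (span over $e_\gamma$, $\gamma\in\beta+L$),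 $V_L=V_{0+L}$, $\iota(e_\beta)=1\otimes e_\beta$ (extended linearly, so $\iota(e_\alpha e_\beta)=\varepsilon(\alpha,\beta)\iota(e_{\alpha+\beta})$), $\mathbf{1}=\iota(e_0)$. Operators: $h(n)$ ($n\ne0$) acts on $M(1)$; $h(0)e_\beta=\langle h,\beta\rangle e_\beta$; $e_\alpha$ acts by left multiplication; $x^\alpha$ acts on $e_\gamma$ as $x^{\langle\alpha,\gamma\rangle}$; $E^\pm(\beta,x)=\exp\big(\sum_{n\in\pm\mathbb{Z}_+}\frac{\beta(n)}{n}x^{-n}\big)$ for $\beta\in L^\circ$. $V_L$ is a (conformal) vertex algebra generated by the $\iota(e_\alpha)$, $\alpha\in L$, with $Y(\iota(e_\alpha),x)=E^-(-\alpha,x)E^+(-\alpha,x)e_\alpha x^\alpha$ and the standard conformal vector $\omega=\frac12\sum_iu_i(-1)u^i(-1)\mathbf{1}$ ($\{u_i\},\{u^i\}$ dual bases of $\mathfrak{h}$). The same formula makes each $V_{\beta+L}$ an irreducible $V_L$-module. Integral forms. An integral form of a complex vector space is the $\mathbb{Z}$-span of a basis. $V_{L,\mathbb{Z}}$ is the smallest vertex subring (additive subgroup containing $\mathbf{1}$ and closed under all products $u_nv$, $n\in\mathbb{Z}$) of $V_L$ containing all $\iota(e_\alpha)$, $\alpha\in L$. $V_{\beta+L,\mathbb{Z}}$ is the $V_{L,\mathbb{Z}}$-submodule of $V_{\beta+L}$ generated by $\iota(e_\beta)$; it is an integral form of $V_{\beta+L}$ and equals the $\mathbb{Z}$-span of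 the coefficients of the products $E^-(-\alpha_1,x_1)\cdots E^-(-\alpha_k,x_k)\iota(e_\alpha e_\beta)$, $\alpha_1,\dots,\alpha_k,\alpha\in L$. Duals. Let $(\cdot,\cdot)$ be the unique bilinear pairing between $V_{\beta+L}$ and $V_{-\beta+L}$ that is invariant, i.e. $(Y(v,x)u,u')=(u,Y(e^{xL(1)}(-x^{-2})^{L(0)}v,x^{-1})u')$ for $v\in V_L$, and normalized by $(\iota(e_\beta),\iota(e_{-\beta}))=1$; it is nondegenerate and satisfies $(\iota(e_\alpha e_\beta),\iota(e_{\alpha'}e_{-\beta}))=(-1)^{\langle\alpha,\alpha\rangle/2}\varepsilon(\alpha,\alpha)^{-1}\delta_{\alpha+\alpha',0}$ for $\alpha,\alpha'\in L$. The graded $\mathbb{Z}$-dual is realized inside $V_{\beta+L}$ as $V_{-\beta+L,\mathbb{Z}}'=\{u\in V_{\beta+L}\mid(u,v)\in\mathbb{Z}\text{ for all }v\in V_{-\beta+L,\mathbb{Z}}\}$. *)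

theory Defs
  imports Complex_Main "HOL-Library.Poly_Mapping"
begin

section \<open>Integral forms\<close>

text \<open>All complex vector spaces below are given by a scalar multiplication on a type of class
  \<^class>\<open>ab_group_add\<close>.  Infinite sums of operators are written with \<^const>\<open>Sum_any\<close>; in every use
  only finitely many terms are nonzero.\<close>

definition zspan :: "(complex \<Rightarrow> 'v \<Rightarrow> 'v) \<Rightarrow> 'v set \<Rightarrow> 'v::ab_group_add set" where
  "zspan s S = module.span (\<lambda>(k::int). s (of_int k)) S"

definition integral_form :: "(complex \<Rightarrow> 'v \<Rightarrow> 'v) \<Rightarrow> 'v set \<Rightarrow> 'v::ab_group_add set \<Rightarrow> bool" where
  "integral_form s U A \<longleftrightarrow>
     (\<exists>B. \<not> module.dependent s B \<and> module.span s B = U \<and> A = zspan s B)"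

definition additive_subgroup :: "'v::ab_group_add set \<Rightarrow> bool" where
  "additive_subgroup A \<longleftrightarrow> 0 \<in> A \<and> (\<forall>u\<in>A. \<forall>v\<in>A. u - v \<in> A)"

text \<open>Complex bilinearity of a map on \<open>U \<times> W\<close>, for subspaces \<open>U\<close> and \<open>W\<close>.\<close>

definition bilinear_on :: "(complex \<Rightarrow> 'u \<Rightarrow> 'u) \<Rightarrow> (complex \<Rightarrow> 'w \<Rightarrow> 'w) \<Rightarrow> (complex \<Rightarrow> 'z \<Rightarrow> 'z)
    \<Rightarrow> 'u::ab_group_add set \<Rightarrow> 'w::ab_group_add set \<Rightarrow> ('u \<Rightarrow> 'w \<Rightarrow> 'z::ab_group_add) \<Rightarrow> bool" where
  "bilinear_on su sw sz U W f \<longleftrightarrow>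
     (\<forall>u\<in>U. \<forall>u'\<in>U. \<forall>w\<in>W. f (u + u') w = f u w + f u' w) \<and>
     (\<forall>u\<in>U. \<forall>w\<in>W. \<forall>w'\<in>W. f u (w + w') = f u w + f u w') \<and>
     (\<forall>c. \<forall>u\<in>U. \<forall>w\<in>W. f (su c u) w = sz c (f u w) \<and> f u (sw c w) = sz c (f u w))"


section \<open>Vertex algebras and modules\<close>

text \<open>\<open>Y u n w\<close> is \<open>u\<^sub>n w\<close>, where \<open>Y(u,x) = \<Sum>n. u\<^sub>n x^(-n-1)\<close>.  The last clause is the
  coefficient form (Borcherds identity) of the Jacobi identity; by lower truncation all three
  sums are finite.\<close>

definition vertex_action :: "(complex \<Rightarrow> 'v \<Rightarrow> 'v) \<Rightarrow> 'v::ab_group_add set \<Rightarrow> 'v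
    \<Rightarrow> ('v \<Rightarrow> int \<Rightarrow> 'v \<Rightarrow> 'v) \<Rightarrow> 'v set \<Rightarrow> bool" where
  "vertex_action s V vac Y W \<longleftrightarrow>
     module.subspace s W \<and>
     (\<forall>u\<in>V. \<forall>n. \<forall>w\<in>W. Y u n w \<in> W) \<and>
     (\<forall>n. bilinear_on s s s V W (\<lambda>u w. Y u n w)) \<and>
     (\<forall>u\<in>V. \<forall>w\<in>W. \<exists>N. \<forall>n\<ge>N. Y u n w = 0) \<and>
     (\<forall>w\<in>W. \<forall>n. Y vac n w = (if n = -1 then w else 0)) \<and>
     (\<forall>u\<in>V. \<forall>v\<in>V. \<forall>w\<in>W. \<forall>l m n.
        Sum_any (\<lambda>i::nat. s (of_int m gchoose i) (Y (Y u (l + int i) v) (m + n - int i) w)) =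
        Sum_any (\<lambda>i::nat. s ((-1) ^ i * (of_int l gchoose i))
          (Y u (l + m - int i) (Y v (n + int i) w)
            - s ((-1) powi l) (Y v (l + n - int i) (Y u (m + int i) w)))))"

definition vertex_algebra :: "(complex \<Rightarrow> 'v \<Rightarrow> 'v) \<Rightarrow> 'v::ab_group_add set \<Rightarrow> 'v
    \<Rightarrow> ('v \<Rightarrow> int \<Rightarrow> 'v \<Rightarrow> 'v) \<Rightarrow> bool" where
  "vertex_algebra s V vac Y \<longleftrightarrow>
     vac \<in> V \<and> vertex_action s V vac Y V \<and>
     (\<forall>u\<in>V. Y u (-1) vac = u \<and> (\<forall>n\<ge>0. Y u n vac = 0))"

definition vertex_module :: "(complex \<Rightarrow> 'v \<Rightarrow> 'v) \<Rightarrow> 'v::ab_group_add set \<Rightarrow> 'v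
    \<Rightarrow> ('v \<Rightarrow> int \<Rightarrow> 'v \<Rightarrow> 'v) \<Rightarrow> 'v set \<Rightarrow> bool" where
  "vertex_module s V vac Y W \<longleftrightarrow> vertex_algebra s V vac Y \<and> vertex_action s V vac Y W"

definition vertex_subring :: "'v::ab_group_add \<Rightarrow> ('v \<Rightarrow> int \<Rightarrow> 'v \<Rightarrow> 'v) \<Rightarrow> 'v set \<Rightarrow> bool" where
  "vertex_subring vac Y U \<longleftrightarrow>
     additive_subgroup U \<and> vac \<in> U \<and> (\<forall>u\<in>U. \<forall>v\<in>U. \<forall>n. Y u n v \<in> U)"

text \<open>The coefficient of \<open>x^k\<close> in \<open>exp (\<Sum>m\<ge>1. a m x^m)\<close>, for operators \<open>a m\<close>: expanding
  \<open>\<Sum>j. (\<Sum>m\<ge>1. a m x^m)^j / j!\<close> gives a sum over the compositions \<open>ns\<close> of \<open>k\<close>, where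
  \<open>j = length ns\<close>.\<close>

definition exp_coeff :: "(complex \<Rightarrow> 'v \<Rightarrow> 'v) \<Rightarrow> (nat \<Rightarrow> 'v \<Rightarrow> 'v) \<Rightarrow> nat \<Rightarrow> 'v \<Rightarrow> 'v::ab_group_add" where
  "exp_coeff s a k v =
     (\<Sum>ns\<in>{ns. 0 \<notin> set ns \<and> sum_list ns = k}. s (1 / fact (length ns)) (foldr a ns v))"


section \<open>The underlying spaces\<close>

text \<open>\<open>M(1)\<close> is realized as the polynomial ring in variables \<open>(b, n)\<close>, standing for \<open>b(-n)\<close>, where
  \<open>b\<close> runs over a basis of \<open>\<hh>\<close> and \<open>n \<ge> 1\<close>.  An element of \<open>M(1) \<otimes> \<complex>{L\<degree>}\<close> is a finitely supported
  function assigning to \<open>\<gamma>\<close> the polynomial \<open>p\<close> in its term \<open>p \<otimes> e\<^sub>\<gamma>\<close>.  These types also contain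
  elements with spurious variables or exponents; the spaces themselves are the carrier sets
  defined below.\<close>

type_synonym 'h fock = "(('h \<times> nat) \<Rightarrow>\<^sub>0 nat) \<Rightarrow>\<^sub>0 complex"
type_synonym 'h lspace = "'h \<Rightarrow>\<^sub>0 'h fock"

definition fscale :: "complex \<Rightarrow> 'h fock \<Rightarrow> 'h fock" where
  "fscale c = Poly_Mapping.map ((*) c)"

definition vscale :: "complex \<Rightarrow> 'h lspace \<Rightarrow> 'h lspace" where
  "vscale c = Poly_Mapping.map (fscale c)"

definition fvar :: "'h \<times> nat \<Rightarrow> 'h fock" where
  "fvar i = Poly_Mapping.single (Poly_Mapping.single i 1) 1"

definition fderiv :: "'h \<times> nat \<Rightarrow> 'h fock \<Rightarrow> 'h fock" where
  "fderiv i p = (\<Sum>m\<in>Poly_Mapping.keys p.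
     Poly_Mapping.single (m - Poly_Mapping.single i 1)
       (of_nat (Poly_Mapping.lookup m i) * Poly_Mapping.lookup p m))"

definition iota :: "'h \<Rightarrow> 'h lspace" where
  "iota \<gamma> = Poly_Mapping.single \<gamma> 1"

lemma lookup_fscale [simp]: "Poly_Mapping.lookup (fscale c p) m = c * Poly_Mapping.lookup p m"
  by (simp add: fscale_def Poly_Mapping.map.rep_eq when_def)

lemma vector_space_fscale: "vector_space fscale"
  by unfold_locales
    (simp_all add: poly_mapping_eq_iff fun_eq_iff lookup_add algebra_simps)

lemma lookup_vscale [simp]:
  "Poly_Mapping.lookup (vscale c v) \<gamma> = fscale c (Poly_Mapping.lookup v \<gamma>)"
proof -
  interpret F: vector_space fscale by (rule vector_space_fscale)
  show ?thesis by (simp add: vscale_def Poly_Mapping.map.rep_eq when_def)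
qed

lemma vector_space_vscale: "vector_space vscale"
  by unfold_locales
    (simp_all add: poly_mapping_eq_iff fun_eq_iff lookup_add algebra_simps)


section \<open>Even lattices\<close>

text \<open>\<open>\<hh>\<close> is the whole type \<open>'h\<close>, and \<open>L\<close> is the \<open>\<int>\<close>-span of the basis \<open>Basis\<close> of \<open>\<hh>\<close>, so that
  \<open>\<hh> = \<complex> \<otimes> L\<close>.  The rank may be \<open>0\<close> and the form may be indefinite.\<close>

locale even_lattice = finite_dimensional_vector_space scale Basis
  for scale :: "complex \<Rightarrow> 'h::ab_group_add \<Rightarrow> 'h" and Basis :: "'h set" +
  fixes form :: "'h \<Rightarrow> 'h \<Rightarrow> complex"
  assumes form_bilinear: "bilinear_on scale scale (*) UNIV UNIV form"
    and form_sym: "form h h' = form h' h"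
    and form_integral: "\<lbrakk>\<alpha> \<in> zspan scale Basis; \<alpha>' \<in> zspan scale Basis\<rbrakk> \<Longrightarrow> form \<alpha> \<alpha>' \<in> \<int>"
    and form_even: "\<alpha> \<in> zspan scale Basis \<Longrightarrow> \<exists>k::int. form \<alpha> \<alpha> = of_int (2 * k)"
    and form_nondegenerate:
      "\<lbrakk>\<alpha> \<in> zspan scale Basis; \<And>\<alpha>'. \<alpha>' \<in> zspan scale Basis \<Longrightarrow> form \<alpha> \<alpha>' = 0\<rbrakk> \<Longrightarrow> \<alpha> = 0"
begin

definition lat :: "'h set" where
  "lat = zspan scale Basis"

definition dual_lat :: "'h set" where
  "dual_lat = {\<beta>. \<forall>\<alpha>\<in>lat. form \<alpha> \<beta> \<in> \<int>}"

definition fock_space :: "'h fock set" where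
  "fock_space = {p. \<forall>m\<in>Poly_Mapping.keys p. Poly_Mapping.keys m \<subseteq> Basis \<times> {1..}}"

text \<open>\<open>V\<^bsub>\<beta>+L\<^esub> = M(1) \<otimes> \<complex>{\<beta>+L}\<close>.\<close>

definition coset_space :: "'h \<Rightarrow> 'h lspace set" where
  "coset_space \<beta> = {v. \<forall>\<gamma>\<in>Poly_Mapping.keys v. \<gamma> - \<beta> \<in> lat \<and> Poly_Mapping.lookup v \<gamma> \<in> fock_space}"

text \<open>The operator \<open>h(n)\<close>.  For \<open>n > 0\<close> it is the derivation of the polynomial ring with
  \<open>h(n) b(-n) = n \<langle>h,b\<rangle>\<close>, whence \<open>[h(m),h'(n)] = m \<langle>h,h'\<rangle> \<delta>\<^bsub>m+n,0\<^esub>\<close>.\<close>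

definition heis :: "'h \<Rightarrow> int \<Rightarrow> 'h lspace \<Rightarrow> 'h lspace" where
  "heis h n v =
     (if n < 0 then
        Poly_Mapping.map
          (\<lambda>p. (\<Sum>b\<in>Basis. fscale (representation Basis h b) (fvar (b, nat (-n)))) * p) v
      else if n > 0 then
        Poly_Mapping.map (\<lambda>p. \<Sum>b\<in>Basis. fscale (of_int n * form h b) (fderiv (b, nat n) p)) v
      else Poly_Mapping.mapp (\<lambda>\<gamma> p. fscale (form h \<gamma>) p) v)"

text \<open>\<open>E\<^sup>-(\<beta>,x) = \<Sum>k\<ge>0. E_minus \<beta> k x^k\<close> and \<open>E\<^sup>+(\<beta>,x) = \<Sum>k\<ge>0. E_plus \<beta> k x^(-k)\<close>.\<close>

definition E_minus :: "'h \<Rightarrow> nat \<Rightarrow> 'h lspace \<Rightarrow> 'h lspace" where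
  "E_minus \<beta> = exp_coeff vscale (\<lambda>m v. vscale (1 / of_int (- int m)) (heis \<beta> (- int m) v))"

definition E_plus :: "'h \<Rightarrow> nat \<Rightarrow> 'h lspace \<Rightarrow> 'h lspace" where
  "E_plus \<beta> = exp_coeff vscale (\<lambda>m v. vscale (1 / of_int (int m)) (heis \<beta> (int m) v))"

definition dual_vec :: "'h \<Rightarrow> 'h" where
  "dual_vec b = (THE u. \<forall>b'\<in>Basis. form b' u = (if b' = b then 1 else 0))"

definition conformal_vector :: "'h lspace" where
  "conformal_vector =
     vscale (1 / 2) (\<Sum>b\<in>Basis. heis b (-1) (heis (dual_vec b) (-1) (iota 0)))"

end


section \<open>The twisted group algebra and the vertex operators\<close>

locale lattice_cocycle = even_lattice scale Basis form
  for scale :: "complex \<Rightarrow> 'h::ab_group_add \<Rightarrow> 'h" and Basis form +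
  fixes eps :: "'h \<Rightarrow> 'h \<Rightarrow> complex"
  assumes eps_add_left: "\<lbrakk>\<beta> \<in> dual_lat; \<beta>' \<in> dual_lat; \<gamma> \<in> dual_lat\<rbrakk>
      \<Longrightarrow> eps (\<beta> + \<beta>') \<gamma> = eps \<beta> \<gamma> * eps \<beta>' \<gamma>"
    and eps_add_right: "\<lbrakk>\<beta> \<in> dual_lat; \<gamma> \<in> dual_lat; \<gamma>' \<in> dual_lat\<rbrakk>
      \<Longrightarrow> eps \<beta> (\<gamma> + \<gamma>') = eps \<beta> \<gamma> * eps \<beta> \<gamma>'"
    and eps_root_of_unity: "\<lbrakk>\<beta> \<in> dual_lat; \<gamma> \<in> dual_lat\<rbrakk> \<Longrightarrow> \<exists>N::nat. N > 0 \<and> eps \<beta> \<gamma> ^ N = 1"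
    and eps_commutator: "\<lbrakk>\<alpha> \<in> lat; \<alpha>' \<in> lat; form \<alpha> \<alpha>' = of_int k\<rbrakk>
      \<Longrightarrow> eps \<alpha> \<alpha>' * inverse (eps \<alpha>' \<alpha>) = (-1) powi k"
    and eps_sign: "\<lbrakk>\<alpha> \<in> lat; \<alpha>' \<in> lat\<rbrakk> \<Longrightarrow> eps \<alpha> \<alpha>' \<in> {1, -1}"
begin

text \<open>Left multiplication by \<open>e\<^sub>\<alpha>\<close>; in particular \<open>e_op \<alpha> (iota \<beta>)\<close> is \<open>\<iota>(e\<^sub>\<alpha> e\<^sub>\<beta>)\<close>.\<close>

definition e_op :: "'h \<Rightarrow> 'h lspace \<Rightarrow> 'h lspace" where
  "e_op \<alpha> v = (\<Sum>\<gamma>\<in>Poly_Mapping.keys v.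
     Poly_Mapping.single (\<alpha> + \<gamma>) (fscale (eps \<alpha> \<gamma>) (Poly_Mapping.lookup v \<gamma>)))"

text \<open>The coefficient of \<open>x^(-n-1)\<close> in \<open>E\<^sup>-(-\<alpha>,x) E\<^sup>+(-\<alpha>,x) e\<^sub>\<alpha> x\<^sup>\<alpha> v\<close>.  On the component of \<open>v\<close>
  at \<open>e\<^sub>\<gamma>\<close> the term with indices \<open>i\<close>, \<open>j\<close> carries the power \<open>x^(i - j + \<langle>\<alpha>,\<gamma>\<rangle>)\<close>.\<close>

definition lattice_vop :: "'h \<Rightarrow> int \<Rightarrow> 'h lspace \<Rightarrow> 'h lspace" where
  "lattice_vop \<alpha> n v = Sum_any (\<lambda>(\<gamma>, i, j).
     if of_int (int i - int j) + form \<alpha> \<gamma> = of_int (- n - 1)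
     then E_minus (-\<alpha>) i (E_plus (-\<alpha>) j
            (e_op \<alpha> (Poly_Mapping.single \<gamma> (Poly_Mapping.lookup v \<gamma>))))
     else 0)"

text \<open>The \<open>\<int>\<close>-span of the coefficients of \<open>E\<^sup>-(-\<beta>\<^sub>1,x\<^sub>1) \<cdots> E\<^sup>-(-\<beta>\<^sub>k,x\<^sub>k) \<iota>(e\<^sub>\<alpha> e\<^sub>\<beta>)\<close> with all \<open>\<beta>\<^sub>i \<in> S\<close>
  and \<open>\<alpha> \<in> L\<close>.  The list \<open>bs\<close> holds the pairs of \<open>\<beta>\<^sub>i\<close> and the exponent of \<open>x\<^sub>i\<close>.\<close>

definition E_minus_span :: "'h set \<Rightarrow> 'h \<Rightarrow> 'h lspace set" where
  "E_minus_span S \<beta> = zspan vscale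
     {foldr (\<lambda>(\<beta>', k). E_minus (-\<beta>') k) bs (e_op \<alpha> (iota \<beta>)) | bs \<alpha>.
        fst ` set bs \<subseteq> S \<and> \<alpha> \<in> lat}"

end


section \<open>Lattice vertex algebras, their modules and integral forms\<close>

text \<open>The vertex operator map of \<open>V\<^sub>L\<close> and of its modules \<open>V\<^bsub>\<beta>+L\<^esub>\<close>.  Since the \<open>\<iota>(e\<^sub>\<alpha>)\<close> generate
  \<open>V\<^sub>L\<close>, these conditions determine \<open>Y u n w\<close> for all \<open>u\<close> in \<open>V\<^sub>L\<close> and \<open>w\<close> in any \<open>V\<^bsub>\<beta>+L\<^esub>\<close>,
  \<open>\<beta> \<in> L\<degree>\<close>.\<close>

locale lattice_vertex_algebra = lattice_cocycle scale Basis form eps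
  for scale :: "complex \<Rightarrow> 'h::ab_group_add \<Rightarrow> 'h" and Basis form eps +
  fixes Y :: "'h lspace \<Rightarrow> int \<Rightarrow> 'h lspace \<Rightarrow> 'h lspace"
  assumes vertex_algebra_V: "vertex_algebra vscale (coset_space 0) (iota 0) Y"
    and vertex_module_V: "\<beta> \<in> dual_lat
      \<Longrightarrow> vertex_module vscale (coset_space 0) (iota 0) Y (coset_space \<beta>)"
    and Y_iota: "\<lbrakk>\<alpha> \<in> lat; \<beta> \<in> dual_lat; w \<in> coset_space \<beta>\<rbrakk>
      \<Longrightarrow> Y (iota \<alpha>) n w = lattice_vop \<alpha> n w"
begin

definition L_op :: "int \<Rightarrow> 'h lspace \<Rightarrow> 'h lspace" where
  "L_op n = Y conformal_vector (n + 1)"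

definition V_int :: "'h lspace set" where
  "V_int = \<Inter>{U. U \<subseteq> coset_space 0 \<and> vertex_subring (iota 0) Y U \<and> iota ` lat \<subseteq> U}"

definition coset_int :: "'h \<Rightarrow> 'h lspace set" where
  "coset_int \<beta> = \<Inter>{W. W \<subseteq> coset_space \<beta> \<and> additive_subgroup W \<and> iota \<beta> \<in> W \<and>
     (\<forall>u\<in>V_int. \<forall>n. \<forall>w\<in>W. Y u n w \<in> W)}"

text \<open>A bilinear pairing of \<open>V\<^bsub>\<beta>+L\<^esub>\<close> and \<open>V\<^bsub>-\<beta>+L\<^esub>\<close> satisfying
  \<open>(Y(v,x)u, u') = (u, Y(e^(x L(1)) (-x^(-2))^(L(0)) v, x^(-1)) u')\<close>, normalized at \<open>\<iota>(e\<^sub>\<beta>)\<close>.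
  Invariance is stated for \<open>v\<close> of \<open>L(0)\<close>-weight \<open>k\<close>, which suffices because such \<open>v\<close> span \<open>V\<^sub>L\<close>.
  For these the vector on the right is
  \<open>\<Sum>j n. (-1)^k / j! (L(1)^j v)\<^sub>n u' x^(j - 2k + n + 1)\<close>, and the two sides are compared at
  \<open>x^(-m-1)\<close>.  The sum over \<open>j\<close> is finite because \<open>L(1)\<close> is locally nilpotent on \<open>V\<^sub>L\<close>.\<close>

definition invariant_pairing :: "'h \<Rightarrow> ('h lspace \<Rightarrow> 'h lspace \<Rightarrow> complex) \<Rightarrow> bool" where
  "invariant_pairing \<beta> pr \<longleftrightarrow>
     bilinear_on vscale vscale (*) (coset_space \<beta>) (coset_space (-\<beta>)) pr \<and>
     (\<forall>v\<in>coset_space 0. \<forall>k::int. L_op 0 v = vscale (of_int k) v \<longrightarrow>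
        (\<forall>u\<in>coset_space \<beta>. \<forall>u'\<in>coset_space (-\<beta>). \<forall>m.
           pr (Y v m u) u' =
           (-1) powi k * Sum_any (\<lambda>j::nat. 1 / fact j *
             pr u (Y ((L_op 1 ^^ j) v) (2 * k - int j - m - 2) u')))) \<and>
     pr (iota \<beta>) (iota (-\<beta>)) = 1"

text \<open>\<open>graded_dual pr \<beta>\<close> is the \<open>\<int>\<close>-dual of \<open>V\<^bsub>-\<beta>+L,\<int>\<^esub>\<close>, realized inside \<open>V\<^bsub>\<beta>+L\<^esub>\<close>.\<close>

definition graded_dual :: "('h lspace \<Rightarrow> 'h lspace \<Rightarrow> complex) \<Rightarrow> 'h \<Rightarrow> 'h lspace set" where
  "graded_dual pr \<beta> = {u \<in> coset_space \<beta>. \<forall>v\<in>coset_int (-\<beta>). pr u v \<in> \<int>}"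

end

end

theory Submission
  imports Defs "HOL-Library.Multiset"
begin

text \<open>Multiplication by \<open>cpl \<beta> k\<close>, the coefficient of \<open>x^k\<close> in \<open>E\<^sup>-(-\<beta>,x)\<close>, behaves like multiplication by
  a complete symmetric function, and \<open>E\<^sup>+(-\<alpha>,x)\<close> acts by substitution on the power sums.  Since
  \<open>E\<^sup>+(-\<alpha>,x) E\<^sup>-(-\<beta>,y) = (1 - y/x)^\<langle>\<alpha>,\<beta>\<rangle> E\<^sup>-(-\<beta>,y) E\<^sup>+(-\<alpha>,x)\<close> has integral coefficients for \<open>\<alpha> \<in> L\<close> and
  \<open>\<beta> \<in> L\<degree>\<close>, the span of the \<open>E\<^sup>-\<close>-coefficients with \<open>\<beta>\<^sub>i \<in> L\<degree>\<close> is stable under the vertex operators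
  \<open>\<iota>(e\<^sub>\<alpha>)\<^sub>n\<close>.  By invariance these operators are, up to sign, their own adjoints, and
  \<open>(u, \<iota>(e\<^bsub>-\<beta>\<^esub>))\<close> is the constant term of \<open>u\<close> at \<open>e\<^sub>\<beta>\<close>; hence this span is contained in the dual.

  Conversely the dual is stable under the \<open>\<iota>(e\<^sub>\<alpha>)\<^sub>n\<close>, so all constant terms of
  \<open>E\<^sup>+(-\<alpha>\<^sub>k,x\<^sub>k) \<cdots> E\<^sup>+(-\<alpha>\<^sub>1,x\<^sub>1) p\<close> are integral for a component \<open>p\<close> of one of its elements (up to the cocycle).
  Expand \<open>p\<close> in monomials in the \<open>cpl b* n\<close> for the basis \<open>b*\<close> of \<open>L\<degree>\<close> dual to \<open>Basis\<close>.  As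
  \<open>E\<^sup>+(-b,x)\<close> turns \<open>E\<^sup>-(-b*,y)\<close> into \<open>(1 - y/x) E\<^sup>-(-b*,y)\<close>, a monomial with \<open>K\<close> factors \<open>cpl b* n\<close> is lowered
  in all these factors by the coefficient of \<open>x^(-K)\<close> and killed by all later ones, so the expansion
  has integral coefficients by induction on the degree.\<close>

section \<open>Coefficients of exponentials of commuting operators\<close>

text \<open>Two ingredients are not given and have to be derived. \<open>Y\<close> is prescribed
  only on the vectors \<open>iota \<alpha>\<close>, whereas the adjoint formula needs the conformal
  vector to act on them; skew symmetry shows that \<open>iota \<alpha>\<close> has weight
  \<open>form \<alpha> \<alpha> / 2\<close> and is killed by \<open>L_op 1\<close>. The pairing is
  known only to be invariant and normalized at one pair of vectors, so its values against
  \<open>iota (- \<beta>)\<close> are extracted from the explicit vertex operators. These values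
  suffice because the integral form being dualized is generated by that vector.

  The obstacle in the converse is that a mode of a vertex operator never yields E^+ alone: E^- of
  the same \<alpha> is mixed in, and so are cocycle values involving \<beta>, which are merely roots
  of unity. The normalizing factor \<open>eps (\<beta> - \<gamma>) \<gamma>\<close> on the component
  at \<gamma> leaves only cocycle values on L, that is, signs. Linear independence of the final
  basis comes out of the same integrality statement, applied to rescaled relations.\<close>

definition comps :: "nat \<Rightarrow> nat \<Rightarrow> nat list set" where
  "comps j k = {ns. length ns = j \<and> 0 \<notin> set ns \<and> sum_list ns = k}"

lemma length_le_sum_list:
  fixes ns :: "nat list"
  shows "0 \<notin> set ns \<Longrightarrow> length ns \<le> sum_list ns"
  by (induction ns) auto

lemma finite_compositions: "finite {ns::nat list. 0 \<notin> set ns \<and> sum_list ns = k}"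
proof (rule finite_subset)
  show "{ns::nat list. 0 \<notin> set ns \<and> sum_list ns = k} \<subseteq> {ns. set ns \<subseteq> {..k} \<and> length ns \<le> k}"
    using length_le_sum_list member_le_sum_list by fastforce
  show "finite {ns. set ns \<subseteq> {..k} \<and> length ns \<le> k}"
    by (rule finite_lists_length_le) simp
qed

lemma finite_comps [simp]: "finite (comps j k)"
  by (rule finite_subset[OF _ finite_compositions[of k]]) (auto simp: comps_def)

lemma comps_0: "comps 0 k = (if k = 0 then {[]} else {})"
  by (auto simp: comps_def)

lemma comps_Suc: "comps (Suc j) k = (\<Union>m\<in>{1..k}. (#) m ` comps j (k - m))"
proof (intro subset_antisym subsetI)
  fix ns assume "ns \<in> comps (Suc j) k"
  then obtain m ms where "ns = m # ms" "length ms = j" "m \<noteq> 0" "0 \<notin> set ms" "m + sum_list ms = k"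
    by (auto simp: comps_def length_Suc_conv)
  then show "ns \<in> (\<Union>m\<in>{1..k}. (#) m ` comps j (k - m))"
    by (intro UN_I[of m]) (auto simp: comps_def)
qed (auto simp: comps_def)

text \<open>The coefficient of \<open>x^k\<close> in the \<open>j\<close>-th power of the series
  \<open>\<Sum>m\<ge>1. a m x^m\<close>.\<close>

definition iter_coeff :: "(nat \<Rightarrow> 'v \<Rightarrow> 'v) \<Rightarrow> nat \<Rightarrow> nat \<Rightarrow> 'v \<Rightarrow> 'v::ab_group_add" where
  "iter_coeff a j k v = (\<Sum>ns\<in>comps j k. foldr a ns v)"

lemma iter_coeff_0: "iter_coeff a 0 k v = (if k = 0 then v else 0)"
  by (simp add: iter_coeff_def comps_0)

lemma iter_coeff_Suc:
  assumes "\<And>m. module_hom s s (a m)"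
  shows "iter_coeff a (Suc j) k v = (\<Sum>m=1..k. a m (iter_coeff a j (k - m) v))"
proof -
  have "iter_coeff a (Suc j) k v = (\<Sum>m=1..k. \<Sum>ns\<in>(#) m ` comps j (k - m). foldr a ns v)"
    unfolding iter_coeff_def comps_Suc by (rule sum.UNION_disjoint) auto
  also have "\<dots> = (\<Sum>m=1..k. a m (iter_coeff a j (k - m) v))"
    by (intro sum.cong refl)
      (simp add: sum.reindex iter_coeff_def module_hom.sum[OF assms])
  finally show ?thesis .
qed

text \<open>A composition of \<open>k\<close> has at most \<open>k\<close> parts, so any
  \<open>N \<ge> k\<close> bounds the sum. The freedom in \<open>N\<close> allows one common bound
  for several coefficients.\<close>

lemma exp_coeff_iter_coeff:
  assumes "module s" "k \<le> N"
  shows "exp_coeff s a k v = (\<Sum>j\<le>N. s (1 / fact j) (iter_coeff a j k v))"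
proof -
  interpret module s by fact
  have eq: "{ns. 0 \<notin> set ns \<and> sum_list ns = k} = (\<Union>j\<le>N. comps j k)"
    using \<open>k \<le> N\<close> length_le_sum_list by (fastforce simp: comps_def)
  have "exp_coeff s a k v = (\<Sum>j\<le>N. \<Sum>ns\<in>comps j k. s (1 / fact (length ns)) (foldr a ns v))"
    unfolding exp_coeff_def eq
    by (rule sum.UNION_disjoint) (use finite_comps in blast, use finite_comps in blast, auto simp: comps_def)
  also have "\<dots> = (\<Sum>j\<le>N. s (1 / fact j) (iter_coeff a j k v))"
    by (intro sum.cong refl) (simp add: iter_coeff_def scale_sum_right comps_def)
  finally show ?thesis .
qed

lemma exp_coeff_0: "module s \<Longrightarrow> exp_coeff s a 0 v = v"
  using exp_coeff_iter_coeff[of s 0 0 a v] by (simp add: iter_coeff_0 module.scale_one)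

text \<open>Coefficient form of \<open>x (A^(j+1))' = (j+1) (x A') A^j\<close> for
  \<open>A = \<Sum>m. a m x^m\<close>, where the derivative produces the weights \<open>k\<close>
  and \<open>m\<close>.\<close>

lemma iter_coeff_weighted:
  assumes hom: "\<And>m. module_hom s s (a m)" and com: "\<And>m n x. a m (a n x) = a n (a m x)"
  shows "s (of_nat k) (iter_coeff a (Suc j) k v) =
    s (of_nat (Suc j)) (\<Sum>m=1..k. s (of_nat m) (a m (iter_coeff a j (k - m) v)))"
proof (induction j arbitrary: k)
  case 0
  interpret module s using hom module_hom_def by blast
  have "s (of_nat k) (iter_coeff a (Suc 0) k v)
      = (\<Sum>m=1..k. s (of_nat k) (a m (iter_coeff a 0 (k - m) v)))"
    by (simp add: iter_coeff_Suc[OF hom] scale_sum_right)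
  also have "\<dots> = (\<Sum>m=1..k. s (of_nat m) (a m (iter_coeff a 0 (k - m) v)))"
    by (intro sum.cong refl) (auto simp: iter_coeff_0 module_hom.zero[OF hom])
  finally show ?case by simp
next
  case (Suc j)
  interpret module s using hom module_hom_def by blast
  let ?A = "iter_coeff a"
  \<comment> \<open>Exchanging the names of the first two parts moves the weight onto
    \<open>m\<close>; commutativity then lets the inner sum be read as
    \<open>iter_coeff a (Suc j)\<close>.\<close>
  have swap: "(\<Sum>m=1..k. \<Sum>m'=1..k-m. s (of_nat m') (a m (a m' (?A j (k - m - m') v))))
      = (\<Sum>m=1..k. \<Sum>m'=1..k-m. s (of_nat m) (a m' (a m (?A j (k - m - m') v))))"
  proof -
    have "(\<Sum>m=1..k. \<Sum>m'=1..k-m. s (of_nat m') (a m (a m' (?A j (k - m - m') v))))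
      = (\<Sum>(m,m')\<in>(SIGMA m:{1..k}. {1..k-m}). s (of_nat m') (a m (a m' (?A j (k - m - m') v))))"
      by (simp add: sum.Sigma)
    also have "\<dots> = (\<Sum>(m,m')\<in>(SIGMA m:{1..k}. {1..k-m}). s (of_nat m) (a m' (a m (?A j (k - m - m') v))))"
      by (rule sum.reindex_bij_witness[where i="\<lambda>(x,y). (y,x)" and j="\<lambda>(x,y). (y,x)"])
        (auto simp: add.commute)
    finally show ?thesis by (simp add: sum.Sigma)
  qed
  have "s (of_nat k) (?A (Suc (Suc j)) k v)
      = (\<Sum>m=1..k. s (of_nat m) (a m (?A (Suc j) (k - m) v)) + a m (s (of_nat (k - m)) (?A (Suc j) (k - m) v)))"
    unfolding iter_coeff_Suc[where a=a and j="Suc j", OF hom] scale_sum_right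
    by (intro sum.cong refl)
      (simp add: module_hom.scale[OF hom] scale_left_distrib[symmetric] flip: of_nat_add)
  also have "\<dots> = (\<Sum>m=1..k. s (of_nat m) (a m (?A (Suc j) (k - m) v)))
      + s (of_nat (Suc j)) (\<Sum>m=1..k. \<Sum>m'=1..k-m. s (of_nat m') (a m (a m' (?A j (k - m - m') v))))"
    unfolding Suc.IH
    by (simp add: sum.distrib module_hom.scale[OF hom] module_hom.sum[OF hom] scale_sum_right
        del: of_nat_Suc)
  also have "(\<Sum>m=1..k. \<Sum>m'=1..k-m. s (of_nat m') (a m (a m' (?A j (k - m - m') v))))
     = (\<Sum>m=1..k. s (of_nat m) (a m (?A (Suc j) (k - m) v)))"
    unfolding swap
    by (simp add: iter_coeff_Suc[where a=a and j=j, OF hom] module_hom.sum[OF hom] scale_sum_right com)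
  finally show ?case
    by (simp only: of_nat_Suc[of "Suc j"] scale_left_distrib scale_one)
qed

text \<open>The logarithmic derivative \<open>x (exp A)' = (x A') exp A\<close>. In characteristic 0
  it determines all coefficients for \<open>k > 0\<close>, so later arguments run by recursion on
  \<open>k\<close> and not over compositions.\<close>

lemma exp_coeff_rec:
  assumes "vector_space s" 
    and hom: "\<And>m. module_hom s s (a m)" and com: "\<And>m n x. a m (a n x) = a n (a m x)"
  shows "s (of_nat k) (exp_coeff s a k v) =
    (\<Sum>m=1..k. s (of_nat m) (a m (exp_coeff s a (k - m) v)))"
proof (cases k)
  case 0
  interpret vector_space s by fact
  show ?thesis using 0 by simp
next
  case (Suc N)
  interpret vector_space s by fact
  have mod: "module s" by unfold_locales
  let ?A = "iter_coeff a"
  have "s (of_nat k) (exp_coeff s a k v) = (\<Sum>j\<le>k. s (1 / fact j) (s (of_nat k) (?A j k v)))"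
    by (simp add: exp_coeff_iter_coeff[OF mod order.refl] scale_sum_right mult.commute)
  also have "\<dots> = (\<Sum>j\<le>N. s (1 / fact (Suc j)) (s (of_nat k) (?A (Suc j) k v)))"
    unfolding Suc sum.atMost_Suc_shift by (simp add: iter_coeff_0)
  also have "\<dots> = (\<Sum>j\<le>N. s (1 / fact j) (\<Sum>m=1..k. s (of_nat m) (a m (?A j (k - m) v))))"
    unfolding iter_coeff_weighted[OF hom com] by (simp del: of_nat_Suc)
  also have "\<dots> = (\<Sum>m=1..k. s (of_nat m) (a m (\<Sum>j\<le>N. s (1 / fact j) (?A j (k - m) v))))"
    unfolding scale_sum_right module_hom.sum[OF hom]
    by (subst sum.swap) (simp add: module_hom.scale[OF hom] mult.commute)
  also have "\<dots> = (\<Sum>m=1..k. s (of_nat m) (a m (exp_coeff s a (k - m) v)))"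
    by (intro sum.cong refl, subst exp_coeff_iter_coeff[OF mod, where N=N]) (auto simp: Suc)
  finally show ?thesis .
qed

lemma foldr_hom:
  assumes "\<And>m v. m \<in> set ns \<Longrightarrow> T (a m v) = a' m (T v)"
  shows "T (foldr a ns v) = foldr a' ns (T v)"
  using assms by (induction ns) auto

text \<open>Compositions have no part 0, so intertwining is required for \<open>m > 0\<close> only.
  This matters because \<open>heis\<close> follows a different formula at index 0.\<close>

lemma exp_coeff_transfer:
  assumes T: "module_hom s s' T" and a: "\<And>m v. m > 0 \<Longrightarrow> T (a m v) = a' m (T v)"
  shows "T (exp_coeff s a k v) = exp_coeff s' a' k (T v)"
proof -
  have "T (foldr a ns v) = foldr a' ns (T v)" if "0 \<notin> set ns" for ns
    by (rule foldr_hom) (metis a that gr0I)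
  then show ?thesis
    unfolding exp_coeff_def module_hom.sum[OF T] module_hom.scale[OF T]
    by (intro sum.cong refl) simp
qed

lemma module_hom_foldr:
  "module s \<Longrightarrow> (\<And>m. module_hom s s (a m)) \<Longrightarrow> module_hom s s (foldr a ns)"
proof (induction ns)
  case Nil
  then show ?case by (simp add: module_hom_iff)
next
  case (Cons n ns)
  then show ?case by (auto simp: module_hom_iff o_def)
qed

lemma module_hom_exp_coeff:
  assumes "vector_space s" and hom: "\<And>m. module_hom s s (a m)"
  shows "module_hom s s (exp_coeff s a k)"
proof -
  interpret vector_space s by fact
  have mod: "module s" by unfold_locales
  show ?thesis
    unfolding module_hom_iff exp_coeff_def
    by (simp add: mod module_hom.add[OF module_hom_foldr[OF mod hom]] 
        module_hom.scale[OF module_hom_foldr[OF mod hom]] scale_sum_right scale_right_distrib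
        sum.distrib mult.commute)
qed

section \<open>Integral spans and integral forms\<close>

lemma module_of_int: "vector_space s \<Longrightarrow> module (\<lambda>k::int. s (of_int k))"
proof -
  assume "vector_space s"
  then interpret vector_space s .
  show ?thesis by unfold_locales (simp_all add: scale_right_distrib scale_left_distrib)
qed

lemma additive_subgroup_uminus: "additive_subgroup A \<Longrightarrow> u \<in> A \<Longrightarrow> - u \<in> A"
  unfolding additive_subgroup_def by (metis diff_0)

lemma additive_subgroup_add: "additive_subgroup A \<Longrightarrow> u \<in> A \<Longrightarrow> v \<in> A \<Longrightarrow> u + v \<in> A"
  using additive_subgroup_uminus[of A v] unfolding additive_subgroup_def
  by (metis diff_minus_eq_add)

lemma additive_subgroup_sum:
  "additive_subgroup A \<Longrightarrow> (\<And>i. i \<in> I \<Longrightarrow> f i \<in> A) \<Longrightarrow> sum f I \<in> A"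
  by (induction I rule: infinite_finite_induct)
    (auto simp: additive_subgroup_add, auto simp: additive_subgroup_def)

lemma additive_subgroup_Sum_any:
  "additive_subgroup A \<Longrightarrow> (\<And>i. f i \<in> A) \<Longrightarrow> Sum_any f \<in> A"
  unfolding Sum_any.expand_set by (rule additive_subgroup_sum)

lemma additive_subgroup_scale_int:
  assumes "vector_space s" "additive_subgroup A" "u \<in> A"
  shows "s (of_int k) u \<in> A"
proof -
  interpret vector_space s by fact
  have nat: "s (of_nat n) u \<in> A" for n
  proof (induction n)
    case 0
    then show ?case using assms by (simp add: additive_subgroup_def)
  next
    case (Suc n)
    then show ?case using assms by (simp add: scale_left_distrib additive_subgroup_add)
  qed
  show ?thesis
  proof (cases k rule: int_cases2)
    case (nonneg n)
    then show ?thesis using nat by simp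
  next
    case (nonpos n)
    then show ?thesis using additive_subgroup_uminus[OF assms(2) nat[of n]] by simp
  qed
qed

lemma additive_subgroup_subspace:
  assumes "vector_space s" "additive_subgroup A"
  shows "module.subspace (\<lambda>k::int. s (of_int k)) A"
proof -
  interpret M: module "\<lambda>k::int. s (of_int k)" by (rule module_of_int) fact
  show ?thesis
    by (rule M.subspaceI)
      (use assms in \<open>auto simp: additive_subgroup_add additive_subgroup_scale_int additive_subgroup_def\<close>)
qed

lemma additive_subgroup_zspan: "vector_space s \<Longrightarrow> additive_subgroup (zspan s S)"
  unfolding zspan_def additive_subgroup_def
  using module.span_zero[OF module_of_int] module.span_diff[OF module_of_int] by blast

lemma zspan_base: "vector_space s \<Longrightarrow> a \<in> S \<Longrightarrow> a \<in> zspan s S"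
  unfolding zspan_def by (rule module.span_base[OF module_of_int])

lemma zspan_minimal: "vector_space s \<Longrightarrow> additive_subgroup A \<Longrightarrow> S \<subseteq> A \<Longrightarrow> zspan s S \<subseteq> A"
  unfolding zspan_def
  by (rule module.span_minimal[OF module_of_int _ additive_subgroup_subspace])

lemma zspan_induct [consumes 1, case_names vs base zero diff]:
  assumes "x \<in> zspan s S" "vector_space s"
    and "\<And>x. x \<in> S \<Longrightarrow> Q x" "Q 0" "\<And>x y. Q x \<Longrightarrow> Q y \<Longrightarrow> Q (x - y)"
  shows "Q x"
  using zspan_minimal[of s "{x. Q x}" S] assms by (auto simp: additive_subgroup_def)

lemma zspan_mono: "vector_space s \<Longrightarrow> S \<subseteq> S' \<Longrightarrow> zspan s S \<subseteq> zspan s S'"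
  by (meson additive_subgroup_zspan subset_iff zspan_base zspan_minimal)

lemma zspan_image:
  assumes "x \<in> zspan s X" "\<And>x y. f (x - y) = f x - f y" "\<And>x. x \<in> X \<Longrightarrow> f x \<in> zspan s' Y"
    and "vector_space s" "vector_space s'"
  shows "f x \<in> zspan s' Y"
proof -
  have f0: "f 0 = 0" using assms(2)[of 0 0] by simp
  have Y: "additive_subgroup (zspan s' Y)" by (rule additive_subgroup_zspan) fact
  show ?thesis
    using assms(1)
    by (induction x rule: zspan_induct) (use assms f0 Y in \<open>auto simp: additive_subgroup_def\<close>)
qed

lemma zspan_empty: "vector_space s \<Longrightarrow> zspan s {} = {0}"
  unfolding zspan_def by (rule module.span_empty[OF module_of_int])

text \<open>Integrality of coefficients already forces independence: a relation with
  \<open>c v \<noteq> 0\<close>, multiplied by \<open>1 / (2 * c v)\<close>, still represents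
  \<open>0 \<in> A\<close> but has the coefficient 1/2 at \<open>v\<close>.\<close>

lemma integral_formI:
  assumes vs: "vector_space s" and A: "additive_subgroup A" "A \<subseteq> module.span s B" "B \<subseteq> A"
    and int: "\<And>t c v. finite t \<Longrightarrow> t \<subseteq> B \<Longrightarrow> (\<Sum>v\<in>t. s (c v) v) \<in> A \<Longrightarrow> v \<in> t \<Longrightarrow> c v \<in> \<int>"
  shows "\<not> module.dependent s B" "A = zspan s B"
proof -
  interpret vector_space s by fact
  interpret Z: module "\<lambda>k::int. s (of_int k)" by (rule module_of_int) fact
  have "c v = 0" if "finite t" "t \<subseteq> B" "(\<Sum>v\<in>t. s (c v) v) = 0" "v \<in> t" for t c v
  proof (rule ccontr)
    assume nz: "c v \<noteq> 0"
    have "(\<Sum>w\<in>t. s (1 / (2 * c v) * c w) w) = s (1 / (2 * c v)) (\<Sum>w\<in>t. s (c w) w)"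
      by (simp add: scale_sum_right)
    also have "\<dots> = 0" by (simp add: that)
    finally have "1 / (2 * c v) * c v \<in> \<int>"
      using that A(1) by (intro int[of t "\<lambda>w. 1 / (2 * c v) * c w" v]) (auto simp: additive_subgroup_def)
    then have "(1 / 2 :: complex) \<in> \<int>" using nz by simp
    then obtain k :: int where "(1 / 2 :: complex) = of_int k" by (elim Ints_cases)
    then have "of_int (2 * k) = (of_int 1 :: complex)" by (simp add: field_simps)
    then have "2 * k = 1" by (simp only: of_int_eq_iff)
    then show False by presburger
  qed
  then show "\<not> dependent B" by (auto simp: dependent_explicit)
  show "A = zspan s B"
  proof (intro subset_antisym subsetI)
    fix u assume "u \<in> A"
    then obtain t c where t: "finite t" "t \<subseteq> B" "u = (\<Sum>v\<in>t. s (c v) v)"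
      using A(2) by (auto simp: span_explicit)
    have "\<forall>v\<in>t. \<exists>k::int. c v = of_int k"
      using int[OF t(1,2), of c] t(3) \<open>u \<in> A\<close> Ints_cases by blast
    then obtain k :: "'a \<Rightarrow> int" where "\<forall>v\<in>t. c v = of_int (k v)" by metis
    then have "u = (\<Sum>v\<in>t. s (of_int (k v)) v)" using t by simp
    then show "u \<in> zspan s B" using t by (auto simp: zspan_def Z.span_explicit)
  next
    fix u assume "u \<in> zspan s B"
    then show "u \<in> A" using zspan_minimal[OF vs A(1,3)] by blast
  qed
qed

section \<open>Derivations and exponentials on the Fock space\<close>

lemma poly_mapping_sum_single:
  "(\<Sum>m\<in>Poly_Mapping.keys p. Poly_Mapping.single m (Poly_Mapping.lookup p m)) = p"
proof (rule poly_mapping_eqI)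
  fix k
  have "(\<Sum>m\<in>Poly_Mapping.keys p. Poly_Mapping.lookup (Poly_Mapping.single m (Poly_Mapping.lookup p m)) k)
    = (\<Sum>m\<in>Poly_Mapping.keys p. if m = k then Poly_Mapping.lookup p m else 0)"
    by (intro sum.cong) (auto simp: lookup_single when_def)
  also have "\<dots> = Poly_Mapping.lookup p k"
    by (simp add: in_keys_iff)
  finally show "Poly_Mapping.lookup (\<Sum>m\<in>Poly_Mapping.keys p. Poly_Mapping.single m (Poly_Mapping.lookup p m)) k
      = Poly_Mapping.lookup p k"
    by (simp add: lookup_sum)
qed

lemma poly_mapping_add_induct [case_names single add]:
  fixes Q :: "('a \<Rightarrow>\<^sub>0 'b::comm_monoid_add) \<Rightarrow> bool"
  assumes "\<And>m c. Q (Poly_Mapping.single m c)" "\<And>p q. Q p \<Longrightarrow> Q q \<Longrightarrow> Q (p + q)"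
  shows "Q p"
proof -
  have "Q (\<Sum>m\<in>A. Poly_Mapping.single m (Poly_Mapping.lookup p m))" if "finite A" for A
    using that assms assms(1)[of _ 0] by (induction A) auto
  from this[of "Poly_Mapping.keys p"] show ?thesis by (simp add: poly_mapping_sum_single)
qed

interpretation fock: vector_space fscale
  by (rule vector_space_fscale)

lemma module_fscale: "module fscale"
  by unfold_locales

interpretation lspace: vector_space vscale
  by (rule vector_space_vscale)

lemma module_vscale: "module vscale"
  by unfold_locales

lemma fscale_conv_mult: "fscale c p = Poly_Mapping.single 0 c * p"
  by (simp add: fscale_def mult_map_scale_conv_mult)

lemma fscale_mult_left [simp]: "fscale c p * q = fscale c (p * q)"
  by (simp add: fscale_conv_mult mult.assoc)

lemma fscale_mult_right [simp]: "p * fscale c q = fscale c (p * q)"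
  by (simp add: fscale_conv_mult mult.left_commute)

lemma fscale_single: "fscale c (Poly_Mapping.single m d) = Poly_Mapping.single m (c * d)"
  by (simp add: fscale_conv_mult mult_single)

lemma lookup_zero_mult [simp]:
  "Poly_Mapping.lookup (p * q :: 'h fock) 0 = Poly_Mapping.lookup p 0 * Poly_Mapping.lookup q 0"
proof (induction p rule: poly_mapping_add_induct)
  case (single m c)
  show ?case
  proof (induction q rule: poly_mapping_add_induct)
    case (single m' c')
    have "m + m' = 0 \<longleftrightarrow> m = 0 \<and> m' = 0"
      by (auto simp: poly_mapping_eq_iff fun_eq_iff lookup_add)
    then show ?case by (auto simp: mult_single lookup_single when_def)
  qed (simp add: lookup_add algebra_simps)
qed (simp add: lookup_add algebra_simps)

lemma fderiv_superset:
  assumes "finite A" "Poly_Mapping.keys p \<subseteq> A"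
  shows "fderiv i p = (\<Sum>m\<in>A. Poly_Mapping.single (m - Poly_Mapping.single i 1)
       (of_nat (Poly_Mapping.lookup m i) * Poly_Mapping.lookup p m))"
  unfolding fderiv_def
  by (rule sum.mono_neutral_left) (use assms in \<open>auto simp: in_keys_iff\<close>)

lemma fderiv_add: "fderiv i (p + q) = fderiv i p + fderiv i q"
proof -
  let ?A = "Poly_Mapping.keys p \<union> Poly_Mapping.keys q"
  show ?thesis
    using Poly_Mapping.keys_add[of p q]
    by (simp add: fderiv_superset[of ?A] lookup_add distrib_left single_add sum.distrib)
qed

lemma fderiv_single:
  "fderiv i (Poly_Mapping.single m c) =
    Poly_Mapping.single (m - Poly_Mapping.single i 1) (of_nat (Poly_Mapping.lookup m i) * c)"
  by (subst fderiv_superset[of "{m}"]) auto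

lemma fderiv_fscale: "fderiv i (fscale c p) = fscale c (fderiv i p)"
  by (induction p rule: poly_mapping_add_induct)
    (simp_all add: fderiv_add fock.scale_right_distrib fscale_conv_mult mult_single fderiv_single
      distrib_left mult.left_commute)

lemma module_hom_fderiv: "module_hom fscale fscale (fderiv i)"
  by (simp add: module_hom_iff module_fscale fderiv_add fderiv_fscale)

lemma fderiv_mult: "fderiv i (p * q) = fderiv i p * q + p * fderiv i q"
proof (induction p rule: poly_mapping_add_induct)
  case (single m c)
  show ?case
  proof (induction q rule: poly_mapping_add_induct)
    case (single m' c')
    let ?e = "Poly_Mapping.single i (1::nat)"
    \<comment> \<open>Subtraction of exponents is truncated, so it moves past the sum only where the
      exponent of \<open>i\<close> is positive; elsewhere the factor \<open>lookup m i\<close> of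
      the derivative vanishes.\<close>
    have 1: "m + m' - ?e = (m - ?e) + m'" if "Poly_Mapping.lookup m i \<noteq> 0"
      using that by (auto simp: poly_mapping_eq_iff fun_eq_iff lookup_add lookup_minus lookup_single when_def)
    have 2: "m + m' - ?e = m + (m' - ?e)" if "Poly_Mapping.lookup m' i \<noteq> 0"
      using that by (auto simp: poly_mapping_eq_iff fun_eq_iff lookup_add lookup_minus lookup_single when_def)
    show ?case
    proof (cases "Poly_Mapping.lookup m i = 0 \<or> Poly_Mapping.lookup m' i = 0")
      case True
      then show ?thesis
        using 1 2
        by (cases "Poly_Mapping.lookup m i = 0"; cases "Poly_Mapping.lookup m' i = 0")
          (simp_all add: mult_single fderiv_single lookup_add mult.assoc mult.left_commute[of c])
    next
      case False
      then have "(m - ?e) + m' = m + m' - ?e" "m + (m' - ?e) = m + m' - ?e"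
        using 1 2 by auto
      then show ?thesis
        by (simp only: mult_single fderiv_single lookup_add single_add[symmetric])
          (simp add: algebra_simps)
    qed
  qed (simp add: fderiv_add algebra_simps)
qed (simp add: fderiv_add algebra_simps)

lemma fderiv_commute: "fderiv i (fderiv j p) = fderiv j (fderiv i p)"
proof (induction p rule: poly_mapping_add_induct)
  case (single m c)
  have "m - Poly_Mapping.single i (1::nat) - Poly_Mapping.single j 1
      = m - Poly_Mapping.single j 1 - Poly_Mapping.single i 1"
    by (simp add: poly_mapping_eq_iff fun_eq_iff lookup_minus diff_commute add.commute)
  then show ?case
    by (cases "i = j") (simp_all add: fderiv_single lookup_minus lookup_single when_def mult.left_commute)
qed (simp add: fderiv_add)

lemma fderiv_const [simp]: "fderiv i (Poly_Mapping.single 0 c) = 0"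
  by (simp add: fderiv_single)

lemma fderiv_fvar: "fderiv i (fvar j) = (if i = j then 1 else 0)"
  by (simp add: fvar_def fderiv_single lookup_single when_def)

definition signed_binom :: "complex \<Rightarrow> nat \<Rightarrow> complex" where
  "signed_binom g k = (-1) ^ k * (g gchoose k)"

lemma signed_binom_0 [simp]: "signed_binom g 0 = 1"
  by (simp add: signed_binom_def)

lemma signed_binom_Ints: "g \<in> \<int> \<Longrightarrow> signed_binom g k \<in> \<int>"
  by (auto simp: signed_binom_def of_int_gbinomial[symmetric] elim!: Ints_cases)

text \<open>The logarithmic derivative of \<open>(1 - t)^g = \<Sum>k. signed_binom g k t^k\<close>.\<close>

lemma signed_binom_rec: "of_nat k * signed_binom g k = - g * (\<Sum>m=1..k. signed_binom g (k - m))"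
proof (cases k)
  case (Suc n)
  have "(\<Sum>m=1..k. signed_binom g (k - m)) = (\<Sum>i\<le>n. signed_binom g i)"
    by (rule sum.reindex_bij_witness[where i="\<lambda>i. k - i" and j="\<lambda>m. k - m"]) (auto simp: Suc)
  also have "\<dots> = (-1) ^ n * (g - 1 gchoose n)"
    using gbinomial_sum_lower_neg[of g n] by (simp add: signed_binom_def mult.commute)
  finally have "- g * (\<Sum>m=1..k. signed_binom g (k - m)) = (-1) ^ Suc n * (g * (g - 1 gchoose n))"
    by simp
  then show ?thesis
    unfolding Suc signed_binom_def gbinomial_absorption[symmetric] by (simp add: algebra_simps)
qed simp

lemma signed_binom_of_0: "signed_binom 0 k = (if k = 0 then 1 else 0)"
  by (cases k) (simp_all add: signed_binom_def)

lemma signed_binom_of_1: "signed_binom 1 k = (if k = 0 then 1 else if k = 1 then -1 else 0)"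
  using gbinomial_absorption'[of k "1::complex"] by (cases k rule: nat.exhaust; cases "k - 1") (auto simp: signed_binom_def)

section \<open>Heisenberg operators and the series E^-, E^+ on a single component\<close>

context even_lattice
begin

lemma form_add_left: "form (a + b) c = form a c + form b c"
  and form_add_right: "form a (b + c) = form a b + form a c"
  and form_scale_left: "form (scale r a) c = r * form a c"
  and form_scale_right: "form a (scale r c) = r * form a c"
  using form_bilinear by (auto simp: bilinear_on_def)

lemma form_zero_left [simp]: "form 0 c = 0"
  using form_scale_left[of 0 0 c] by simp

lemma form_zero_right [simp]: "form c 0 = 0"
  using form_scale_right[of c 0 0] by simp

lemma form_minus_left [simp]: "form (- a) c = - form a c"
  using form_add_left[of a "- a" c] by (simp add: add_eq_0_iff)

lemma form_minus_right [simp]: "form c (- a) = - form c a"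
  using form_add_right[of c a "- a"] by (simp add: add_eq_0_iff)

lemma form_diff_left: "form (a - b) c = form a c - form b c"
  using form_add_left[of a "- b" c] by simp

lemma form_diff_right: "form c (a - b) = form c a - form c b"
  using form_add_right[of c a "- b"] by simp

lemma form_sum_right: "form c (sum f A) = (\<Sum>i\<in>A. form c (f i))"
  by (induction A rule: infinite_finite_induct) (simp_all add: form_add_right)

lemma vector_space_scale: "vector_space scale"
  by unfold_locales

lemma basis_expansion: "(\<Sum>b\<in>Basis. scale (representation Basis h b) b) = h"
  by (rule sum_representation_eq) (simp_all add: independent_Basis finite_Basis span_Basis)

lemma representation_basis: "b \<in> Basis \<Longrightarrow> representation Basis b b' = (if b' = b then 1 else 0)"
  by (simp add: representation_basis[OF independent_Basis])

definition creation :: "'h \<Rightarrow> nat \<Rightarrow> 'h fock" where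
  "creation h n = (\<Sum>b\<in>Basis. fscale (representation Basis h b) (fvar (b, n)))"

definition annihilation :: "'h \<Rightarrow> nat \<Rightarrow> 'h fock \<Rightarrow> 'h fock" where
  "annihilation h n p = (\<Sum>b\<in>Basis. fscale (of_nat n * form h b) (fderiv (b, n) p))"

lemma lookup_heis_neg:
  "n > 0 \<Longrightarrow> Poly_Mapping.lookup (heis h (- int n) v) \<gamma> = creation h n * Poly_Mapping.lookup v \<gamma>"
  by (simp add: heis_def Poly_Mapping.map.rep_eq when_def creation_def)

lemma annihilation_zero [simp]: "annihilation h n 0 = 0"
  by (simp add: annihilation_def module_hom.zero[OF module_hom_fderiv])

lemma lookup_heis_pos:
  "n > 0 \<Longrightarrow> Poly_Mapping.lookup (heis h (int n) v) \<gamma> = annihilation h n (Poly_Mapping.lookup v \<gamma>)"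
  by (auto simp add: heis_def Poly_Mapping.map.rep_eq when_def annihilation_def 
      module_hom.zero[OF module_hom_fderiv])

lemma creation_add: "creation (h + h') n = creation h n + creation h' n"
  by (simp add: creation_def representation_add[OF independent_Basis] span_Basis
      fock.scale_left_distrib sum.distrib)

lemma creation_scale: "creation (scale c h) n = fscale c (creation h n)"
  by (simp add: creation_def representation_scale[OF independent_Basis] span_Basis fock.scale_sum_right)

lemma creation_zero [simp]: "creation 0 n = 0"
  using creation_scale[of 0 0] by simp

lemma creation_uminus: "creation (- h) n = - creation h n"
  using creation_scale[of "-1" h n] by simp

lemma creation_basis: "b \<in> Basis \<Longrightarrow> creation b n = fvar (b, n)"
  by (simp add: creation_def representation_basis if_distrib[of "\<lambda>c. fscale c _"] finite_Basis cong: if_cong)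

lemma annihilation_uminus: "annihilation (- h) n p = - annihilation h n p"
  by (simp add: annihilation_def sum_negf)

lemma annihilation_add: "annihilation h n (p + q) = annihilation h n p + annihilation h n q"
  by (simp add: annihilation_def fderiv_add fock.scale_right_distrib sum.distrib)

lemma annihilation_fscale: "annihilation h n (fscale c p) = fscale c (annihilation h n p)"
  by (simp add: annihilation_def fderiv_fscale fock.scale_sum_right mult.commute)

lemma annihilation_hom: "module_hom fscale fscale (annihilation h n)"
  by (simp add: module_hom_iff module_fscale annihilation_add annihilation_fscale)

lemmas annihilation_neg = module_hom.neg[OF annihilation_hom]

lemma annihilation_mult:
  "annihilation h n (p * q) = annihilation h n p * q + p * annihilation h n q"
  by (simp add: annihilation_def fderiv_mult fock.scale_right_distrib sum.distrib
      sum_distrib_left sum_distrib_right)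

lemma annihilation_commute:
  "annihilation h n (annihilation h' n' p) = annihilation h' n' (annihilation h n p)"
proof -
  have "annihilation h n (annihilation h' n' p) = (\<Sum>b\<in>Basis. \<Sum>b'\<in>Basis.
      fscale (of_nat n * form h b * (of_nat n' * form h' b')) (fderiv (b, n) (fderiv (b', n') p)))" for h h' n n'
    by (simp add: annihilation_def module_hom.sum[OF module_hom_fderiv] fderiv_fscale fock.scale_sum_right)
  note A = this
  show ?thesis
    unfolding A[of h n h' n'] A[of h' n' h n]
    by (subst sum.swap) (simp add: fderiv_commute mult.commute)
qed

lemma annihilation_const [simp]: "annihilation h n (Poly_Mapping.single 0 c) = 0"
  by (simp add: annihilation_def)

lemma annihilation_creation:
  "annihilation h n (creation h' n') = (if n = n' then Poly_Mapping.single 0 (of_nat n * form h h') else 0)"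
proof -
  have "annihilation h n (creation h' n') = (\<Sum>b\<in>Basis. \<Sum>b'\<in>Basis.
      fscale (of_nat n * form h b * representation Basis h' b') (fderiv (b, n) (fvar (b', n'))))"
    by (simp add: annihilation_def creation_def module_hom.sum[OF module_hom_fderiv] fderiv_fscale
        fock.scale_sum_right)
  also have "\<dots> = (\<Sum>b\<in>Basis. if n = n' then fscale (of_nat n * form h b * representation Basis h' b) 1 else 0)"
    by (intro sum.cong refl) 
      (simp add: fderiv_fvar if_distrib[of "fscale _"] finite_Basis cong: if_cong)
  also have "\<dots> = (if n = n' then fscale (of_nat n * (\<Sum>b\<in>Basis. form h (scale (representation Basis h' b) b))) 1 else 0)"
    by (simp add: fock.scale_sum_left[symmetric] sum_distrib_left form_scale_right mult_ac)
  also have "(\<Sum>b\<in>Basis. form h (scale (representation Basis h' b) b)) = form h h'"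
    by (simp add: form_sum_right[symmetric] basis_expansion)
  finally show ?thesis by (simp add: fscale_conv_mult)
qed

text \<open>\<open>E\<^sup>-(-\<beta>,x)\<close> is multiplication by \<open>\<Sum>k. cpl \<beta> k x^k\<close>, where \<open>cpl \<beta> k\<close> is the complete symmetric
  function whose power sums are the \<open>\<beta>(-n)\<close>; \<open>E\<^sup>+(-\<beta>,x)\<close> acts as \<open>\<Sum>k. shift \<beta> k x^(-k)\<close>.\<close>

definition cpl :: "'h \<Rightarrow> nat \<Rightarrow> 'h fock" where
  "cpl \<beta> k = exp_coeff fscale (\<lambda>m p. fscale (1 / of_nat m) (creation \<beta> m * p)) k 1"

definition shift :: "'h \<Rightarrow> nat \<Rightarrow> 'h fock \<Rightarrow> 'h fock" where
  "shift \<beta> = exp_coeff fscale (\<lambda>m p. fscale (- 1 / of_nat m) (annihilation \<beta> m p))"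

lemma module_hom_lookup: "module_hom vscale fscale (\<lambda>v. Poly_Mapping.lookup v \<gamma>)"
  by (simp add: module_hom_iff module_fscale module_vscale lookup_add)

text \<open>The sign of \<open>- \<beta>\<close> cancels that of the denominator \<open>- m\<close>,
  so the exponent becomes \<open>\<Sum>m. \<beta>(-m) x^m / m\<close>. Its exponential consists of
  multiplication operators and is determined by its value at 1.\<close>

lemma lookup_E_minus: "Poly_Mapping.lookup (E_minus (- \<beta>) k v) \<gamma> = cpl \<beta> k * Poly_Mapping.lookup v \<gamma>"
proof -
  let ?a = "\<lambda>m p. fscale (1 / of_nat m) (creation \<beta> m * p)"
  have "Poly_Mapping.lookup (E_minus (- \<beta>) k v) \<gamma> = exp_coeff fscale ?a k (Poly_Mapping.lookup v \<gamma>)"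
    unfolding E_minus_def
    by (rule exp_coeff_transfer[OF module_hom_lookup]) (simp add: lookup_heis_neg creation_uminus)
  also have "\<dots> = exp_coeff fscale ?a k (1 * Poly_Mapping.lookup v \<gamma>)" by simp
  also have "\<dots> = exp_coeff fscale ?a k 1 * Poly_Mapping.lookup v \<gamma>"
    by (rule exp_coeff_transfer[where T="\<lambda>p. p * Poly_Mapping.lookup v \<gamma>", symmetric])
      (auto simp: module_hom_iff module_fscale distrib_right mult.assoc)
  finally show ?thesis by (simp add: cpl_def)
qed

lemma lookup_E_plus: "Poly_Mapping.lookup (E_plus (- \<beta>) k v) \<gamma> = shift \<beta> k (Poly_Mapping.lookup v \<gamma>)"
  unfolding E_plus_def shift_def
  by (rule exp_coeff_transfer[OF module_hom_lookup]) (simp add: lookup_heis_pos annihilation_uminus)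

lemma cpl_0 [simp]: "cpl \<beta> 0 = 1"
  by (simp add: cpl_def exp_coeff_0 module_fscale)

text \<open>Newton's identity between complete symmetric functions and power sums, with
  \<open>creation \<beta> m\<close> as the power sums.\<close>

lemma cpl_rec: "fscale (of_nat n) (cpl \<beta> n) = (\<Sum>m=1..n. creation \<beta> m * cpl \<beta> (n - m))"
proof -
  have "fscale (of_nat n) (cpl \<beta> n) = (\<Sum>m=1..n. fscale (of_nat m) (fscale (1 / of_nat m) (creation \<beta> m * cpl \<beta> (n - m))))"
    unfolding cpl_def
    by (rule exp_coeff_rec[OF vector_space_fscale])
      (auto simp: module_hom_iff module_fscale fock.scale_right_distrib distrib_left distrib_right
        mult.commute mult.left_commute)
  then show ?thesis by simp
qed

lemma shift_0 [simp]: "shift \<beta> 0 p = p"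
  by (simp add: shift_def exp_coeff_0 module_fscale)

lemma shift_coeff_hom: "module_hom fscale fscale (\<lambda>p. fscale (- 1 / of_nat m) (annihilation \<beta> m p))"
  by (simp add: module_hom_iff module_fscale annihilation_add annihilation_fscale fock.scale_right_distrib
      mult.commute)

lemma shift_hom: "module_hom fscale fscale (shift \<beta> k)"
  unfolding shift_def by (rule module_hom_exp_coeff[OF vector_space_fscale shift_coeff_hom])

lemmas shift_add = module_hom.add[OF shift_hom]
  and shift_diff = module_hom.diff[OF shift_hom]
  and shift_fscale = module_hom.scale[OF shift_hom]
  and shift_zero [simp] = module_hom.zero[OF shift_hom]
  and shift_sum = module_hom.sum[OF shift_hom]

lemma shift_rec: "fscale (of_nat k) (shift \<beta> k p) = - (\<Sum>m=1..k. annihilation \<beta> m (shift \<beta> (k - m) p))"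
proof -
  have "fscale (of_nat k) (shift \<beta> k p)
      = (\<Sum>m=1..k. fscale (of_nat m) (fscale (- 1 / of_nat m) (annihilation \<beta> m (shift \<beta> (k - m) p))))"
    unfolding shift_def
    by (rule exp_coeff_rec[OF vector_space_fscale shift_coeff_hom])
      (simp add: annihilation_fscale annihilation_neg annihilation_commute[of \<beta> _ \<beta>] mult.commute)
  then show ?thesis by (simp add: sum_negf)
qed

lemma shift_const: "shift \<beta> k (Poly_Mapping.single 0 c) = (if k = 0 then Poly_Mapping.single 0 c else 0)"
proof (induction k rule: less_induct)
  case (less k)
  show ?case
  proof (cases "k = 0")
    case False
    have "fscale (of_nat k) (shift \<beta> k (Poly_Mapping.single 0 c)) = fscale (of_nat k) 0"
      unfolding shift_rec using less by (auto intro!: sum.neutral)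
    then show ?thesis using False by simp
  qed simp
qed

lemma shift_one: "shift \<beta> k 1 = (if k = 0 then 1 else 0)"
  using shift_const[of \<beta> k 1] by (simp split: if_splits)

text \<open>The exponential of a series of commuting derivations is multiplicative. In the induction
  both sides are multiplied by \<open>k\<close>, expanded by \<open>shift_rec\<close>, and matched
  by the Leibniz rule.\<close>

lemma shift_mult: "shift \<beta> k (p * q) = (\<Sum>i\<le>k. shift \<beta> i p * shift \<beta> (k - i) q)"
proof (induction k rule: less_induct)
  case (less k)
  let ?S = "shift \<beta>" and ?D = "annihilation \<beta>"
  show ?case
  proof (cases "k = 0")
    case False
    have "fscale (of_nat k) (?S k (p * q))
      = - (\<Sum>m=1..k. \<Sum>i\<le>k-m. ?D m (?S i p) * ?S (k - m - i) q)
        - (\<Sum>m=1..k. \<Sum>i\<le>k-m. ?S i p * ?D m (?S (k - m - i) q))"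
      unfolding shift_rec
      by (simp add: less.IH module_hom.sum[OF annihilation_hom] annihilation_mult sum.distrib)
    also have "(\<Sum>m=1..k. \<Sum>i\<le>k-m. ?D m (?S i p) * ?S (k - m - i) q)
      = (\<Sum>t\<le>k. \<Sum>m=1..t. ?D m (?S (t - m) p) * ?S (k - t) q)"
      unfolding sum.Sigma[OF finite_atLeastAtMost ballI[OF finite_atMost]]
        sum.Sigma[OF finite_atMost ballI[OF finite_atLeastAtMost]]
      by (rule sum.reindex_bij_witness[where j="\<lambda>(m,i). (m + i, m)" and i="\<lambda>(t,m). (m, t - m)"])
        auto
    also have "(\<Sum>m=1..k. \<Sum>i\<le>k-m. ?S i p * ?D m (?S (k - m - i) q))
      = (\<Sum>i\<le>k. \<Sum>m=1..k-i. ?S i p * ?D m (?S (k - i - m) q))"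
      unfolding sum.Sigma[OF finite_atLeastAtMost ballI[OF finite_atMost]]
        sum.Sigma[OF finite_atMost ballI[OF finite_atLeastAtMost]]
      by (rule sum.reindex_bij_witness[where j="\<lambda>(m,i). (i, m)" and i="\<lambda>(i,m). (m, i)"])
        (auto simp: add.commute)
    also have "- (\<Sum>t\<le>k. \<Sum>m=1..t. ?D m (?S (t - m) p) * ?S (k - t) q)
       - (\<Sum>i\<le>k. \<Sum>m=1..k-i. ?S i p * ?D m (?S (k - i - m) q))
      = (\<Sum>i\<le>k. fscale (of_nat i) (?S i p) * ?S (k - i) q + ?S i p * fscale (of_nat (k - i)) (?S (k - i) q))"
      unfolding shift_rec
      by (simp add: sum.distrib sum_distrib_left sum_distrib_right sum_negf sum_subtractf)
    also have "\<dots> = fscale (of_nat k) (\<Sum>i\<le>k. ?S i p * ?S (k - i) q)"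
      unfolding fock.scale_sum_right
      by (intro sum.cong refl) (simp add: fock.scale_left_distrib[symmetric] flip: of_nat_add)
    finally show ?thesis using False by simp
  qed simp
qed

text \<open>On generators the automorphism is a translation: it sends
  \<open>creation \<gamma> m\<close> to
  \<open>creation \<gamma> m - form \<beta> \<gamma> x^(-m)\<close>.\<close>

lemma shift_creation:
  assumes "m > 0"
  shows "shift \<beta> k (creation \<gamma> m) =
    (if k = 0 then creation \<gamma> m else if k = m then Poly_Mapping.single 0 (- form \<beta> \<gamma>) else 0)"
proof (induction k rule: less_induct)
  case (less k)
  show ?case
  proof (cases "k = 0")
    case False
    have "fscale (of_nat k) (shift \<beta> k (creation \<gamma> m))
      = - (\<Sum>l=1..k. if l = k then annihilation \<beta> k (creation \<gamma> m) else 0)"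
      unfolding shift_rec
      by (intro arg_cong[where f=uminus] sum.cong refl) (use less in auto)
    also have "\<dots> = - annihilation \<beta> k (creation \<gamma> m)"
      using False by simp
    also have "\<dots> = fscale (of_nat k) (if k = m then Poly_Mapping.single 0 (- form \<beta> \<gamma>) else 0)"
      by (simp add: annihilation_creation fscale_single single_uminus)
    finally show ?thesis using False by simp
  qed simp
qed

lemma shift_creation_mult:
  assumes "m > 0"
  shows "shift \<beta> k (creation \<gamma> m * q) = creation \<gamma> m * shift \<beta> k q -
    (if m \<le> k then fscale (form \<beta> \<gamma>) (shift \<beta> (k - m) q) else 0)"
proof -
  have "shift \<beta> k (creation \<gamma> m * q) = (\<Sum>i\<le>k. (if i = 0 then creation \<gamma> m * shift \<beta> k q else 0)
      + (if i = m then fscale (- form \<beta> \<gamma>) (shift \<beta> (k - m) q) else 0))"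
    unfolding shift_mult
    by (intro sum.cong refl) (use assms in \<open>auto simp: shift_creation fscale_conv_mult\<close>)
  then show ?thesis by (simp add: sum.distrib)
qed

text \<open>The coefficient form of
  \<open>E\<^sup>+(-\<beta>,x) E\<^sup>-(-\<gamma>,y) = (1 - y/x)^\<langle>\<beta>,\<gamma>\<rangle> E\<^sup>-(-\<gamma>,y) E\<^sup>+(-\<beta>,x)\<close>.\<close>

lemma shift_cpl:
  "shift \<beta> k (cpl \<gamma> n) = (if k \<le> n then fscale (signed_binom (form \<beta> \<gamma>) k) (cpl \<gamma> (n - k)) else 0)"
proof (induction n arbitrary: k rule: less_induct)
  case (less n)
  let ?S = "shift \<beta>" and ?g = "form \<beta> \<gamma>"
  let ?c = "signed_binom ?g"
  show ?case
  proof (cases "n = 0")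
    case True
    then show ?thesis by (simp add: shift_one)
  next
    case False
    \<comment> \<open>Newton's identity for \<open>cpl \<gamma> n\<close> with every power sum
      translated. For \<open>k \<le> n\<close> the first sum contributes the weight
      \<open>n - k\<close> by Newton's identity again, the second the weight \<open>k\<close> by
      \<open>signed_binom_rec\<close>; together they give \<open>n\<close>.\<close>
    have *: "fscale (of_nat n) (?S k (cpl \<gamma> n)) = (\<Sum>m=1..n. creation \<gamma> m * ?S k (cpl \<gamma> (n - m)))
      - (\<Sum>m=1..n. if m \<le> k then fscale ?g (?S (k - m) (cpl \<gamma> (n - m))) else 0)"
    proof -
      have "fscale (of_nat n) (?S k (cpl \<gamma> n)) = ?S k (\<Sum>m=1..n. creation \<gamma> m * cpl \<gamma> (n - m))"
        by (simp only: shift_fscale[symmetric] cpl_rec)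
      then show ?thesis by (simp add: shift_sum shift_creation_mult sum_subtractf)
    qed
    show ?thesis
    proof (cases "k \<le> n")
      case True
      have "(\<Sum>m=1..n. creation \<gamma> m * ?S k (cpl \<gamma> (n - m)))
        = (\<Sum>m=1..n-k. creation \<gamma> m * ?S k (cpl \<gamma> (n - m)))"
        by (rule sum.mono_neutral_right) (use less.IH in auto)
      also have "\<dots> = (\<Sum>m=1..n-k. fscale (?c k) (creation \<gamma> m * cpl \<gamma> (n - k - m)))"
        by (intro sum.cong refl, subst less.IH) (auto simp: add.commute)
      also have "\<dots> = fscale (?c k * of_nat (n - k)) (cpl \<gamma> (n - k))"
        unfolding fock.scale_sum_right[symmetric] cpl_rec[symmetric] by simp
      finally have 1: "(\<Sum>m=1..n. creation \<gamma> m * ?S k (cpl \<gamma> (n - m))) = \<dots>" .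
      have "(\<Sum>m=1..n. if m \<le> k then fscale ?g (?S (k - m) (cpl \<gamma> (n - m))) else 0)
        = (\<Sum>m=1..k. if m \<le> k then fscale ?g (?S (k - m) (cpl \<gamma> (n - m))) else 0)"
        by (rule sum.mono_neutral_right) (use True in auto)
      also have "\<dots> = (\<Sum>m=1..k. fscale (?g * ?c (k - m)) (cpl \<gamma> (n - k)))"
        by (intro sum.cong refl, subst less.IH) (use True in auto)
      also have "\<dots> = - fscale (of_nat k * ?c k) (cpl \<gamma> (n - k))"
        unfolding signed_binom_rec fock.scale_sum_left[symmetric]
        by (simp add: sum_distrib_left sum_negf)
      finally have "fscale (of_nat n) (?S k (cpl \<gamma> n)) = fscale (?c k * of_nat (n - k) + of_nat k * ?c k) (cpl \<gamma> (n - k))"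
        using * 1 by (simp add: fock.scale_left_distrib)
      also have "?c k * of_nat (n - k) + of_nat k * ?c k = of_nat n * ?c k"
        using True by (simp add: of_nat_diff algebra_simps)
      finally have "fscale (of_nat n) (?S k (cpl \<gamma> n)) = fscale (of_nat n) (fscale (?c k) (cpl \<gamma> (n - k)))"
        by simp
      then have "?S k (cpl \<gamma> n) = fscale (?c k) (cpl \<gamma> (n - k))"
        unfolding fock.scale_cancel_left using False by simp
      then show ?thesis using True by simp
    next
      case k: False
      have "fscale (of_nat n) (?S k (cpl \<gamma> n)) = fscale (of_nat n) 0"
      proof -
        have "creation \<gamma> m * ?S k (cpl \<gamma> (n - m)) = 0" "?S (k - m) (cpl \<gamma> (n - m)) = 0"
          if "m \<in> {1..n}" for m
          using that k by (auto simp: less.IH)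
        then have "(\<Sum>m=1..n. creation \<gamma> m * ?S k (cpl \<gamma> (n - m))) = 0"
          "(\<Sum>m=1..n. if m \<le> k then fscale ?g (?S (k - m) (cpl \<gamma> (n - m))) else 0) = 0"
          by (intro sum.neutral ballI; auto)+
        then show ?thesis unfolding * by simp
      qed
      then show ?thesis using False k by simp
    qed
  qed
qed

end

section \<open>Lattice and dual basis\<close>

lemma rat_common_denominator:
  fixes g :: "'a \<Rightarrow> rat"
  assumes "finite A"
  shows "\<exists>N::int. N > 0 \<and> (\<forall>x\<in>A. \<exists>k::int. of_int N * g x = of_int k)"
  using assms
proof (induction A)
  case (insert x A)
  then obtain N :: int where N: "N > 0" "\<forall>x\<in>A. \<exists>k::int. of_int N * g x = of_int k" by auto
  obtain a b where ab: "g x = of_int a / of_int b" "b > 0"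
    using Rat_cases[of "g x"] by (metis Fract_of_int_quotient)
  have "of_int (N * b) * g x = of_int (N * a)" using ab by simp
  moreover have "\<exists>k::int. of_int (N * b) * g y = of_int k" if "y \<in> A" for y
  proof -
    from N(2) that obtain k :: int where "of_int N * g y = of_int k" by blast
    then have "of_int (N * b) * g y = of_int (k * b)" by (simp add: mult.commute mult.left_commute)
    then show ?thesis by blast
  qed
  ultimately show ?case using N(1) ab(2) by (intro exI[of _ "N * b"]) fastforce
qed (auto intro: exI[of _ 1])

context even_lattice
begin

lemma lat_subgroup: "additive_subgroup lat"
  unfolding lat_def by (rule additive_subgroup_zspan[OF vector_space_scale])

lemma zero_in_lat [simp]: "0 \<in> lat"
  and lat_diff: "a \<in> lat \<Longrightarrow> b \<in> lat \<Longrightarrow> a - b \<in> lat"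
  using lat_subgroup by (auto simp: additive_subgroup_def)

lemma lat_minus: "a \<in> lat \<Longrightarrow> - a \<in> lat"
  using additive_subgroup_uminus[OF lat_subgroup] .

lemma lat_add: "a \<in> lat \<Longrightarrow> b \<in> lat \<Longrightarrow> a + b \<in> lat"
  using additive_subgroup_add[OF lat_subgroup] .

lemma basis_in_lat: "b \<in> Basis \<Longrightarrow> b \<in> lat"
  unfolding lat_def by (rule zspan_base[OF vector_space_scale])

lemma form_lat_dual: "a \<in> lat \<Longrightarrow> g \<in> dual_lat \<Longrightarrow> form a g \<in> \<int>"
  by (simp add: dual_lat_def)

lemma lat_in_dual: "a \<in> lat \<Longrightarrow> a \<in> dual_lat"
  using form_integral by (simp add: dual_lat_def lat_def)

lemma dual_add: "a \<in> dual_lat \<Longrightarrow> b \<in> dual_lat \<Longrightarrow> a + b \<in> dual_lat"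
  by (simp add: dual_lat_def form_add_right)

lemma dual_minus: "a \<in> dual_lat \<Longrightarrow> - a \<in> dual_lat"
  by (simp add: dual_lat_def)

lemma dual_diff: "a \<in> dual_lat \<Longrightarrow> b \<in> dual_lat \<Longrightarrow> a - b \<in> dual_lat"
  by (simp add: dual_lat_def form_diff_right)

lemma zero_in_dual [simp]: "0 \<in> dual_lat"
  by (simp add: dual_lat_def)

lemma lat_form_eq_0:
  assumes "\<And>b. b \<in> Basis \<Longrightarrow> form b u = 0" "a \<in> lat"
  shows "form a u = 0"
  using assms(2) unfolding lat_def
  by (induction a rule: zspan_induct) (simp_all add: vector_space_scale assms(1) form_diff_left)

text \<open>Nondegeneracy on \<open>L\<close> passes to \<open>\<hh> = \<complex> \<otimes> L\<close>: apply a \<open>\<rat>\<close>-linear functional \<open>\<complex> \<rightarrow> \<rat>\<close> that does not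
  vanish on some coordinate of a radical vector and clear denominators.\<close>

lemma form_nondegenerate_complex:
  assumes u: "\<And>b. b \<in> Basis \<Longrightarrow> form b u = 0"
  shows "u = 0"
proof (rule ccontr)
  assume "u \<noteq> 0"
  let ?c = "representation Basis u"
  have "\<exists>b\<in>Basis. ?c b \<noteq> 0"
  proof (rule ccontr)
    assume "\<not> (\<exists>b\<in>Basis. ?c b \<noteq> 0)"
    then have "(\<Sum>b\<in>Basis. scale (?c b) b) = 0" by (intro sum.neutral) auto
    then show False using basis_expansion[of u] \<open>u \<noteq> 0\<close> by simp
  qed
  then obtain b0 where b0: "b0 \<in> Basis" "?c b0 \<noteq> 0" by blast
  \<comment> \<open>\<complex> is viewed as a vector space over \<rat>. Extending the nonzero
    coordinate to a \<rat>-basis makes \<open>f\<close> the coordinate functional with value 1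
    there.\<close>
  interpret Q: vector_space "\<lambda>q x. of_rat q * x :: complex"
    by unfold_locales (simp_all add: distrib_left distrib_right of_rat_add of_rat_mult mult.assoc)
  define E where "E = Q.extend_basis {?c b0}"
  have ind: "Q.independent {?c b0}" using b0 by (simp add: Q.dependent_single)
  have E: "Q.independent E" "Q.span E = UNIV" "?c b0 \<in> E"
    unfolding E_def using Q.independent_extend_basis[OF ind] Q.span_extend_basis[OF ind]
      Q.extend_basis_superset[OF ind] by auto
  define f where "f x = Q.representation E x (?c b0)" for x
  have f_add: "f (x + y) = f x + f y" for x y
    unfolding f_def by (simp add: Q.representation_add[OF E(1)] E(2))
  have f_scale: "f (of_rat q * x) = q * f x" for q x
    unfolding f_def using Q.representation_scale[OF E(1), of x q] by (simp add: E(2))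
  have f_zero: "f 0 = 0" using f_scale[of 0 0] by simp
  have f_sum: "f (sum g A) = (\<Sum>i\<in>A. f (g i))" for g :: "'h \<Rightarrow> complex" and A
    by (induction A rule: infinite_finite_induct) (simp_all add: f_zero f_add)
  have f1: "f (?c b0) = 1"
    unfolding f_def by (simp add: Q.representation_basis[OF E(1,3)])
  have "\<forall>b\<in>Basis. \<forall>b'\<in>Basis. \<exists>k::int. form b' b = of_int k"
    using form_lat_dual basis_in_lat lat_in_dual by (meson Ints_cases)
  then obtain k :: "'h \<Rightarrow> 'h \<Rightarrow> int" where k: "\<And>b b'. b \<in> Basis \<Longrightarrow> b' \<in> Basis \<Longrightarrow> form b' b = of_int (k b b')"
    by metis
  obtain N :: int where N: "N > 0" "\<forall>b\<in>Basis. \<exists>n::int. of_int N * f (?c b) = of_int n"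
    using rat_common_denominator[OF finite_Basis, of "\<lambda>b. f (?c b)"] by blast
  then obtain n :: "'h \<Rightarrow> int" where n: "\<And>b. b \<in> Basis \<Longrightarrow> of_int N * f (?c b) = of_int (n b)"
    by metis
  \<comment> \<open>The vector obtained from \<open>u\<close> by applying \<open>f\<close> to its
    coordinates and clearing denominators. The Gram matrix is integral, so \<open>f\<close> commutes
    with the equations \<open>form b' u = 0\<close> and \<open>a\<close> is again orthogonal to the
    basis, now inside L.\<close>
  define a where "a = (\<Sum>b\<in>Basis. scale (of_int (n b)) b)"
  have "a \<in> lat"
    unfolding a_def
    by (intro additive_subgroup_sum[OF lat_subgroup]
        additive_subgroup_scale_int[OF vector_space_scale lat_subgroup] basis_in_lat)
  have "form b' a = 0" if b': "b' \<in> Basis" for b'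
  proof -
    have "0 = form b' (\<Sum>b\<in>Basis. scale (?c b) b)"
      by (simp add: basis_expansion u b')
    also have "\<dots> = (\<Sum>b\<in>Basis. of_rat (of_int (k b b')) * ?c b)"
      by (simp add: form_sum_right form_scale_right k b' mult.commute)
    finally have "f 0 = f (\<Sum>b\<in>Basis. of_rat (of_int (k b b')) * ?c b)" by simp
    then have "0 = of_int N * (\<Sum>b\<in>Basis. of_int (k b b') * f (?c b))"
      by (simp only: f_sum f_scale f_zero mult_zero_right)
    also have "\<dots> = (\<Sum>b\<in>Basis. of_int (k b b') * (of_int N * f (?c b)))"
      by (simp add: sum_distrib_left mult_ac)
    also have "\<dots> = of_int (\<Sum>b\<in>Basis. k b b' * n b)"
      by (simp add: n)
    finally have "(\<Sum>b\<in>Basis. k b b' * n b) = 0"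
      by (metis of_int_0_eq_iff)
    moreover have "form b' a = of_int (\<Sum>b\<in>Basis. k b b' * n b)"
      by (simp add: a_def form_sum_right form_scale_right k b' mult.commute)
    ultimately show ?thesis by simp
  qed
  then have "form a' a = 0" if "a' \<in> lat" for a' using lat_form_eq_0 that by blast
  then have "a = 0" 
    using form_nondegenerate[of a] \<open>a \<in> lat\<close> form_sym unfolding lat_def by metis
  then have "of_int (n b0) = (0::complex)"
    using independentD[OF independent_Basis finite_Basis order.refl, of "\<lambda>b. of_int (n b)"] b0(1)
    by (simp add: a_def)
  then show False using n[OF b0(1)] f1 N(1) by simp
qed

text \<open>The map \<open>u \<mapsto> \<Sum>b. form b u b\<close> is injective by nondegeneracy,
  hence surjective in finite dimension; the vector sought is the preimage of
  \<open>b\<close>.\<close>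

lemma dual_basis_ex1:
  assumes "b \<in> Basis"
  shows "\<exists>!u. \<forall>b'\<in>Basis. form b' u = (if b' = b then 1 else 0)"
proof (rule ex_ex1I)
  define \<phi> where "\<phi> u = (\<Sum>b\<in>Basis. scale (form b u) b)" for u
  have lin: "Vector_Spaces.linear scale scale \<phi>"
    by (simp add: Vector_Spaces.linear_iff vector_space_scale \<phi>_def form_add_right form_scale_right
        scale_left_distrib sum.distrib scale_sum_right)
  have coeff: "form b' u = c b'" if "\<phi> u = (\<Sum>b\<in>Basis. scale (c b) b)" "b' \<in> Basis" for u c b'
    using independentD[OF independent_Basis finite_Basis order.refl, of "\<lambda>b. form b u - c b" b'] that
    by (simp add: \<phi>_def scale_left_diff_distrib sum_subtractf)
  have "inj \<phi>"
  proof (rule injI)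
    fix u v assume "\<phi> u = \<phi> v"
    then have "form b' u = form b' v" if "b' \<in> Basis" for b'
      using coeff[of u "\<lambda>b. form b v" b'] that by (simp add: \<phi>_def)
    then show "u = v" using form_nondegenerate_complex[of "u - v"] by (simp add: form_diff_right)
  qed
  then have "surj \<phi>" using linear_inj_imp_surj lin by blast
  then obtain u where "\<phi> u = b" by (metis surjD)
  moreover have "(\<Sum>b'\<in>Basis. scale (if b' = b then 1 else 0) b') = b"
    using assms finite_Basis by (simp add: if_distrib[of "\<lambda>c. scale c _"] cong: if_cong)
  ultimately show "\<exists>u. \<forall>b'\<in>Basis. form b' u = (if b' = b then 1 else 0)"
    using coeff[of u "\<lambda>b'. if b' = b then 1 else 0"] by (intro exI[of _ u]) auto
next
  fix u v
  assume "\<forall>b'\<in>Basis. form b' u = (if b' = b then 1 else 0)" "\<forall>b'\<in>Basis. form b' v = (if b' = b then 1 else 0)"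
  then show "u = v" using form_nondegenerate_complex[of "u - v"] by (simp add: form_diff_right)
qed

lemma form_dual_vec:
  "b \<in> Basis \<Longrightarrow> b' \<in> Basis \<Longrightarrow> form b' (dual_vec b) = (if b' = b then 1 else 0)"
  using theI'[OF dual_basis_ex1, of b] unfolding dual_vec_def[symmetric] by simp

lemma dual_basis_expansion: "(\<Sum>b\<in>Basis. scale (form b h) (dual_vec b)) = h"
proof -
  have "form b' (h - (\<Sum>b\<in>Basis. scale (form b h) (dual_vec b))) = 0" if "b' \<in> Basis" for b'
  proof -
    have "form b' (\<Sum>b\<in>Basis. scale (form b h) (dual_vec b)) = (\<Sum>b\<in>Basis. if b = b' then form b h else 0)"
      unfolding form_sum_right by (intro sum.cong refl) (use that in \<open>auto simp: form_scale_right form_dual_vec\<close>)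
    then show ?thesis using that finite_Basis by (simp add: form_diff_right)
  qed
  from form_nondegenerate_complex[OF this] show ?thesis by simp
qed

lemma dual_vec_in_dual: "b \<in> Basis \<Longrightarrow> dual_vec b \<in> dual_lat"
proof -
  assume b: "b \<in> Basis"
  have "form a (dual_vec b) \<in> \<int>" if "a \<in> lat" for a
    using that unfolding lat_def
    by (induction a rule: zspan_induct) (simp_all add: vector_space_scale form_dual_vec b form_diff_left)
  then show ?thesis by (simp add: dual_lat_def)
qed

section \<open>Products of complete symmetric functions\<close>

definition cpl_prod :: "('h \<times> nat) list \<Rightarrow> 'h fock" where
  "cpl_prod bs = prod_list (map (\<lambda>(\<beta>, n). cpl \<beta> n) bs)"

definition total :: "('h \<times> nat) list \<Rightarrow> nat" where
  "total bs = sum_list (map snd bs)"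

lemma cpl_prod_simps [simp]:
  "cpl_prod [] = 1" "cpl_prod ((\<beta>, n) # bs) = cpl \<beta> n * cpl_prod bs"
  "cpl_prod (bs @ bs') = cpl_prod bs * cpl_prod bs'"
  by (simp_all add: cpl_prod_def)

lemma total_simps [simp]: "total [] = 0" "total ((\<beta>, n) # bs) = n + total bs"
  "total (bs @ bs') = total bs + total bs'"
  by (simp_all add: total_def)

lemma lookup_cpl_0 [simp]: "Poly_Mapping.lookup (cpl \<beta> n) 0 = (if n = 0 then 1 else 0)"
proof (cases "n = 0")
  case False
  have "Poly_Mapping.lookup (creation h m) 0 = 0" for h m
    by (simp add: creation_def lookup_sum fvar_def lookup_single when_def poly_mapping_eq_iff fun_eq_iff)
  then have "of_nat n * Poly_Mapping.lookup (cpl \<beta> n) 0 = 0"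
    using arg_cong[OF cpl_rec[of n \<beta>], of "\<lambda>p. Poly_Mapping.lookup p 0"] by (simp add: lookup_sum)
  with False show ?thesis by simp
qed simp

lemma lookup_cpl_prod_Ints: "Poly_Mapping.lookup (cpl_prod bs) 0 \<in> \<int>"
  by (induction bs) auto

lemma shift_cpl_mult:
  "shift \<beta> j (cpl \<gamma> n * q) =
    (\<Sum>i\<le>j. if i \<le> n then fscale (signed_binom (form \<beta> \<gamma>) i) (cpl \<gamma> (n - i) * shift \<beta> (j - i) q) else 0)"
  unfolding shift_mult by (intro sum.cong refl) (simp add: shift_cpl)

text \<open>Each factor \<open>cpl \<gamma> n\<close> turns into integral multiples of
  \<open>cpl \<gamma> (n - i)\<close>. The underlying vectors are kept and the drop of
  \<open>total\<close> is recorded exactly: this yields local nilpotency and feeds inductions on the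
  degree.\<close>

lemma shift_cpl_prod:
  assumes "\<And>\<gamma>. \<gamma> \<in> fst ` set bs \<Longrightarrow> form \<beta> \<gamma> \<in> \<int>"
  shows "shift \<beta> j (cpl_prod bs) \<in>
    zspan fscale {cpl_prod bs' |bs'. map fst bs' = map fst bs \<and> total bs' + j = total bs}"
  using assms
proof (induction bs arbitrary: j)
  case Nil
  have "(1 :: 'h fock) \<in> zspan fscale {1}" "(0 :: 'h fock) \<in> zspan fscale S" for S :: "'h fock set"
    using zspan_base[OF vector_space_fscale] additive_subgroup_zspan[OF vector_space_fscale]
    by (auto simp: additive_subgroup_def)
  then show ?case by (cases "j = 0") (simp_all add: shift_one)
next
  case (Cons x bs)
  obtain \<gamma> n where x: "x = (\<gamma>, n)" by (cases x)
  let ?Z = "zspan fscale {cpl_prod bs' |bs'. map fst bs' = map fst (x # bs) \<and> total bs' + j = total (x # bs)}"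
  have sub: "additive_subgroup ?Z" by (rule additive_subgroup_zspan[OF vector_space_fscale])
  have "fscale (signed_binom (form \<beta> \<gamma>) i) (cpl \<gamma> (n - i) * shift \<beta> (j - i) (cpl_prod bs)) \<in> ?Z"
    if "i \<le> j" "i \<le> n" for i
  proof (rule zspan_image[where f="\<lambda>q. fscale (signed_binom (form \<beta> \<gamma>) i) (cpl \<gamma> (n - i) * q)"])
    show "shift \<beta> (j - i) (cpl_prod bs) \<in>
        zspan fscale {cpl_prod bs' |bs'. map fst bs' = map fst bs \<and> total bs' + (j - i) = total bs}"
      using Cons by simp
    fix q assume "q \<in> {cpl_prod bs' |bs'. map fst bs' = map fst bs \<and> total bs' + (j - i) = total bs}"
    then obtain bs' where bs': "q = cpl_prod bs'" "map fst bs' = map fst bs" "total bs' + (j - i) = total bs"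
      by blast
    have "cpl_prod ((\<gamma>, n - i) # bs') \<in> ?Z"
      by (rule zspan_base[OF vector_space_fscale]) (use bs' x that in \<open>fastforce intro!: exI[of _ "(\<gamma>, n - i) # bs'"]\<close>)
    moreover obtain k :: int where "signed_binom (form \<beta> \<gamma>) i = of_int k"
    proof -
      have "form \<beta> \<gamma> \<in> \<int>" by (rule Cons.prems) (simp add: x)
      then show ?thesis using that signed_binom_Ints Ints_cases by blast
    qed
    ultimately show "fscale (signed_binom (form \<beta> \<gamma>) i) (cpl \<gamma> (n - i) * q) \<in> ?Z"
      using additive_subgroup_scale_int[OF vector_space_fscale sub] bs'(1) by auto
  qed (simp_all add: algebra_simps fock.scale_right_diff_distrib vector_space_fscale)
  then show ?case
    unfolding x cpl_prod_simps shift_cpl_mult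
    using sub by (intro additive_subgroup_sum) (auto simp: x additive_subgroup_def)
qed

lemma shift_cpl_prod_dual:
  assumes "\<alpha> \<in> lat" and bs: "fst ` set bs \<subseteq> dual_lat"
  shows "shift \<alpha> j (cpl_prod bs) \<in> zspan fscale {cpl_prod bs |bs. fst ` set bs \<subseteq> dual_lat}"
proof -
  have "shift \<alpha> j (cpl_prod bs) \<in> zspan fscale {cpl_prod bs' |bs'. map fst bs' = map fst bs \<and> total bs' + j = total bs}"
    by (rule shift_cpl_prod) (use assms in \<open>auto intro!: form_lat_dual\<close>)
  moreover have "{cpl_prod bs' |bs'. map fst bs' = map fst bs \<and> total bs' + j = total bs}
      \<subseteq> {cpl_prod bs |bs. fst ` set bs \<subseteq> dual_lat}"
  proof safe
    fix bs' :: "('h \<times> nat) list" assume "map fst bs' = map fst bs"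
    then have "set (map fst bs') = set (map fst bs)" by (simp only:)
    then have "fst ` set bs' \<subseteq> dual_lat" using bs by simp
    then show "\<exists>bs. cpl_prod bs' = cpl_prod bs \<and> fst ` set bs \<subseteq> dual_lat" by blast
  qed
  ultimately show ?thesis using zspan_mono[OF vector_space_fscale] by blast
qed

section \<open>The Fock space\<close>

lemma fock_subspace: "fock.subspace fock_space"
proof (rule fock.subspaceI)
  fix p q :: "'h fock" assume "p \<in> fock_space" "q \<in> fock_space"
  then show "p + q \<in> fock_space" using Poly_Mapping.keys_add[of p q] by (auto simp: fock_space_def)
next
  fix c and p :: "'h fock" assume "p \<in> fock_space"
  then show "fscale c p \<in> fock_space" by (auto simp: fock_space_def in_keys_iff)
qed (simp add: fock_space_def)

lemmas fock_space_add = fock.subspace_add[OF fock_subspace]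
  and fock_space_scale = fock.subspace_scale[OF fock_subspace]
  and fock_space_zero [simp] = fock.subspace_0[OF fock_subspace]
  and fock_space_sum = fock.subspace_sum[OF fock_subspace]
  and fock_space_diff = fock.subspace_diff[OF fock_subspace]

lemma fock_space_one [simp]: "1 \<in> fock_space"
  by (simp add: fock_space_def)

lemma fock_space_mult: "p \<in> fock_space \<Longrightarrow> q \<in> fock_space \<Longrightarrow> p * q \<in> fock_space"
  unfolding fock_space_def using keys_mult[of p q]
  by (auto simp: subset_iff) (metis (no_types, lifting) Poly_Mapping.keys_add UnE subsetD mem_Sigma_iff atLeast_iff)+

lemma creation_in_fock: "m > 0 \<Longrightarrow> creation h m \<in> fock_space"
  unfolding creation_def
  by (intro fock_space_sum fock_space_scale) (auto simp: fock_space_def fvar_def split: if_splits)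

lemma cpl_in_fock: "cpl \<beta> n \<in> fock_space"
proof (induction n rule: less_induct)
  case (less n)
  show ?case
  proof (cases "n = 0")
    case False
    have "fscale (of_nat n) (cpl \<beta> n) \<in> fock_space"
      unfolding cpl_rec
      by (intro fock_space_sum fock_space_mult creation_in_fock less.IH) (use False in auto)
    then have "fscale (1 / of_nat n) (fscale (of_nat n) (cpl \<beta> n)) \<in> fock_space"
      by (rule fock_space_scale)
    then show ?thesis using False by simp
  qed simp
qed

lemma cpl_prod_in_fock: "cpl_prod bs \<in> fock_space"
  by (induction bs) (auto simp: fock_space_mult cpl_in_fock)

text \<open>Newton's identity can be solved for the power sum, so the span, being closed under
  products, contains every \<open>creation \<beta> n\<close> with \<beta> in \<open>S\<close>, and
  by linearity in \<beta> all variables. It is applied both to L and to the dual basis.\<close>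

lemma fock_spanned:
  assumes S: "Basis \<subseteq> span S"
  shows "fock_space \<subseteq> fock.span {cpl_prod bs |bs. set bs \<subseteq> S \<times> {1..}}" (is "_ \<subseteq> ?R")
proof
  have one: "1 \<in> ?R" by (rule fock.span_base) (auto intro!: exI[of _ "[]"])
  have mult: "p * q \<in> ?R" if "p \<in> ?R" "q \<in> ?R" for p q
    using that(1)
  proof (induction p rule: fock.span_induct_alt)
    case (step c x y)
    have "x * q \<in> ?R"
      using that(2)
    proof (induction q rule: fock.span_induct_alt)
      case (step c' x' y')
      have "x * x' \<in> ?R"
        using \<open>x \<in> _\<close> \<open>x' \<in> _\<close>
        by (intro fock.span_base) (auto, metis Un_least cpl_prod_simps(3) set_append)
      then show ?case using step by (simp add: distrib_left fock.span_add fock.span_scale)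
    qed (simp add: fock.span_zero)
    then show ?case using step by (simp add: distrib_right fock.span_add fock.span_scale)
  qed (simp add: fock.span_zero)
  have cpl: "cpl \<beta> n \<in> ?R" if "\<beta> \<in> S" for \<beta> n
  proof (cases "n = 0")
    case False
    then show ?thesis using that by (intro fock.span_base) (auto intro!: exI[of _ "[(\<beta>, n)]"])
  qed (use one in simp)
  have creation_S: "creation \<beta> n \<in> ?R" if "\<beta> \<in> S" "n > 0" for \<beta> n
    using that(2)
  proof (induction n rule: less_induct)
    case (less n)
    \<comment> \<open>The term \<open>m = n\<close> is \<open>creation \<beta> n\<close> itself
      because \<open>cpl \<beta> 0 = 1\<close>.\<close>
    have "{1..n} = insert n {1..<n}" using less.prems by auto
    then have "creation \<beta> n = fscale (of_nat n) (cpl \<beta> n) - (\<Sum>m=1..<n. creation \<beta> m * cpl \<beta> (n - m))"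
      unfolding cpl_rec by simp
    also have "\<dots> \<in> ?R"
      by (intro fock.span_diff fock.span_scale cpl fock.span_sum mult less.IH that) auto
    finally show ?case .
  qed
  have creation: "creation h n \<in> ?R" if "h \<in> span S" "n > 0" for h n
    using that(1)
    by (induction h rule: span_induct_alt)
      (simp_all add: creation_add creation_scale creation_S that fock.span_add fock.span_scale fock.span_zero
        del: One_nat_def)
  have fvar: "fvar (b, n) \<in> ?R" if "b \<in> Basis" "n \<ge> 1" for b n
    using creation[of b n] that S by (auto simp: creation_basis)
  have monom: "Poly_Mapping.single m 1 \<in> ?R" if "Poly_Mapping.keys m \<subseteq> Basis \<times> {1..}" for m :: "('h \<times> nat) \<Rightarrow>\<^sub>0 nat"
    using that
  proof (induction m rule: poly_mapping_add_induct)
    case (single i c)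
    show ?case
    proof (cases "c = 0")
      case False
      then have i: "fvar i \<in> ?R" using single fvar by (cases i) auto
      have "Poly_Mapping.single (Poly_Mapping.single i c) 1 \<in> ?R"
      proof (induction c)
        case (Suc c)
        have "Poly_Mapping.single (Poly_Mapping.single i (Suc c)) 1
           = fvar i * Poly_Mapping.single (Poly_Mapping.single i c) 1"
          by (simp add: fvar_def mult_single flip: single_add)
        then show ?case using mult[OF i Suc] by simp
      qed (use one in simp)
      then show ?thesis .
    qed (use one in simp)
  next
    case (add m m')
    have "Poly_Mapping.keys (m + m') = Poly_Mapping.keys m \<union> Poly_Mapping.keys m'"
      by (auto simp: in_keys_iff lookup_add)
    then have "Poly_Mapping.single m 1 * Poly_Mapping.single m' 1 \<in> ?R"
      using add by (intro mult) auto
    then show ?case by (simp add: mult_single)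
  qed
  fix p :: "'h fock" assume p: "p \<in> fock_space"
  have "p = (\<Sum>m\<in>Poly_Mapping.keys p. fscale (Poly_Mapping.lookup p m) (Poly_Mapping.single m 1))"
    by (simp add: fscale_single poly_mapping_sum_single)
  also have "\<dots> \<in> ?R"
    by (intro fock.span_sum fock.span_scale monom) (use p in \<open>auto simp: fock_space_def\<close>)
  finally show "p \<in> ?R" .
qed

section \<open>Integrality of Fock space elements\<close>


text \<open>The coefficients of the constant terms of \<open>E\<^sup>+(-\<alpha>\<^sub>k,x\<^sub>k) \<cdots> E\<^sup>+(-\<alpha>\<^sub>1,x\<^sub>1) p\<close>.\<close>

fun shift_eval :: "('h \<times> nat) list \<Rightarrow> 'h fock \<Rightarrow> complex" where
  "shift_eval [] p = Poly_Mapping.lookup p 0"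
| "shift_eval ((\<alpha>, j) # as) p = shift_eval as (shift \<alpha> j p)"

lemma shift_eval_add: "shift_eval as (p + q) = shift_eval as p + shift_eval as q"
  by (induction as p arbitrary: q rule: shift_eval.induct) (simp_all add: lookup_add shift_add)

lemma shift_eval_fscale: "shift_eval as (fscale c p) = c * shift_eval as p"
  by (induction as p rule: shift_eval.induct) (simp_all add: shift_fscale)

lemma shift_eval_zero [simp]: "shift_eval as 0 = 0"
  using shift_eval_fscale[of as 0 0] by simp

lemma shift_eval_diff: "shift_eval as (p - q) = shift_eval as p - shift_eval as q"
  using shift_eval_add[of as "p - q" q] by simp

lemma shift_eval_sum: "shift_eval as (sum f A) = (\<Sum>i\<in>A. shift_eval as (f i))"
  by (induction A rule: infinite_finite_induct) (simp_all add: shift_eval_add)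

text \<open>Padding: an entry of degree 0 leaves the value unchanged but adjusts the sum of the
  lattice vectors, hence the charge that is reached.\<close>

lemma shift_eval_append_0: "shift_eval (as @ [(\<alpha>, 0)]) p = shift_eval as p"
  by (induction as p rule: shift_eval.induct) simp_all

lemma Ints_subgroup: "additive_subgroup (\<int> :: complex set)"
  by (simp add: additive_subgroup_def)

definition integral_fock :: "'h fock set" where
  "integral_fock = {p. \<forall>as. fst ` set as \<subseteq> lat \<longrightarrow> shift_eval as p \<in> \<int>}"

lemma integral_fockD: "p \<in> integral_fock \<Longrightarrow> fst ` set as \<subseteq> lat \<Longrightarrow> shift_eval as p \<in> \<int>"
  by (simp add: integral_fock_def)

lemma integral_fock_subgroup: "additive_subgroup integral_fock"
  by (auto simp: additive_subgroup_def integral_fock_def shift_eval_diff)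

lemma integral_fock_fscale: "p \<in> integral_fock \<Longrightarrow> c \<in> \<int> \<Longrightarrow> fscale c p \<in> integral_fock"
  by (auto simp: integral_fock_def shift_eval_fscale)

lemma integral_fock_shift: "p \<in> integral_fock \<Longrightarrow> \<alpha> \<in> lat \<Longrightarrow> shift \<alpha> j p \<in> integral_fock"
proof -
  assume p: "p \<in> integral_fock" and \<alpha>: "\<alpha> \<in> lat"
  have "shift_eval as (shift \<alpha> j p) \<in> \<int>" if "fst ` set as \<subseteq> lat" for as
    using integral_fockD[OF p, of "(\<alpha>, j) # as"] that \<alpha> by simp
  then show ?thesis by (simp add: integral_fock_def)
qed

text \<open>The \<int>-span of these products is stable under all shifts by lattice vectors, and
  constant terms of its elements are integers. The induction over the list of shifts runs for the
  whole span.\<close>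

lemma cpl_prod_integral:
  assumes "fst ` set bs \<subseteq> dual_lat"
  shows "cpl_prod bs \<in> integral_fock"
proof -
  have "shift_eval as p \<in> \<int>"
    if "fst ` set as \<subseteq> lat" "p \<in> zspan fscale {cpl_prod bs |bs. fst ` set bs \<subseteq> dual_lat}" for as p
    using that
  proof (induction as arbitrary: p)
    case Nil
    from Nil(2) show ?case
      by (induction p rule: zspan_induct) (auto simp: vector_space_fscale lookup_cpl_prod_Ints lookup_minus)
  next
    case (Cons x as)
    obtain \<alpha> j where x: "x = (\<alpha>, j)" by (cases x)
    have "shift \<alpha> j p \<in> zspan fscale {cpl_prod bs |bs. fst ` set bs \<subseteq> dual_lat}"
    proof (rule zspan_image[OF Cons.prems(2) shift_diff])
      fix q assume "q \<in> {cpl_prod bs |bs. fst ` set bs \<subseteq> dual_lat}"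
      then obtain bs where bs: "q = cpl_prod bs" "fst ` set bs \<subseteq> dual_lat" by blast
      then show "shift \<alpha> j q \<in> zspan fscale {cpl_prod bs |bs. fst ` set bs \<subseteq> dual_lat}"
        using shift_cpl_prod_dual Cons.prems(1) x by simp
    qed (simp_all add: vector_space_fscale)
    then show ?case using Cons x by simp
  qed
  moreover have "cpl_prod bs \<in> zspan fscale {cpl_prod bs |bs. fst ` set bs \<subseteq> dual_lat}"
    by (rule zspan_base[OF vector_space_fscale]) (use assms in blast)
  ultimately show ?thesis by (simp add: integral_fock_def)
qed

text \<open>Multiplication by \<open>cpl \<alpha> i\<close> is moved to the left through the shifts, where it only lowers their
  degrees, until it is killed by the constant term.\<close>

lemma shift_eval_cpl_Ints:
  assumes "\<And>\<alpha>'. \<alpha>' \<in> fst ` set as \<Longrightarrow> form \<alpha>' \<alpha> \<in> \<int>"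
    and "\<And>as'. map fst as' = map fst as \<Longrightarrow> total as' + i = total as \<Longrightarrow> c * shift_eval as' p \<in> \<int>"
  shows "c * shift_eval as (cpl \<alpha> i * p) \<in> \<int>"
  using assms
proof (induction as arbitrary: i p)
  case Nil
  then show ?case using Nil(2)[of "[]"] by simp
next
  case (Cons x as)
  obtain \<alpha>' j where x: "x = (\<alpha>', j)" by (cases x)
  have "c * shift_eval as (fscale (signed_binom (form \<alpha>' \<alpha>) l) (cpl \<alpha> (i - l) * shift \<alpha>' (j - l) p)) \<in> \<int>"
    if "l \<le> j" "l \<le> i" for l
  proof -
    have "c * shift_eval as (cpl \<alpha> (i - l) * shift \<alpha>' (j - l) p) \<in> \<int>"
    proof (rule Cons.IH)
      fix as' assume "map fst as' = map fst as" "total as' + (i - l) = total as"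
      then show "c * shift_eval as' (shift \<alpha>' (j - l) p) \<in> \<int>"
        using Cons.prems(2)[of "(\<alpha>', j - l) # as'"] that x by simp
    qed (use Cons.prems(1) in simp)
    moreover have "signed_binom (form \<alpha>' \<alpha>) l \<in> \<int>"
      using Cons.prems(1)[of \<alpha>'] x by (intro signed_binom_Ints) simp
    ultimately show ?thesis
      unfolding shift_eval_fscale mult.left_commute[of c] by (rule Ints_mult[rotated])
  qed
  then show ?case
    unfolding x shift_eval.simps shift_cpl_mult shift_eval_sum sum_distrib_left
    by (intro additive_subgroup_sum[OF Ints_subgroup]) auto
qed

section \<open>Monomials in the dual basis and the integrality of their coefficients\<close>

definition dual_monom :: "('h \<times> nat) multiset \<Rightarrow> 'h fock" where
  "dual_monom M = prod_mset (image_mset (\<lambda>(b, n). cpl (dual_vec b) n) M)"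

lemma dual_monom_simps [simp]: "dual_monom {#} = 1"
  "dual_monom (add_mset (b, n) M) = cpl (dual_vec b) n * dual_monom M"
  by (simp_all add: dual_monom_def)

text \<open>Multisets account for the commuting factors, and \<open>n \<ge> 1\<close> excludes the
  trivial factor \<open>cpl b 0 = 1\<close>; otherwise one monomial would carry several
  indices.\<close>

definition dual_indices :: "('h \<times> nat) multiset set" where
  "dual_indices = {M. set_mset M \<subseteq> Basis \<times> {1..}}"

lemma dual_monom_cpl_prod:
  "dual_monom (mset bs) = cpl_prod (map (\<lambda>(b, n). (dual_vec b, n)) bs)"
  by (induction bs) auto

lemma dual_monom_eq_cpl_prod:
  assumes "M \<in> dual_indices"
  obtains bs where "dual_monom M = cpl_prod bs" "fst ` set bs \<subseteq> dual_lat"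
proof -
  obtain xs where "mset xs = M" using ex_mset by blast
  with assms show ?thesis
    by (intro that[of "map (\<lambda>(b, n). (dual_vec b, n)) xs"])
      (auto simp: dual_monom_cpl_prod[symmetric] dual_indices_def intro!: dual_vec_in_dual)
qed

lemma dual_monom_integral: "M \<in> dual_indices \<Longrightarrow> dual_monom M \<in> integral_fock"
  by (metis cpl_prod_integral dual_monom_eq_cpl_prod)

lemma dual_monom_in_fock: "M \<in> dual_indices \<Longrightarrow> dual_monom M \<in> fock_space"
  by (metis cpl_prod_in_fock dual_monom_eq_cpl_prod)

lemma fock_spanned_dual_monom: "fock_space \<subseteq> fock.span (dual_monom ` dual_indices)"
proof -
  have "b \<in> span (dual_vec ` Basis)" for b
  proof -
    have "(\<Sum>b'\<in>Basis. scale (form b' b) (dual_vec b')) \<in> span (dual_vec ` Basis)"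
      by (intro span_sum span_scale span_base) simp
    then show ?thesis by (simp add: dual_basis_expansion)
  qed
  then have "fock_space \<subseteq> fock.span {cpl_prod bs |bs. set bs \<subseteq> dual_vec ` Basis \<times> {1..}}"
    by (intro fock_spanned) auto
  also have "\<dots> \<subseteq> fock.span (dual_monom ` dual_indices)"
  proof (rule fock.span_mono, safe)
    fix bs :: "('h \<times> nat) list" assume "set bs \<subseteq> dual_vec ` Basis \<times> {1..}"
    then have "\<exists>xs. set xs \<subseteq> Basis \<times> {1..} \<and> bs = map (\<lambda>(b, n). (dual_vec b, n)) xs"
    proof (induction bs)
      case (Cons x bs)
      then obtain xs b n where "set xs \<subseteq> Basis \<times> {1..}" "bs = map (\<lambda>(b, n). (dual_vec b, n)) xs"
        "x = (dual_vec b, n)" "b \<in> Basis" "n \<ge> 1" by auto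
      then show ?case by (intro exI[of _ "(b, n) # xs"]) auto
    qed simp
    then obtain xs where "set xs \<subseteq> Basis \<times> {1..}" "bs = map (\<lambda>(b, n). (dual_vec b, n)) xs" by blast
    then show "cpl_prod bs \<in> dual_monom ` dual_indices"
      by (intro image_eqI[of _ _ "mset xs"]) (auto simp: dual_monom_cpl_prod dual_indices_def)
  qed
  finally show ?thesis .
qed

text \<open>For \<open>b\<close> in the basis, \<open>shift b\<close> acts on the factors \<open>cpl (dual_vec b) n\<close> by lowering \<open>n\<close> by at most
  \<open>1\<close>.  Hence \<open>shift b j\<close> kills every monomial with fewer than \<open>j\<close> factors of this kind, and for
  exactly \<open>j\<close> such factors lowers all of them.  This triangularity replaces the Gale--Ryser
  comparison of elementary and complete symmetric functions.\<close>

definition part_length :: "'h \<Rightarrow> ('h \<times> nat) multiset \<Rightarrow> nat" where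
  "part_length b M = size (filter_mset (\<lambda>x. fst x = b) M)"

text \<open>If the entries with first component \<open>b\<close> are read as a partition, this
  removes the first column of its Young diagram; parts equal to 1 disappear.\<close>

definition strip :: "'h \<Rightarrow> ('h \<times> nat) multiset \<Rightarrow> ('h \<times> nat) multiset" where
  "strip b M = filter_mset (\<lambda>x. snd x \<noteq> 0) (image_mset (\<lambda>(b', n). (b', if b' = b then n - 1 else n)) M)"

definition degree :: "('h \<times> nat) multiset \<Rightarrow> nat" where
  "degree M = sum_mset (image_mset snd M)"

lemma part_length_simps [simp]: "part_length b {#} = 0"
  "part_length b (add_mset (b', n) M) = (if b' = b then Suc (part_length b M) else part_length b M)"
  by (simp_all add: part_length_def)

lemma degree_simps [simp]: "degree {#} = 0" "degree (add_mset (b, n) M) = n + degree M"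
  by (simp_all add: degree_def)

lemma strip_simps: "strip b {#} = {#}"
  "strip b (add_mset (b', n) M) = (let n' = (if b' = b then n - 1 else n) in
    if n' = 0 then strip b M else add_mset (b', n') (strip b M))"
  by (simp_all add: strip_def Let_def)

lemma dual_indices_simps [simp]: "{#} \<in> dual_indices"
  "add_mset (b, n) M \<in> dual_indices \<longleftrightarrow> b \<in> Basis \<and> n \<ge> 1 \<and> M \<in> dual_indices"
  by (auto simp: dual_indices_def)

lemma shift_dual_monom:
  assumes "b \<in> Basis" "M \<in> dual_indices" "part_length b M \<le> j"
  shows "shift b j (dual_monom M) =
    (if j = part_length b M then fscale ((-1) ^ j) (dual_monom (strip b M)) else 0)"
  using assms(2,3)
proof (induction M arbitrary: j)
  case empty
  then show ?case by (simp add: shift_one strip_simps)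
next
  case (add x M)
  obtain b' n where x: "x = (b', n)" by (cases x)
  with add.prems have b': "b' \<in> Basis" "n \<ge> 1" and M: "M \<in> dual_indices" by auto
  show ?case
  proof (cases "b' = b")
    case False
    have "shift b j (dual_monom (add_mset x M)) = (\<Sum>i\<le>j. if i = 0 then cpl (dual_vec b') n * shift b j (dual_monom M) else 0)"
      unfolding x dual_monom_simps shift_cpl_mult
      by (intro sum.cong refl) (use False assms(1) b' in \<open>auto simp: form_dual_vec signed_binom_of_0\<close>)
    then show ?thesis using add False b' M by (simp add: x strip_simps)
  next
    case True
    with add.prems x have j: "part_length b M \<le> j - 1" "j \<ge> 1" "part_length b M \<noteq> j" "part_length b M \<le> j" by auto
    have "shift b j (dual_monom (add_mset x M)) =
        (\<Sum>i\<le>j. (if i = 0 then cpl (dual_vec b) n * shift b j (dual_monom M) else 0) +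
          (if i = 1 then - (cpl (dual_vec b) (n - 1) * shift b (j - 1) (dual_monom M)) else 0))"
      unfolding x dual_monom_simps shift_cpl_mult True
      by (intro sum.cong refl) (use assms(1) b' in \<open>auto simp: form_dual_vec signed_binom_of_1\<close>)
    \<comment> \<open>The term \<open>i = 0\<close> leaves all of \<open>j\<close> for
      \<open>M\<close>, which has fewer than \<open>j\<close> matching factors, so it vanishes by
      the induction hypothesis.\<close>
    also have "\<dots> = - (cpl (dual_vec b) (n - 1) * shift b (j - 1) (dual_monom M))"
      using j M add.IH[of j] by (simp add: sum.distrib)
    also have "\<dots> = (if j = Suc (part_length b M)
        then fscale ((-1) ^ j) (cpl (dual_vec b) (n - 1) * dual_monom (strip b M)) else 0)"
      using j M add.IH[of "j - 1"] by (cases j) auto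
    finally show ?thesis using True by (simp add: x strip_simps Let_def)
  qed
qed

lemma strip_in_indices: "M \<in> dual_indices \<Longrightarrow> strip b M \<in> dual_indices"
  by (auto simp: dual_indices_def strip_def split: if_splits)

lemma degree_strip: "M \<in> dual_indices \<Longrightarrow> degree (strip b M) + part_length b M = degree M"
  by (induction M) (auto simp: strip_simps Let_def)

lemma part_length_strip:
  "M \<in> dual_indices \<Longrightarrow> part_length b (strip b M) + count M (b, 1) = part_length b M"
proof (induction M)
  case (add x M)
  obtain b' n where "x = (b', n)" by (cases x)
  with add show ?case by (cases "b' = b"; cases "n = 1") (auto simp: strip_simps Let_def)
qed (simp add: strip_simps)

lemma unstrip:
  "M \<in> dual_indices \<Longrightarrow>
    image_mset (\<lambda>(b', n). (b', if b' = b then Suc n else n)) (strip b M) + replicate_mset (count M (b, 1)) (b, 1) = M"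
proof (induction M)
  case (add x M)
  obtain b' n where "x = (b', n)" by (cases x)
  with add show ?case by (cases "b' = b"; cases "n = 1") (auto simp: strip_simps Let_def)
qed (simp add: strip_simps)

text \<open>A partition is recovered from its diagram without the first column once its number of
  parts is known: that number tells how many parts equal to 1 were lost.\<close>

lemma inj_strip: "inj_on (strip b) {M \<in> dual_indices. part_length b M = K}"
proof (rule inj_onI)
  fix M M'
  assume "M \<in> {M \<in> dual_indices. part_length b M = K}" "M' \<in> {M \<in> dual_indices. part_length b M = K}"
    and eq: "strip b M = strip b M'"
  then have M: "M \<in> dual_indices" "M' \<in> dual_indices" "part_length b M = part_length b M'" by auto
  have "count M (b, 1) = count M' (b, 1)"
    using part_length_strip[OF M(1), of b] part_length_strip[OF M(2), of b] M(3) eq by simp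
  then show "M = M'" using unstrip[OF M(1), of b] unstrip[OF M(2), of b] eq by metis
qed

text \<open>Induction on the degree and, for a fixed basis vector \<open>b\<close>, on a bound for
  the number of \<open>b\<close>-parts. The monomials with the most \<open>b\<close>-parts have
  integral coefficients by the degree hypothesis; they are themselves integral and can be
  subtracted, which lowers the bound.\<close>

lemma dual_monom_coeff_Ints:
  assumes "finite F" "F \<subseteq> dual_indices" "\<And>M. M \<in> F \<Longrightarrow> degree M < N"
    and "(\<Sum>M\<in>F. fscale (c M) (dual_monom M)) \<in> integral_fock" "M \<in> F"
  shows "c M \<in> \<int>"
  using assms
proof (induction N arbitrary: F c M)
  case (Suc N)
  note IH = Suc.IH
  let ?p = "\<lambda>F. \<Sum>M\<in>F. fscale (c M) (dual_monom M)"
  have remove: "?p (F - G) \<in> integral_fock"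
    if "F \<subseteq> dual_indices" "finite F" "?p F \<in> integral_fock" "G \<subseteq> F" "\<And>M. M \<in> G \<Longrightarrow> c M \<in> \<int>" for F G
  proof -
    have "?p G \<in> integral_fock"
      using that by (intro additive_subgroup_sum[OF integral_fock_subgroup] integral_fock_fscale dual_monom_integral) auto
    then show ?thesis
      using that integral_fock_subgroup by (simp add: sum_diff additive_subgroup_def)
  qed
  have *: "c M \<in> \<int>"
    if "b \<in> Basis" "finite F" "F \<subseteq> dual_indices" "\<And>M. M \<in> F \<Longrightarrow> degree M < Suc N"
      "\<And>M. M \<in> F \<Longrightarrow> part_length b M \<le> K" "?p F \<in> integral_fock" "M \<in> F" "part_length b M > 0" for b K F M
    using that
  proof (induction K arbitrary: F M)
    case (Suc K)
    define G where "G = {M \<in> F. part_length b M = Suc K}"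
    have G: "finite G" "G \<subseteq> F" "G \<subseteq> dual_indices" using Suc.prems by (auto simp: G_def)
    have inj: "inj_on (strip b) G"
      by (rule inj_on_subset[OF inj_strip[of b "Suc K"]]) (use G in \<open>auto simp: G_def\<close>)
    define c' where "c' S = (-1) ^ Suc K * c (the_inv_into G (strip b) S)" for S
    have cG: "c M \<in> \<int>" if "M \<in> G" for M
    proof -
      \<comment> \<open>Since \<open>Suc K\<close> bounds all part lengths in \<open>F\<close>,
        exactly the monomials of \<open>G\<close> survive. They stay distinct after stripping, and
        their degree drops by \<open>Suc K\<close>.\<close>
      have "shift b (Suc K) (?p F) = (\<Sum>M\<in>F. if M \<in> G then fscale ((-1) ^ Suc K * c M) (dual_monom (strip b M)) else 0)"
        unfolding shift_sum
        by (intro sum.cong refl)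
          (use Suc.prems in \<open>auto simp: shift_fscale shift_dual_monom G_def subset_iff mult.commute\<close>)
      also have "\<dots> = (\<Sum>M\<in>G. fscale ((-1) ^ Suc K * c M) (dual_monom (strip b M)))"
        using Suc.prems(2) G by (simp add: sum.inter_restrict[symmetric] Int_absorb1)
      also have "\<dots> = (\<Sum>S\<in>strip b ` G. fscale (c' S) (dual_monom S))"
        by (simp add: sum.reindex[OF inj] c'_def the_inv_into_f_f[OF inj])
      finally have "(\<Sum>S\<in>strip b ` G. fscale (c' S) (dual_monom S)) \<in> integral_fock"
        using integral_fock_shift[OF Suc.prems(6) basis_in_lat[OF Suc.prems(1)], of "Suc K"] by simp
      moreover have "degree S < N" if S: "S \<in> strip b ` G" for S
      proof -
        obtain M' where M': "S = strip b M'" "M' \<in> G" using S by blast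
        then have "degree M' < Suc N" "part_length b M' = Suc K" "M' \<in> dual_indices"
          using Suc.prems(4) G by (auto simp: G_def)
        then show ?thesis using degree_strip[of M' b] M'(1) by simp
      qed
      ultimately have "c' (strip b M) \<in> \<int>"
        using G that by (intro IH[of "strip b ` G" c']) (auto intro: strip_in_indices)
      then have "(-1) ^ Suc K * c M \<in> \<int>"
        by (simp add: c'_def the_inv_into_f_f[OF inj that])
      then show ?thesis by (cases "even K") (auto simp: minus_in_Ints_iff)
    qed
    show ?case
    proof (cases "M \<in> G")
      case False
      show ?thesis
      proof (rule Suc.IH[of "F - G"])
        show "?p (F - G) \<in> integral_fock"
          by (rule remove) (use Suc.prems G cG in auto)
        show "part_length b M \<le> K" if "M \<in> F - G" for M
          using that Suc.prems(5)[of M] by (auto simp: G_def)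
      qed (use Suc.prems False in auto)
    qed (rule cG)
  qed simp
  have nonempty: "c M \<in> \<int>" if M: "M \<in> F" "M \<noteq> {#}" for M
  proof -
    obtain b n where bn: "(b, n) \<in># M" using M(2) by (metis multiset_nonemptyE surj_pair)
    then have "b \<in> Basis" using M Suc.prems(2) by (auto simp: dual_indices_def)
    moreover have "part_length b M > 0"
      using bn by (force simp: part_length_def filter_mset_eq_conv nonempty_has_size[symmetric])
    moreover obtain K where "\<forall>M\<in>F. part_length b M \<le> K"
      using finite_nat_set_iff_bounded_le[of "part_length b ` F"] Suc.prems(1) by auto
    ultimately show ?thesis
      using *[of b F K M] Suc.prems M by blast
  qed
  show ?case
  proof (cases "M = {#}")
    case True
    \<comment> \<open>After the nonempty monomials are subtracted, only the constant is left, and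
      the empty list of shifts reads off its coefficient.\<close>
    have "?p (F - (F - {{#}})) \<in> integral_fock"
      by (rule remove) (use Suc.prems nonempty in auto)
    moreover have "F - (F - {{#}}) = {{#}}" using Suc.prems(5) True by auto
    ultimately have "fscale (c {#}) 1 \<in> integral_fock" by simp
    from integral_fockD[OF this, of "[]"] show ?thesis using True by simp
  qed (use nonempty Suc.prems in auto)
qed auto

section \<open>Vertex operators on the lattice spaces\<close>


text \<open>\<open>shift \<alpha> j\<close> lowers \<open>total\<close> by exactly \<open>j\<close>,
  so for \<open>j > total bs\<close> a product of complete functions over L is sent into the span of
  the empty set.\<close>

lemma shift_locally_nilpotent:
  assumes "\<alpha> \<in> lat" "p \<in> fock_space"
  shows "\<exists>N. \<forall>j>N. shift \<alpha> j p = 0"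
proof -
  have "Basis \<subseteq> span lat" using basis_in_lat span_superset by blast
  then have "p \<in> fock.span {cpl_prod bs |bs. set bs \<subseteq> lat \<times> {1..}}"
    using fock_spanned assms(2) by blast
  then show ?thesis
  proof (induction p rule: fock.span_induct_alt)
    case (step c x y)
    then obtain bs N where bs: "x = cpl_prod bs" "set bs \<subseteq> lat \<times> {1..}" and N: "\<forall>j>N. shift \<alpha> j y = 0"
      by blast
    have "shift \<alpha> j x = 0" if "j > total bs" for j
    proof -
      have "form \<alpha> \<gamma> \<in> \<int>" if "\<gamma> \<in> fst ` set bs" for \<gamma>
        using that bs(2) assms(1) by (auto intro!: form_lat_dual lat_in_dual)
      from shift_cpl_prod[OF this, where j=j]
      have "shift \<alpha> j x \<in> zspan fscale {cpl_prod bs' |bs'. map fst bs' = map fst bs \<and> total bs' + j = total bs}"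
        unfolding bs(1) .
      moreover have "{cpl_prod bs' |bs'. map fst bs' = map fst bs \<and> total bs' + j = total bs} = {}"
        using that by auto
      ultimately show ?thesis by (simp only: zspan_empty[OF vector_space_fscale] singleton_iff)
    qed
    then show ?case using N by (intro exI[of _ "max N (total bs)"]) (simp add: shift_add shift_fscale)
  qed simp
qed

lemma coset_space_subspace: "lspace.subspace (coset_space \<beta>)"
proof (rule lspace.subspaceI)
  fix u v :: "'h lspace" assume uv: "u \<in> coset_space \<beta>" "v \<in> coset_space \<beta>"
  have "\<gamma> - \<beta> \<in> lat \<and> Poly_Mapping.lookup (u + v) \<gamma> \<in> fock_space" if "\<gamma> \<in> Poly_Mapping.keys (u + v)" for \<gamma>
  proof -
    have "\<gamma> \<in> Poly_Mapping.keys u \<or> \<gamma> \<in> Poly_Mapping.keys v" using that Poly_Mapping.keys_add[of u v] by blast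
    moreover have "Poly_Mapping.lookup w \<gamma> \<in> fock_space" if "w \<in> coset_space \<beta>" for w :: "'h lspace"
      using that by (cases "\<gamma> \<in> Poly_Mapping.keys w") (auto simp: coset_space_def in_keys_iff)
    ultimately show ?thesis
      using uv by (auto simp: coset_space_def lookup_add intro!: fock_space_add)
  qed
  then show "u + v \<in> coset_space \<beta>" by (simp add: coset_space_def)
next
  fix c and u :: "'h lspace" assume "u \<in> coset_space \<beta>"
  then show "vscale c u \<in> coset_space \<beta>"
    by (auto simp: coset_space_def in_keys_iff fock_space_scale)
qed (simp add: coset_space_def)

lemmas coset_space_diff = lspace.subspace_diff[OF coset_space_subspace]
  and coset_space_scale = lspace.subspace_scale[OF coset_space_subspace]
  and coset_space_zero [simp] = lspace.subspace_0[OF coset_space_subspace]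
  and coset_space_sum = lspace.subspace_sum[OF coset_space_subspace]

lemma coset_space_subgroup: "additive_subgroup (coset_space \<beta>)"
  by (simp add: additive_subgroup_def coset_space_diff)

lemma lookup_coset_space: "v \<in> coset_space \<beta> \<Longrightarrow> Poly_Mapping.lookup v \<gamma> \<in> fock_space"
  by (cases "\<gamma> \<in> Poly_Mapping.keys v") (auto simp: coset_space_def in_keys_iff)

lemma single_in_coset: "\<gamma> - \<beta> \<in> lat \<Longrightarrow> p \<in> fock_space \<Longrightarrow> Poly_Mapping.single \<gamma> p \<in> coset_space \<beta>"
  by (auto simp: coset_space_def split: if_splits)

lemma iota_in_coset: "\<gamma> - \<beta> \<in> lat \<Longrightarrow> iota \<gamma> \<in> coset_space \<beta>"
  by (simp add: iota_def single_in_coset)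

lemma coset_dual: "\<beta> \<in> dual_lat \<Longrightarrow> \<gamma> - \<beta> \<in> lat \<Longrightarrow> \<gamma> \<in> dual_lat"
  using dual_add[of \<beta> "\<gamma> - \<beta>"] lat_in_dual by simp

lemma vscale_single: "vscale c (Poly_Mapping.single \<gamma> p) = Poly_Mapping.single \<gamma> (fscale c p)"
  by (rule poly_mapping_eqI) (simp add: lookup_single when_def)

lemma E_minus_single:
  "E_minus (- \<beta>) k (Poly_Mapping.single \<gamma> p) = Poly_Mapping.single \<gamma> (cpl \<beta> k * p)"
  by (rule poly_mapping_eqI) (simp add: lookup_E_minus lookup_single when_def)

lemma E_plus_single:
  "E_plus (- \<beta>) k (Poly_Mapping.single \<gamma> p) = Poly_Mapping.single \<gamma> (shift \<beta> k p)"
  by (rule poly_mapping_eqI) (simp add: lookup_E_plus lookup_single when_def)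

end

section \<open>Modes of the vertex operators on the components of a vector\<close>

context lattice_cocycle
begin

lemma eps_nonzero: "\<beta> \<in> dual_lat \<Longrightarrow> \<gamma> \<in> dual_lat \<Longrightarrow> eps \<beta> \<gamma> \<noteq> 0"
  using eps_root_of_unity[of \<beta> \<gamma>] by (auto simp: power_0_left)

lemma eps_zero_left [simp]: "\<gamma> \<in> dual_lat \<Longrightarrow> eps 0 \<gamma> = 1"
  using eps_add_left[of 0 0 \<gamma>] eps_nonzero[of 0 \<gamma>] by simp

lemma e_op_single: "e_op \<alpha> (Poly_Mapping.single \<gamma> p) = Poly_Mapping.single (\<alpha> + \<gamma>) (fscale (eps \<alpha> \<gamma>) p)"
  by (simp add: e_op_def)

lemma vop_term:
  "E_minus (- \<alpha>) i (E_plus (- \<alpha>) j (e_op \<alpha> (Poly_Mapping.single \<gamma> p))) =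
    Poly_Mapping.single (\<alpha> + \<gamma>) (fscale (eps \<alpha> \<gamma>) (cpl \<alpha> i * shift \<alpha> j p))"
  by (simp add: e_op_single E_plus_single E_minus_single shift_fscale)

lemma lookup_vop_eq_0:
  assumes "Poly_Mapping.lookup v (\<delta> - \<alpha>) = 0"
  shows "Poly_Mapping.lookup (lattice_vop \<alpha> n v) \<delta> = 0"
  unfolding lattice_vop_def Sum_any.expand_set lookup_sum vop_term
  by (rule sum.neutral) (use assms in \<open>auto simp: lookup_single when_def split: if_splits\<close>)

text \<open>At a fixed charge \<gamma> the power of x determines \<open>i - j = d\<close>, so one
  index \<open>j\<close> is left, and local nilpotency bounds it by \<open>N\<close>.\<close>

lemma lookup_vop:
  assumes \<alpha>: "\<alpha> \<in> lat" and \<beta>: "\<beta> \<in> dual_lat" and v: "v \<in> coset_space \<beta>"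
    and d: "of_int d = of_int (- n - 1) - form \<alpha> \<gamma>"
    and N: "\<And>j. j > N \<Longrightarrow> shift \<alpha> j (Poly_Mapping.lookup v \<gamma>) = 0"
  shows "Poly_Mapping.lookup (lattice_vop \<alpha> n v) (\<alpha> + \<gamma>) = fscale (eps \<alpha> \<gamma>)
    (\<Sum>j\<le>N. if int j + d \<ge> 0 then cpl \<alpha> (nat (int j + d)) * shift \<alpha> j (Poly_Mapping.lookup v \<gamma>) else 0)"
proof -
  define t where "t = (\<lambda>(\<eta>, i, j).
     if of_int (int i - int j) + form \<alpha> \<eta> = of_int (- n - 1)
     then E_minus (-\<alpha>) i (E_plus (-\<alpha>) j
            (e_op \<alpha> (Poly_Mapping.single \<eta> (Poly_Mapping.lookup v \<eta>))))
     else 0)"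
  have "\<forall>\<eta>\<in>Poly_Mapping.keys v. \<exists>k::int. form \<alpha> \<eta> = of_int k"
  proof
    fix \<eta> assume "\<eta> \<in> Poly_Mapping.keys v"
    then have "\<eta> - \<beta> \<in> lat" using v by (simp add: coset_space_def)
    from coset_dual[OF \<beta> this] show "\<exists>k::int. form \<alpha> \<eta> = of_int k"
      using form_lat_dual[OF \<alpha>] Ints_cases by blast
  qed
  then obtain k :: "'h \<Rightarrow> int" where k: "\<And>\<eta>. \<eta> \<in> Poly_Mapping.keys v \<Longrightarrow> form \<alpha> \<eta> = of_int (k \<eta>)"
    by metis
  obtain M where M: "\<And>\<eta> j. j > M \<eta> \<Longrightarrow> shift \<alpha> j (Poly_Mapping.lookup v \<eta>) = 0"
    using shift_locally_nilpotent[OF \<alpha> lookup_coset_space[OF v]] by metis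
  \<comment> \<open>\<open>Sum_any\<close> is a genuine sum only for finite support, so finiteness
    is established over all charges together before one component is extracted.\<close>
  have fin: "finite {x. t x \<noteq> 0}"
  proof (rule finite_subset)
    show "{x. t x \<noteq> 0} \<subseteq> (\<lambda>(\<eta>, j). (\<eta>, nat (int j - n - 1 - k \<eta>), j)) ` (SIGMA \<eta>:Poly_Mapping.keys v. {..M \<eta>})"
    proof safe
      fix \<eta> i j assume "t (\<eta>, i, j) \<noteq> 0"
      then have eq: "of_int (int i - int j) + form \<alpha> \<eta> = of_int (- n - 1)"
        and nz: "shift \<alpha> j (Poly_Mapping.lookup v \<eta>) \<noteq> 0"
        by (auto simp: t_def vop_term split: if_splits)
      have \<eta>: "\<eta> \<in> Poly_Mapping.keys v" using nz by (auto simp: in_keys_iff)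
      have "(of_int (int i - int j + k \<eta>) :: complex) = of_int (- n - 1)"
        using eq k[OF \<eta>] by simp
      then have "int i - int j + k \<eta> = - n - 1" by (simp only: of_int_eq_iff)
      then have "i = nat (int j - n - 1 - k \<eta>)" by linarith
      moreover have "j \<le> M \<eta>" using nz M by (meson not_le)
      ultimately show "(\<eta>, i, j) \<in> (\<lambda>(\<eta>, j). (\<eta>, nat (int j - n - 1 - k \<eta>), j)) ` (SIGMA \<eta>:Poly_Mapping.keys v. {..M \<eta>})"
        using \<eta> by (intro image_eqI[of _ _ "(\<eta>, j)"]) auto
    qed
  qed simp
  define C where "C = (\<lambda>j. (\<gamma>, nat (int j + d), j)) ` {j\<in>{..N}. int j + d \<ge> 0}"
  let ?A = "{x. t x \<noteq> 0} \<union> C"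
  have A: "finite ?A" using fin by (simp add: C_def)
  have t_C: "Poly_Mapping.lookup (t (\<gamma>, nat (int j + d), j)) (\<alpha> + \<gamma>) =
      fscale (eps \<alpha> \<gamma>) (cpl \<alpha> (nat (int j + d)) * shift \<alpha> j (Poly_Mapping.lookup v \<gamma>))"
    if "int j + d \<ge> 0" for j
  proof -
    have "int (nat (int j + d)) - int j = d" using that by simp
    then have "of_int (int (nat (int j + d)) - int j) + form \<alpha> \<gamma> = of_int (- n - 1)"
      by (simp only: d) simp
    then show ?thesis by (simp only: t_def prod.case simp_thms if_True vop_term lookup_single_eq)
  qed
  have "lattice_vop \<alpha> n v = Sum_any t" by (simp add: lattice_vop_def t_def)
  also have "\<dots> = sum t ?A" by (rule Sum_any.expand_superset[OF A]) simp
  finally have "Poly_Mapping.lookup (lattice_vop \<alpha> n v) (\<alpha> + \<gamma>) = (\<Sum>x\<in>?A. Poly_Mapping.lookup (t x) (\<alpha> + \<gamma>))"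
    by (simp add: lookup_sum)
  also have "\<dots> = (\<Sum>x\<in>C. Poly_Mapping.lookup (t x) (\<alpha> + \<gamma>))"
  proof (rule sum.mono_neutral_right[OF A])
    show "\<forall>x\<in>?A - C. Poly_Mapping.lookup (t x) (\<alpha> + \<gamma>) = 0"
    proof (rule ballI, rule ccontr)
      fix x assume x: "x \<in> ?A - C" "Poly_Mapping.lookup (t x) (\<alpha> + \<gamma>) \<noteq> 0"
      obtain \<eta> i j where xe: "x = (\<eta>, i, j)" by (metis surj_pair)
      from x(2) have eq: "of_int (int i - int j) + form \<alpha> \<eta> = of_int (- n - 1)"
        and \<eta>: "\<alpha> + \<eta> = (\<alpha> + \<gamma>)" and nz: "shift \<alpha> j (Poly_Mapping.lookup v \<eta>) \<noteq> 0"
        by (auto simp: xe t_def vop_term lookup_single when_def split: if_splits)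
      have \<eta>': "\<eta> = \<gamma>" using \<eta> by (simp add: algebra_simps)
      have "(of_int (int i - int j) :: complex) = of_int d" using eq unfolding d \<eta>' by (simp only: eq_diff_eq)
      then have "int i - int j = d" by (simp only: of_int_eq_iff)
      moreover have "j \<le> N" using nz N \<eta>' by (meson not_le)
      ultimately have "x \<in> C" using \<eta>' xe unfolding C_def by (intro image_eqI[of _ _ j]) auto
      then show False using x by simp
    qed
  qed simp
  also have "\<dots> = (\<Sum>j\<in>{j\<in>{..N}. int j + d \<ge> 0}. Poly_Mapping.lookup (t (\<gamma>, nat (int j + d), j)) (\<alpha> + \<gamma>))"
    unfolding C_def by (subst sum.reindex) (auto simp: inj_on_def)
  also have "\<dots> = (\<Sum>j\<in>{j\<in>{..N}. int j + d \<ge> 0}.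
      fscale (eps \<alpha> \<gamma>) (cpl \<alpha> (nat (int j + d)) * shift \<alpha> j (Poly_Mapping.lookup v \<gamma>)))"
    by (intro sum.cong refl) (use t_C in auto)
  also have "\<dots> = (\<Sum>j\<le>N. if int j + d \<ge> 0 then
      fscale (eps \<alpha> \<gamma>) (cpl \<alpha> (nat (int j + d)) * shift \<alpha> j (Poly_Mapping.lookup v \<gamma>)) else 0)"
    by (rule sum.inter_filter) simp
  finally show ?thesis
    by (simp add: fock.scale_sum_right if_distrib[of "fscale _"] cong: if_cong)
qed

lemma vop_single:
  assumes \<alpha>: "\<alpha> \<in> lat" and \<gamma>: "\<gamma> \<in> dual_lat" and p: "p \<in> fock_space"
    and d: "of_int d = of_int (- n - 1) - form \<alpha> \<gamma>"
    and N: "\<And>j. j > N \<Longrightarrow> shift \<alpha> j p = 0"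
  shows "lattice_vop \<alpha> n (Poly_Mapping.single \<gamma> p) = Poly_Mapping.single (\<alpha> + \<gamma>)
    (fscale (eps \<alpha> \<gamma>) (\<Sum>j\<le>N. if int j + d \<ge> 0 then cpl \<alpha> (nat (int j + d)) * shift \<alpha> j p else 0))"
proof (rule poly_mapping_eqI)
  fix \<delta>
  show "Poly_Mapping.lookup (lattice_vop \<alpha> n (Poly_Mapping.single \<gamma> p)) \<delta> =
    Poly_Mapping.lookup (Poly_Mapping.single (\<alpha> + \<gamma>)
      (fscale (eps \<alpha> \<gamma>) (\<Sum>j\<le>N. if int j + d \<ge> 0 then cpl \<alpha> (nat (int j + d)) * shift \<alpha> j p else 0))) \<delta>"
  proof (cases "\<delta> = \<alpha> + \<gamma>")
    case True
    have "Poly_Mapping.single \<gamma> p \<in> coset_space \<gamma>" using p by (simp add: single_in_coset)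
    from lookup_vop[OF \<alpha> \<gamma> this, where \<gamma>=\<gamma>, of d n N] show ?thesis using d N True by (simp cong: if_cong)
  next
    case False
    then have "\<gamma> \<noteq> \<delta> - \<alpha>" by (auto simp: algebra_simps)
    then have "Poly_Mapping.lookup (Poly_Mapping.single \<gamma> p) (\<delta> - \<alpha>) = 0"
      by (simp add: lookup_single)
    from lookup_vop_eq_0[OF this] show ?thesis using False by (simp add: lookup_single)
  qed
qed

text \<open>\<open>charged \<beta> \<alpha> p\<close> is \<open>p \<otimes> e\<^sub>\<alpha> e\<^sub>\<beta>\<close>.\<close>

definition charged :: "'h \<Rightarrow> 'h \<Rightarrow> 'h fock \<Rightarrow> 'h lspace" where
  "charged \<beta> \<alpha> p = Poly_Mapping.single (\<alpha> + \<beta>) (fscale (eps \<alpha> \<beta>) p)"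

lemma charged_diff: "charged \<beta> \<alpha> (p - q) = charged \<beta> \<alpha> p - charged \<beta> \<alpha> q"
  by (simp add: charged_def fock.scale_right_diff_distrib single_diff)

lemma charged_fscale: "charged \<beta> \<alpha> (fscale c p) = vscale c (charged \<beta> \<alpha> p)"
  by (simp add: charged_def vscale_single mult.commute)

lemma charged_in_coset: "\<alpha> \<in> lat \<Longrightarrow> p \<in> fock_space \<Longrightarrow> charged \<beta> \<alpha> p \<in> coset_space \<beta>"
  by (simp add: charged_def single_in_coset fock_space_scale)

lemma foldr_E_minus:
  "foldr (\<lambda>(\<beta>', k). E_minus (- \<beta>') k) bs (e_op \<alpha> (iota \<beta>)) = charged \<beta> \<alpha> (cpl_prod bs)"
proof (induction bs)
  case (Cons x bs)
  then show ?case by (cases x) (simp add: charged_def E_minus_single)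
qed (simp add: charged_def iota_def e_op_single)

lemma E_minus_span_charged:
  "E_minus_span S \<beta> = zspan vscale {charged \<beta> \<alpha> (cpl_prod bs) |bs \<alpha>. fst ` set bs \<subseteq> S \<and> \<alpha> \<in> lat}"
  by (simp add: E_minus_span_def foldr_E_minus)

lemma E_minus_span_subset_coset: "E_minus_span S \<beta> \<subseteq> coset_space \<beta>"
  unfolding E_minus_span_charged
  by (rule zspan_minimal[OF vector_space_vscale coset_space_subgroup])
    (auto intro!: charged_in_coset cpl_prod_in_fock)

text \<open>Associativity of the twisted group algebra: multiplying
  \<open>e_\<alpha>' e_\<beta>\<close> by \<open>e_\<alpha>\<close> gives
  \<open>e_(\<alpha>+\<alpha>') e_\<beta>\<close> times \<open>eps \<alpha> \<alpha>'\<close>, a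
  sign. The cocycle values at \<beta> are absorbed into \<open>charged\<close>, so integrality is
  not disturbed by roots of unity.\<close>

lemma vop_charged:
  assumes \<beta>: "\<beta> \<in> dual_lat" and \<alpha>: "\<alpha> \<in> lat" "\<alpha>' \<in> lat" and bs: "fst ` set bs \<subseteq> dual_lat"
  shows "lattice_vop \<alpha> n (charged \<beta> \<alpha>' (cpl_prod bs)) \<in> E_minus_span dual_lat \<beta>"
proof -
  let ?D = "E_minus_span dual_lat \<beta>"
  have D: "additive_subgroup ?D"
    unfolding E_minus_span_def by (rule additive_subgroup_zspan[OF vector_space_vscale])
  have dual: "\<alpha> \<in> dual_lat" "\<alpha>' \<in> dual_lat" using \<alpha> lat_in_dual by auto
  have \<gamma>: "\<alpha>' + \<beta> \<in> dual_lat" using dual \<beta> dual_add by blast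
  obtain k :: int where k: "form \<alpha> (\<alpha>' + \<beta>) = of_int k"
    using form_lat_dual[OF \<alpha>(1) \<gamma>] Ints_cases by blast
  define d where "d = - n - 1 - k"
  obtain N where N: "\<And>j. j > N \<Longrightarrow> shift \<alpha> j (cpl_prod bs) = 0"
    using shift_locally_nilpotent[OF \<alpha>(1) cpl_prod_in_fock] by blast
  have eps: "eps \<alpha> (\<alpha>' + \<beta>) * eps \<alpha>' \<beta> = eps \<alpha> \<alpha>' * eps (\<alpha> + \<alpha>') \<beta>"
    using eps_add_right[OF dual(1,2) \<beta>] eps_add_left[OF dual(1,2) \<beta>] by simp
  have in_D: "vscale (eps \<alpha> \<alpha>') (charged \<beta> (\<alpha> + \<alpha>') (cpl \<alpha> i * q)) \<in> ?D"
    if "q \<in> zspan fscale {cpl_prod bs |bs. fst ` set bs \<subseteq> dual_lat}" for q i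
    using that
  proof (rule zspan_image[where f="\<lambda>q. vscale (eps \<alpha> \<alpha>') (charged \<beta> (\<alpha> + \<alpha>') (cpl \<alpha> i * q))" and s'=vscale
        and Y="{charged \<beta> \<alpha> (cpl_prod bs) |bs \<alpha>. fst ` set bs \<subseteq> dual_lat \<and> \<alpha> \<in> lat}", folded E_minus_span_charged])
    fix q assume "q \<in> {cpl_prod bs |bs. fst ` set bs \<subseteq> dual_lat}"
    then obtain bs where bs: "q = cpl_prod bs" "fst ` set bs \<subseteq> dual_lat" by blast
    have "charged \<beta> (\<alpha> + \<alpha>') (cpl_prod ((\<alpha>, i) # bs)) \<in> ?D"
      unfolding E_minus_span_charged
      by (rule zspan_base[OF vector_space_vscale],
          intro CollectI exI[of _ "(\<alpha>, i) # bs"] exI[of _ "\<alpha> + \<alpha>'"])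
        (use bs dual \<alpha> in \<open>auto intro!: lat_add\<close>)
    moreover have "eps \<alpha> \<alpha>' = of_int 1 \<or> eps \<alpha> \<alpha>' = of_int (-1)" using eps_sign[OF \<alpha>] by auto
    ultimately show "vscale (eps \<alpha> \<alpha>') (charged \<beta> (\<alpha> + \<alpha>') (cpl \<alpha> i * q)) \<in> ?D"
      using additive_subgroup_scale_int[OF vector_space_vscale D] bs(1) by (metis cpl_prod_simps(2))
  qed (simp_all add: vector_space_fscale vector_space_vscale right_diff_distrib charged_diff lspace.scale_right_diff_distrib)
  note shift_in = shift_cpl_prod_dual[OF \<alpha>(1) bs]
  have "lattice_vop \<alpha> n (charged \<beta> \<alpha>' (cpl_prod bs)) = Poly_Mapping.single (\<alpha> + (\<alpha>' + \<beta>))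
    (fscale (eps \<alpha> (\<alpha>' + \<beta>)) (\<Sum>j\<le>N. if int j + d \<ge> 0 then cpl \<alpha> (nat (int j + d)) *
      shift \<alpha> j (fscale (eps \<alpha>' \<beta>) (cpl_prod bs)) else 0))"
    unfolding charged_def
    by (rule vop_single[OF \<alpha>(1) \<gamma>])
      (use N k in \<open>auto simp: shift_fscale d_def cpl_prod_in_fock fock_space_scale\<close>)
  also have "\<dots> = (\<Sum>j\<le>N. if int j + d \<ge> 0 then
      vscale (eps \<alpha> \<alpha>') (charged \<beta> (\<alpha> + \<alpha>') (cpl \<alpha> (nat (int j + d)) * shift \<alpha> j (cpl_prod bs))) else 0)"
    by (rule poly_mapping_eqI)
      (auto simp: lookup_sum lookup_single when_def charged_def shift_fscale fock.scale_sum_right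
        add.assoc eps if_distrib[of "fscale _"] if_distrib[of "\<lambda>v. Poly_Mapping.lookup v _"]
        intro!: sum.cong cong: if_cong)
  also have "\<dots> \<in> ?D"
    using D in_D shift_in by (intro additive_subgroup_sum[OF D]) (auto simp: additive_subgroup_def)
  finally show ?thesis .
qed

text \<open>Integrality of the constant term at charge \<open>\<beta>\<close> of all elements of a set that is stable under the
  vertex operators gives integrality, up to the cocycle, of all components: the leading term of the
  component of \<open>lattice_vop \<alpha> n u\<close> is \<open>shift \<alpha> j\<close> of a component of \<open>u\<close>, and the remaining terms have
  lower degree in the outer shifts.\<close>

lemma stable_components_eval:
  assumes \<beta>: "\<beta> \<in> dual_lat" and T: "T \<subseteq> coset_space \<beta>"
    and vop: "\<And>u \<alpha> n. u \<in> T \<Longrightarrow> \<alpha> \<in> lat \<Longrightarrow> lattice_vop \<alpha> n u \<in> T"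
    and const: "\<And>u. u \<in> T \<Longrightarrow> Poly_Mapping.lookup (Poly_Mapping.lookup u \<beta>) 0 \<in> \<int>"
    and u: "u \<in> T" and as: "set (map fst as) \<subseteq> lat" "\<gamma> + sum_list (map fst as) = \<beta>"
  shows "eps (\<beta> - \<gamma>) \<gamma> * shift_eval as (Poly_Mapping.lookup u \<gamma>) \<in> \<int>"
proof -
  have "eps (\<beta> - \<gamma>) \<gamma> * shift_eval as (Poly_Mapping.lookup u \<gamma>) \<in> \<int>"
    if "u \<in> T" "map fst as = \<alpha>s" "set \<alpha>s \<subseteq> lat" "\<gamma> + sum_list \<alpha>s = \<beta>" for \<alpha>s as u \<gamma>
    using that
  proof (induction \<alpha>s arbitrary: as u \<gamma>)
    case Nil
    then show ?case using const[of u] \<beta> by simp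
  next
    case (Cons \<alpha> \<alpha>s)
    note IH = Cons.IH
    from Cons.prems have \<alpha>: "\<alpha> \<in> lat" and \<alpha>s: "set \<alpha>s \<subseteq> lat" and \<gamma>_sum: "(\<gamma> + \<alpha>) + sum_list \<alpha>s = \<beta>"
      and u: "u \<in> T" by (auto simp: add.assoc)
    have sum_lat: "sum_list \<alpha>s \<in> lat"
      using \<alpha>s by (induction \<alpha>s) (auto intro: lat_add)
    have \<gamma>_lat: "\<beta> - \<gamma> - \<alpha> \<in> lat" using sum_lat \<gamma>_sum by (metis add_diff_cancel_left' diff_diff_add)
    have \<gamma>: "\<gamma> \<in> dual_lat"
    proof -
      have "\<gamma> = \<beta> - (\<alpha> + sum_list \<alpha>s)" using \<gamma>_sum by (simp add: algebra_simps)
      then show ?thesis using \<beta> dual_diff lat_in_dual lat_add \<alpha> sum_lat by presburger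
    qed
    let ?p = "Poly_Mapping.lookup u \<gamma>"
    let ?f = "eps (\<beta> - \<gamma>) \<gamma>"
    have uc: "u \<in> coset_space \<beta>" using u T by blast
    obtain N where N: "\<And>j. j > N \<Longrightarrow> shift \<alpha> j ?p = 0"
      using shift_locally_nilpotent[OF \<alpha> lookup_coset_space[OF uc]] by blast
    obtain g :: int where g: "form \<alpha> \<gamma> = of_int g"
      using form_lat_dual[OF \<alpha> \<gamma>] Ints_cases by blast
    have *: "?f * shift_eval bs (shift \<alpha> j ?p) \<in> \<int>" if "map fst bs = \<alpha>s" for bs j
      using that
    proof (induction "total bs" arbitrary: bs j rule: less_induct)
      case less
      \<comment> \<open>This mode makes \<open>d = - j\<close>, so the term with
        \<open>shift \<alpha> j\<close> carries \<open>cpl \<alpha> 0 = 1\<close> and lower shifts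
        do not occur.\<close>
      define n where "n = int j - 1 - g"
      let ?w = "lattice_vop \<alpha> n u"
      define M where "M = max N j"
      have "?w \<in> T" using vop u \<alpha> by blast
      then have 1: "eps (\<beta> - (\<gamma> + \<alpha>)) (\<gamma> + \<alpha>) * shift_eval bs (Poly_Mapping.lookup ?w (\<gamma> + \<alpha>)) \<in> \<int>"
        by (rule IH) (use less.prems \<alpha>s \<gamma>_sum in auto)
      have "Poly_Mapping.lookup ?w (\<alpha> + \<gamma>) = fscale (eps \<alpha> \<gamma>)
          (\<Sum>l\<le>M. if int l + - int j \<ge> 0 then cpl \<alpha> (nat (int l + - int j)) * shift \<alpha> l ?p else 0)"
        by (rule lookup_vop[OF \<alpha> \<beta> uc]) (use N g in \<open>auto simp: n_def M_def\<close>)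
      also have "(\<Sum>l\<le>M. if int l + - int j \<ge> 0 then cpl \<alpha> (nat (int l + - int j)) * shift \<alpha> l ?p else 0)
         = (\<Sum>l\<in>{j..M}. cpl \<alpha> (l - j) * shift \<alpha> l ?p)"
        by (rule sum.mono_neutral_cong_right) (auto simp: nat_minus_as_int)
      also have "\<dots> = shift \<alpha> j ?p + (\<Sum>l\<in>{j<..M}. cpl \<alpha> (l - j) * shift \<alpha> l ?p)"
      proof -
        have "{j..M} = insert j {j<..M}" by (auto simp: M_def)
        then show ?thesis by simp
      qed
      finally have 2: "shift_eval bs (Poly_Mapping.lookup ?w (\<gamma> + \<alpha>)) = eps \<alpha> \<gamma> *
          (shift_eval bs (shift \<alpha> j ?p) + (\<Sum>l\<in>{j<..M}. shift_eval bs (cpl \<alpha> (l - j) * shift \<alpha> l ?p)))"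
        by (simp add: shift_eval_fscale shift_eval_add shift_eval_sum add.commute[of \<gamma>])
      have dual: "\<beta> - \<gamma> - \<alpha> \<in> dual_lat" "\<alpha> \<in> dual_lat" using \<gamma>_lat \<alpha> lat_in_dual by auto
      \<comment> \<open>Bimultiplicativity compares the normalizations at the charges
        \<open>\<gamma> + \<alpha>\<close> and \<gamma>; the discrepancy is a cocycle value at two
        lattice vectors, hence a sign.\<close>
      have eps: "eps (\<beta> - (\<gamma> + \<alpha>)) (\<gamma> + \<alpha>) * eps \<alpha> \<gamma> = eps (\<beta> - \<gamma> - \<alpha>) \<alpha> * ?f"
        using eps_add_right[OF dual(1) \<gamma> dual(2)] eps_add_left[OF dual \<gamma>] by (simp add: diff_diff_eq)
      let ?e = "eps (\<beta> - \<gamma> - \<alpha>) \<alpha>"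
      have e: "?e \<in> {1, -1}" by (rule eps_sign[OF \<gamma>_lat \<alpha>])
      have "?e * (?f * (shift_eval bs (shift \<alpha> j ?p) + (\<Sum>l\<in>{j<..M}. shift_eval bs (cpl \<alpha> (l - j) * shift \<alpha> l ?p)))) \<in> \<int>"
        using 1 unfolding 2 mult.assoc[symmetric] eps .
      then have "?f * (shift_eval bs (shift \<alpha> j ?p) + (\<Sum>l\<in>{j<..M}. shift_eval bs (cpl \<alpha> (l - j) * shift \<alpha> l ?p))) \<in> \<int>"
        using e by (auto simp: minus_in_Ints_iff)
      then have "?f * shift_eval bs (shift \<alpha> j ?p) + (\<Sum>l\<in>{j<..M}. ?f * shift_eval bs (cpl \<alpha> (l - j) * shift \<alpha> l ?p)) \<in> \<int>"
        by (simp add: distrib_left sum_distrib_left)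
      moreover have "?f * shift_eval bs (cpl \<alpha> (l - j) * shift \<alpha> l ?p) \<in> \<int>" if "l \<in> {j<..M}" for l
      proof (rule shift_eval_cpl_Ints)
        show "form \<alpha>' \<alpha> \<in> \<int>" if "\<alpha>' \<in> fst ` set bs" for \<alpha>'
        proof -
          have "fst ` set bs = set \<alpha>s" using less.prems by (metis image_set)
          then show ?thesis using that \<alpha>s \<alpha> by (intro form_lat_dual lat_in_dual) auto
        qed
        show "?f * shift_eval bs' (shift \<alpha> l ?p) \<in> \<int>"
          if "map fst bs' = map fst bs" "total bs' + (l - j) = total bs" for bs'
          by (rule less.hyps) (use that \<open>l \<in> _\<close> less.prems in auto)
      qed
      then have "(\<Sum>l\<in>{j<..M}. ?f * shift_eval bs (cpl \<alpha> (l - j) * shift \<alpha> l ?p)) \<in> \<int>"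
        by (intro additive_subgroup_sum[OF Ints_subgroup])
      ultimately show ?case
        using Ints_diff by fastforce
    qed
    obtain j bs where "as = (\<alpha>, j) # bs" "map fst bs = \<alpha>s"
      using Cons.prems(2) by (cases as) auto
    then show ?case using * by simp
  qed
  from this[OF u refl as] show ?thesis .
qed

text \<open>An arbitrary list of shifts need not lead from charge \<gamma> to \<beta>; a final shift
  of degree 0 by the missing lattice vector repairs this.\<close>

lemma stable_components_integral:
  assumes \<beta>: "\<beta> \<in> dual_lat" and T: "T \<subseteq> coset_space \<beta>"
    and vop: "\<And>u \<alpha> n. u \<in> T \<Longrightarrow> \<alpha> \<in> lat \<Longrightarrow> lattice_vop \<alpha> n u \<in> T"
    and const: "\<And>u. u \<in> T \<Longrightarrow> Poly_Mapping.lookup (Poly_Mapping.lookup u \<beta>) 0 \<in> \<int>"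
    and u: "u \<in> T" and \<gamma>: "\<gamma> - \<beta> \<in> lat"
  shows "fscale (eps (\<beta> - \<gamma>) \<gamma>) (Poly_Mapping.lookup u \<gamma>) \<in> integral_fock"
proof -
  have "eps (\<beta> - \<gamma>) \<gamma> * shift_eval as (Poly_Mapping.lookup u \<gamma>) \<in> \<int>" if as: "fst ` set as \<subseteq> lat" for as
  proof -
    define \<alpha> where "\<alpha> = \<beta> - \<gamma> - sum_list (map fst as)"
    have "sum_list (map fst as) \<in> lat"
      using as by (induction as) (auto intro: lat_add)
    then have "\<alpha> \<in> lat" using lat_diff[of "- (\<gamma> - \<beta>)"] lat_minus[OF \<gamma>] by (simp add: \<alpha>_def)
    then have "eps (\<beta> - \<gamma>) \<gamma> * shift_eval (as @ [(\<alpha>, 0)]) (Poly_Mapping.lookup u \<gamma>) \<in> \<int>"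
      by (intro stable_components_eval[OF \<beta> T vop const u]) (use as in \<open>auto simp: \<alpha>_def\<close>)
    then show ?thesis by (simp add: shift_eval_append_0)
  qed
  then show ?thesis by (simp add: integral_fock_def shift_eval_fscale)
qed

definition dual_elt :: "'h \<Rightarrow> 'h \<times> ('h \<times> nat) multiset \<Rightarrow> 'h lspace" where
  "dual_elt \<beta> = (\<lambda>(\<alpha>, M). charged \<beta> \<alpha> (dual_monom M))"

lemma span_dual_elt:
  assumes \<beta>: "\<beta> \<in> dual_lat"
  shows "lspace.span (dual_elt \<beta> ` (lat \<times> dual_indices)) = coset_space \<beta>" (is "?S = _")
proof
  show "?S \<subseteq> coset_space \<beta>"
    by (rule lspace.span_minimal[OF _ coset_space_subspace])
      (auto simp: dual_elt_def intro!: charged_in_coset dual_monom_in_fock)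
  have charged: "charged \<beta> \<alpha> p \<in> ?S" if "\<alpha> \<in> lat" "p \<in> fock_space" for \<alpha> p
  proof -
    have "p \<in> fock.span (dual_monom ` dual_indices)" using that(2) fock_spanned_dual_monom by blast
    then show ?thesis
    proof (induction p rule: fock.span_induct_alt)
      case base
      then show ?case by (simp add: charged_def lspace.span_zero)
    next
      case (step c x y)
      then have "charged \<beta> \<alpha> x \<in> ?S"
        using that(1) by (intro lspace.span_base) (force simp: dual_elt_def)
      moreover have "charged \<beta> \<alpha> (fscale c x + y) = vscale c (charged \<beta> \<alpha> x) + charged \<beta> \<alpha> y"
        unfolding charged_fscale[symmetric] by (simp add: charged_def fock.scale_right_distrib single_add)
      ultimately show ?case using step by (simp add: lspace.span_add lspace.span_scale)
    qed
  qed
  show "coset_space \<beta> \<subseteq> ?S"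
  proof
    fix v assume v: "v \<in> coset_space \<beta>"
    have "Poly_Mapping.single \<gamma> (Poly_Mapping.lookup v \<gamma>) \<in> ?S" if \<gamma>: "\<gamma> \<in> Poly_Mapping.keys v" for \<gamma>
    proof -
      have \<gamma>\<beta>: "\<gamma> - \<beta> \<in> lat" "Poly_Mapping.lookup v \<gamma> \<in> fock_space" using v \<gamma> by (auto simp: coset_space_def)
      then have "vscale (inverse (eps (\<gamma> - \<beta>) \<beta>)) (charged \<beta> (\<gamma> - \<beta>) (Poly_Mapping.lookup v \<gamma>)) \<in> ?S"
        by (intro lspace.span_scale charged)
      then show ?thesis
        using eps_nonzero[OF lat_in_dual[OF \<gamma>\<beta>(1)] \<beta>] by (simp add: charged_def vscale_single)
    qed
    then have "(\<Sum>\<gamma>\<in>Poly_Mapping.keys v. Poly_Mapping.single \<gamma> (Poly_Mapping.lookup v \<gamma>)) \<in> ?S"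
      by (rule lspace.span_sum)
    then show "v \<in> ?S" by (simp add: poly_mapping_sum_single)
  qed
qed

end

section \<open>Lattice vertex algebras\<close>

lemma Sum_any_only_0:
  fixes f :: "nat \<Rightarrow> 'a::comm_monoid_add"
  assumes "\<And>i. i > 0 \<Longrightarrow> f i = 0"
  shows "Sum_any f = f 0"
  by (subst Sum_any.expand_superset[of "{0}"]) (use assms in \<open>auto intro: ccontr\<close>)

lemma minus_one_powi: "(-1 :: complex) powi k = of_int (if even k then 1 else -1)"
  by (simp add: power_int_minus_left)

context lattice_vertex_algebra
begin

lemma vertex_action_coset:
  "\<beta> \<in> dual_lat \<Longrightarrow> vertex_action vscale (coset_space 0) (iota 0) Y (coset_space \<beta>)"
  using vertex_module_V by (simp add: vertex_module_def)

lemma Y_closed: "\<beta> \<in> dual_lat \<Longrightarrow> u \<in> coset_space 0 \<Longrightarrow> w \<in> coset_space \<beta> \<Longrightarrow> Y u n w \<in> coset_space \<beta>"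
  using vertex_action_coset unfolding vertex_action_def by blast

lemma Y_bilinear: "\<beta> \<in> dual_lat \<Longrightarrow>
    bilinear_on vscale vscale vscale (coset_space 0) (coset_space \<beta>) (\<lambda>u w. Y u n w)"
  using vertex_action_coset unfolding vertex_action_def by blast

lemma Y_zero_right: "\<beta> \<in> dual_lat \<Longrightarrow> u \<in> coset_space 0 \<Longrightarrow> Y u n 0 = 0"
  using Y_bilinear[of \<beta> n] coset_space_zero[of \<beta>] unfolding bilinear_on_def
  by (metis lspace.scale_zero_left)

lemma Y_zero_left: "\<beta> \<in> dual_lat \<Longrightarrow> w \<in> coset_space \<beta> \<Longrightarrow> Y 0 n w = 0"
  using Y_bilinear[of \<beta> n] coset_space_zero[of 0] unfolding bilinear_on_def
  by (metis lspace.scale_zero_left)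

lemma Y_diff_left:
  assumes "\<beta> \<in> dual_lat" "u \<in> coset_space 0" "u' \<in> coset_space 0" "w \<in> coset_space \<beta>"
  shows "Y (u - u') n w = Y u n w - Y u' n w"
proof -
  have "Y ((u - u') + u') n w = Y (u - u') n w + Y u' n w"
    using Y_bilinear[OF assms(1), of n] assms coset_space_diff unfolding bilinear_on_def by blast
  then show ?thesis by simp
qed

lemma Y_diff_right:
  assumes "\<beta> \<in> dual_lat" "u \<in> coset_space 0" "w' \<in> coset_space \<beta>" "w \<in> coset_space \<beta>"
  shows "Y u n (w - w') = Y u n w - Y u n w'"
proof -
  have "Y u n ((w - w') + w') = Y u n (w - w') + Y u n w'"
    using Y_bilinear[OF assms(1), of n] assms coset_space_diff unfolding bilinear_on_def by blast
  then show ?thesis by simp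
qed

lemma Y_vac: "\<beta> \<in> dual_lat \<Longrightarrow> w \<in> coset_space \<beta> \<Longrightarrow> Y (iota 0) n w = (if n = -1 then w else 0)"
  using vertex_action_coset unfolding vertex_action_def by blast

lemma borcherds:
  assumes "\<beta> \<in> dual_lat" "u \<in> coset_space 0" "v \<in> coset_space 0" "w \<in> coset_space \<beta>"
  shows "Sum_any (\<lambda>i::nat. vscale (of_int m gchoose i) (Y (Y u (l + int i) v) (m + n - int i) w)) =
        Sum_any (\<lambda>i::nat. vscale ((-1) ^ i * (of_int l gchoose i))
          (Y u (l + m - int i) (Y v (n + int i) w)
            - vscale ((-1) powi l) (Y v (l + n - int i) (Y u (m + int i) w))))"
  using vertex_action_coset[OF assms(1)] assms(2-4) unfolding vertex_action_def by blast

lemma Y_on_vac: "u \<in> coset_space 0 \<Longrightarrow> Y u (-1) (iota 0) = u"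
  "u \<in> coset_space 0 \<Longrightarrow> n \<ge> 0 \<Longrightarrow> Y u n (iota 0) = 0"
  using vertex_algebra_V unfolding vertex_algebra_def by blast+

lemma iota_lat: "\<alpha> \<in> lat \<Longrightarrow> iota \<alpha> \<in> coset_space 0"
  by (simp add: iota_in_coset)

lemma vop_closed: "\<alpha> \<in> lat \<Longrightarrow> \<beta> \<in> dual_lat \<Longrightarrow> w \<in> coset_space \<beta> \<Longrightarrow> lattice_vop \<alpha> n w \<in> coset_space \<beta>"
  using Y_closed[OF _ iota_lat] Y_iota by metis

lemma vop_diff:
  assumes "\<alpha> \<in> lat" "\<beta> \<in> dual_lat" "w \<in> coset_space \<beta>" "w' \<in> coset_space \<beta>"
  shows "lattice_vop \<alpha> n (w - w') = lattice_vop \<alpha> n w - lattice_vop \<alpha> n w'"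
  using Y_diff_right[OF assms(2) iota_lat[OF assms(1)] assms(4,3), of n] assms coset_space_diff
  by (simp add: Y_iota)

subsection \<open>Conformal weight of the generators\<close>

definition casimir :: "'h fock" where
  "casimir = fscale (1 / 2) (\<Sum>b\<in>Basis. creation b 1 * creation (dual_vec b) 1)"

lemma conformal_vector_casimir: "conformal_vector = Poly_Mapping.single 0 casimir"
proof (rule poly_mapping_eqI)
  fix k
  have "Poly_Mapping.lookup (heis b (-1) v) \<gamma> = creation b 1 * Poly_Mapping.lookup v \<gamma>" for b v \<gamma>
    using lookup_heis_neg[of 1 b v \<gamma>] by simp
  then show "Poly_Mapping.lookup conformal_vector k = Poly_Mapping.lookup (Poly_Mapping.single 0 casimir) k"
    by (simp add: conformal_vector_def casimir_def lookup_sum iota_def lookup_single lookup_one when_def)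
qed

lemma casimir_in_fock: "casimir \<in> fock_space"
  unfolding casimir_def
  by (intro fock_space_scale fock_space_sum fock_space_mult creation_in_fock) simp_all

text \<open>The polynomial is quadratic in power sums of degree 1, each translated by a multiple of
  \<open>x^(-1)\<close>. The top coefficient is half of
  \<open>\<Sum>b. form \<alpha> b * form \<alpha> (dual_vec b)\<close>, which the dual basis
  expansion evaluates.\<close>

lemma shift_casimir:
  "shift \<alpha> 2 casimir = Poly_Mapping.single 0 (form \<alpha> \<alpha> / 2)"
  "k > 2 \<Longrightarrow> shift \<alpha> k casimir = 0"
proof -
  have summand: "shift \<alpha> k (creation b 1 * creation (dual_vec b) 1) =
      (if k = 2 then Poly_Mapping.single 0 (form \<alpha> b * form \<alpha> (dual_vec b)) else 0)" if "k \<ge> 2" for k b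
    unfolding shift_creation_mult[OF zero_less_one]
    using that by (auto simp: shift_creation fscale_single single_uminus)
  show "shift \<alpha> k casimir = 0" if "k > 2"
    unfolding casimir_def shift_fscale shift_sum using that by (simp only: summand) simp
  have "shift \<alpha> 2 casimir = Poly_Mapping.single 0 ((\<Sum>b\<in>Basis. form \<alpha> (scale (form b \<alpha>) (dual_vec b))) / 2)"
    unfolding casimir_def shift_fscale shift_sum
    by (rule poly_mapping_eqI)
      (simp add: summand lookup_sum lookup_single when_def form_scale_right form_sym[of \<alpha>] sum_divide_distrib
        del: One_nat_def)
  then show "shift \<alpha> 2 casimir = Poly_Mapping.single 0 (form \<alpha> \<alpha> / 2)"
    unfolding form_sum_right[symmetric] dual_basis_expansion .
qed

lemma conformal_in_coset: "conformal_vector \<in> coset_space 0"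
  by (simp add: conformal_vector_casimir single_in_coset casimir_in_fock)

text \<open>The mode \<open>n\<close> at charge 0 needs \<open>j \<ge> n + 1 \<ge> 2\<close>, and
  shifts beyond 2 kill the conformal vector; so only \<open>j = 2\<close>, \<open>n = 1\<close>
  contributes.\<close>

lemma vop_conformal:
  assumes \<alpha>: "\<alpha> \<in> lat" and n: "n \<ge> 1"
  shows "lattice_vop \<alpha> n conformal_vector = (if n = 1 then vscale (form \<alpha> \<alpha> / 2) (iota \<alpha>) else 0)"
proof -
  have "\<alpha> \<in> dual_lat" using \<alpha> by (rule lat_in_dual)
  then have eps0: "eps \<alpha> 0 = 1"
    using eps_add_right[of \<alpha> 0 0] eps_nonzero[of \<alpha> 0] by simp
  have "lattice_vop \<alpha> n conformal_vector = Poly_Mapping.single (\<alpha> + 0) (fscale (eps \<alpha> 0)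
    (\<Sum>j\<le>2::nat. if int j + (- n - 1) \<ge> 0 then cpl \<alpha> (nat (int j + (- n - 1))) * shift \<alpha> j casimir else 0))"
    unfolding conformal_vector_casimir
    by (rule vop_single[OF \<alpha> zero_in_dual casimir_in_fock]) (simp_all add: shift_casimir)
  also have "(\<Sum>j\<le>2::nat. if int j + (- n - 1) \<ge> 0 then cpl \<alpha> (nat (int j + (- n - 1))) * shift \<alpha> j casimir else 0)
    = (\<Sum>j\<le>2::nat. if j = 2 \<and> n = 1 then Poly_Mapping.single 0 (form \<alpha> \<alpha> / 2) else 0)"
    by (intro sum.cong refl) (use n in \<open>auto simp: shift_casimir\<close>)
  also have "\<dots> = (if n = 1 then Poly_Mapping.single 0 (form \<alpha> \<alpha> / 2) else 0)"
    by (simp add: numeral_2_eq_2)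
  finally show ?thesis
    by (simp add: eps0 iota_def vscale_single fscale_conv_mult)
qed

text \<open>Skew symmetry, i.e. the Borcherds identity with \<open>w = \<one>\<close>, \<open>m = -1\<close> and \<open>n = 0\<close>, expresses \<open>\<omega>\<^sub>l \<iota>(e\<^sub>\<alpha>)\<close> through
  the explicitly known \<open>\<iota>(e\<^sub>\<alpha>)\<^sub>l \<omega>\<close>.\<close>

lemma Y_conformal_iota:
  assumes \<alpha>: "\<alpha> \<in> lat" and l: "l \<ge> 1"
  shows "Y conformal_vector l (iota \<alpha>) = (if l = 1 then vscale (form \<alpha> \<alpha> / 2) (iota \<alpha>) else 0)"
proof -
  let ?u = "iota \<alpha>" and ?v = conformal_vector and ?vac = "iota 0 :: 'h lspace"
  have u: "?u \<in> coset_space 0" by (rule iota_lat[OF \<alpha>])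
  have vac: "?vac \<in> coset_space 0" by (rule iota_lat) simp
  note v = conformal_in_coset
  have Yu: "Y ?u n ?v = (if n = 1 then vscale (form \<alpha> \<alpha> / 2) ?u else 0)" if "n \<ge> 1" for n
    using vop_conformal[OF \<alpha> that] Y_iota[OF \<alpha> zero_in_dual v] by simp
  have "Sum_any (\<lambda>i::nat. vscale (of_int (-1) gchoose i) (Y (Y ?u (l + int i) ?v) (-1 + 0 - int i) ?vac)) =
        Sum_any (\<lambda>i::nat. vscale ((-1) ^ i * (of_int l gchoose i))
          (Y ?u (l + (-1) - int i) (Y ?v (0 + int i) ?vac)
            - vscale ((-1) powi l) (Y ?v (l + 0 - int i) (Y ?u (-1 + int i) ?vac))))"
    by (rule borcherds[OF zero_in_dual u v vac])
  \<comment> \<open>For \<open>i > 0\<close> the index \<open>l + i\<close> is at least 2, where the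
    known modes vanish. On the other side nonnegative modes annihilate the vacuum, which again
    leaves only \<open>i = 0\<close>.\<close>
  also have "Sum_any (\<lambda>i::nat. vscale (of_int (-1) gchoose i) (Y (Y ?u (l + int i) ?v) (-1 + 0 - int i) ?vac)) = Y ?u l ?v"
    by (subst Sum_any_only_0) 
      (use l in \<open>simp_all add: Yu Y_zero_left[OF zero_in_dual vac] Y_on_vac Y_closed[OF zero_in_dual u v] u lspace.scale_zero_right coset_space_scale\<close>)
  also have "Sum_any (\<lambda>i::nat. vscale ((-1) ^ i * (of_int l gchoose i))
          (Y ?u (l + (-1) - int i) (Y ?v (0 + int i) ?vac)
            - vscale ((-1) powi l) (Y ?v (l + 0 - int i) (Y ?u (-1 + int i) ?vac)))) =
       - vscale ((-1) powi l) (Y ?v l ?u)"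
    by (subst Sum_any_only_0)
      (simp_all add: Y_on_vac u v Y_zero_right[OF zero_in_dual])
  finally have "Y ?u l ?v = - vscale ((-1) powi l) (Y ?v l ?u)" .
  then have "vscale ((-1) powi l) (Y ?u l ?v) = - Y ?v l ?u"
    by (simp add: minus_one_powi)
  then have "Y ?v l ?u = - vscale ((-1) powi l) (Y ?u l ?v)" by simp
  then show ?thesis using Yu[OF l] by (auto simp: minus_one_powi)
qed

subsection \<open>The pairing\<close>

text \<open>\<open>iota \<alpha>\<close> has weight \<open>k\<close> and is killed by
  \<open>L_op 1\<close>, so the exponential in the invariance formula reduces to its term
  \<open>j = 0\<close>. The index map \<open>m \<mapsto> 2 * k - m - 2\<close> is an involution,
  hence the relation reads both ways.\<close>

lemma pairing_vop:
  assumes pr: "invariant_pairing \<beta> pr" and \<beta>: "\<beta> \<in> dual_lat" and \<alpha>: "\<alpha> \<in> lat"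
    and u: "u \<in> coset_space \<beta>" and u': "u' \<in> coset_space (- \<beta>)" and k: "form \<alpha> \<alpha> = of_int (2 * k)"
  shows "pr (lattice_vop \<alpha> m u) u' = of_int (if even k then 1 else -1) * pr u (lattice_vop \<alpha> (2 * k - m - 2) u')"
proof -
  have \<alpha>V: "iota \<alpha> \<in> coset_space 0" by (rule iota_lat[OF \<alpha>])
  have \<beta>': "- \<beta> \<in> dual_lat" using \<beta> by (rule dual_minus)
  have L0: "L_op 0 (iota \<alpha>) = vscale (of_int k) (iota \<alpha>)"
    using Y_conformal_iota[OF \<alpha>, of 1] k by (simp add: L_op_def)
  have L1: "L_op 1 (iota \<alpha>) = 0"
    using Y_conformal_iota[OF \<alpha>, of 2] by (simp add: L_op_def)
  have "L_op 1 0 = 0"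
    unfolding L_op_def by (rule Y_zero_right[OF zero_in_dual conformal_in_coset])
  then have L1j: "(L_op 1 ^^ j) (iota \<alpha>) = 0" if "j > 0" for j
    using that by (induction j) (auto simp: L1, metis L1 funpow_0 gr0I)
  have pr0: "pr u 0 = 0"
  proof -
    have "pr u (vscale 0 u') = 0 * pr u u'"
      using pr u u' unfolding invariant_pairing_def bilinear_on_def by blast
    then show ?thesis by simp
  qed
  have "pr (Y (iota \<alpha>) m u) u' = (-1) powi k * Sum_any (\<lambda>j::nat. 1 / fact j *
             pr u (Y ((L_op 1 ^^ j) (iota \<alpha>)) (2 * k - int j - m - 2) u'))"
    using pr \<alpha>V L0 u u' unfolding invariant_pairing_def by blast
  also have "Sum_any (\<lambda>j::nat. 1 / fact j * pr u (Y ((L_op 1 ^^ j) (iota \<alpha>)) (2 * k - int j - m - 2) u'))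
      = pr u (Y (iota \<alpha>) (2 * k - m - 2) u')"
    by (subst Sum_any_only_0) (simp_all add: L1j Y_zero_left[OF \<beta>' u'] pr0)
  finally show ?thesis
    by (simp add: Y_iota[OF \<alpha> \<beta> u] Y_iota[OF \<alpha> \<beta>' u'] minus_one_powi)
qed

section \<open>Values of the pairing against \<open>iota (- \<beta>)\<close>\<close>

context
  fixes \<beta> pr
  assumes pr: "invariant_pairing \<beta> pr" and \<beta>: "\<beta> \<in> dual_lat"
begin

lemma pr_add_left: "u \<in> coset_space \<beta> \<Longrightarrow> u' \<in> coset_space \<beta> \<Longrightarrow> w \<in> coset_space (- \<beta>) \<Longrightarrow>
    pr (u + u') w = pr u w + pr u' w"
  using pr unfolding invariant_pairing_def bilinear_on_def by blast

lemma pr_scale_left: "u \<in> coset_space \<beta> \<Longrightarrow> w \<in> coset_space (- \<beta>) \<Longrightarrow> pr (vscale c u) w = c * pr u w"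
  using pr unfolding invariant_pairing_def bilinear_on_def by blast

lemma pr_zero_left: "w \<in> coset_space (- \<beta>) \<Longrightarrow> pr 0 w = 0"
  using pr_scale_left[of 0 w 0] by simp

lemma pr_diff_left: "u \<in> coset_space \<beta> \<Longrightarrow> u' \<in> coset_space \<beta> \<Longrightarrow> w \<in> coset_space (- \<beta>) \<Longrightarrow>
    pr (u - u') w = pr u w - pr u' w"
  using pr_add_left[of "u - u'" u' w] by (simp add: coset_space_diff)

lemma pr_sum_left: "(\<And>i. i \<in> I \<Longrightarrow> f i \<in> coset_space \<beta>) \<Longrightarrow> w \<in> coset_space (- \<beta>) \<Longrightarrow>
    pr (sum f I) w = (\<Sum>i\<in>I. pr (f i) w)"
  by (induction I rule: infinite_finite_induct) (simp_all add: pr_zero_left pr_add_left coset_space_sum)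

lemma pr_diff_right: "u \<in> coset_space \<beta> \<Longrightarrow> w \<in> coset_space (- \<beta>) \<Longrightarrow> w' \<in> coset_space (- \<beta>) \<Longrightarrow>
    pr u (w - w') = pr u w - pr u w'"
proof -
  assume *: "u \<in> coset_space \<beta>" "w \<in> coset_space (- \<beta>)" "w' \<in> coset_space (- \<beta>)"
  then have "pr u ((w - w') + w') = pr u (w - w') + pr u w'"
    using pr coset_space_diff unfolding invariant_pairing_def bilinear_on_def by blast
  then show ?thesis by simp
qed

lemma pr_zero_right: "u \<in> coset_space \<beta> \<Longrightarrow> pr u 0 = 0"
  using pr_diff_right[of u 0 0] by simp

lemma iota_minus_in_coset: "iota (- \<beta>) \<in> coset_space (- \<beta>)"
  by (simp add: iota_in_coset)

text \<open>The functional \<open>(\<cdot>, \<iota>(e\<^bsub>-\<beta>\<^esub>))\<close> kills \<open>lattice_vop \<alpha> n w\<close> whenever the adjoint operator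
  annihilates \<open>\<iota>(e\<^bsub>-\<beta>\<^esub>)\<close> for degree reasons.  By induction on the degree of \<open>w\<close> this forces it to
  vanish off the constants at charge \<open>\<beta>\<close>.\<close>

lemma pr_cpl_eq_0:
  assumes \<alpha>: "\<alpha> \<in> lat" and \<gamma>: "\<gamma> - \<beta> \<in> lat" and h: "form \<alpha> (\<gamma> - \<beta>) = of_int h" and i: "int i \<ge> 1 - h"
    and bs: "fst ` set bs \<subseteq> lat"
  shows "pr (Poly_Mapping.single \<gamma> (cpl \<alpha> i * cpl_prod bs)) (iota (- \<beta>)) = 0"
  using i bs
proof (induction "total bs" arbitrary: bs i rule: less_induct)
  case less
  note v = iota_minus_in_coset
  define F where "F q = pr (Poly_Mapping.single \<gamma> q) (iota (- \<beta>))" for q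
  have single: "Poly_Mapping.single \<gamma> q \<in> coset_space \<beta>" if "q \<in> fock_space" for q
    using single_in_coset[OF \<gamma> that] .
  have F_scale: "F (fscale c q) = c * F q" if "q \<in> fock_space" for c q
    unfolding F_def vscale_single[symmetric] using pr_scale_left[OF single[OF that] v] .
  have F_diff: "F (q - q') = F q - F q'" if "q \<in> fock_space" "q' \<in> fock_space" for q q'
    unfolding F_def single_diff using pr_diff_left[OF single[OF that(1)] single[OF that(2)] v] .
  have F_add: "F (q + q') = F q + F q'" if "q \<in> fock_space" "q' \<in> fock_space" for q q'
    unfolding F_def single_add using pr_add_left[OF single[OF that(1)] single[OF that(2)] v] .
  have F_zero: "F 0 = 0" using F_diff[of 0 0] by simp
  have F_sum: "F (sum q I) = (\<Sum>i\<in>I. F (q i))" if "\<And>i. i \<in> I \<Longrightarrow> q i \<in> fock_space" for q I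
    using that
    by (induction I rule: infinite_finite_induct) (simp_all add: F_zero F_add fock_space_sum)
  obtain k :: int where k: "form \<alpha> \<alpha> = of_int (2 * k)"
    using form_even \<alpha> by (auto simp: lat_def)
  have \<gamma>\<alpha>: "\<gamma> - \<alpha> - \<beta> \<in> lat" using lat_diff[OF \<gamma> \<alpha>] by (simp add: algebra_simps)
  have dual: "\<gamma> - \<alpha> \<in> dual_lat" using coset_dual[OF \<beta> \<gamma>\<alpha>] .
  obtain g :: int where g: "form \<alpha> (\<gamma> - \<alpha>) = of_int g"
    using form_lat_dual[OF \<alpha> dual] Ints_cases by blast
  obtain f :: int where f: "form \<alpha> \<beta> = of_int f"
    using form_lat_dual[OF \<alpha> \<beta>] Ints_cases by blast
  have "(of_int g :: complex) = of_int (h + f - 2 * k)"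
    using g h f k by (simp add: form_diff_right algebra_simps)
  then have gh: "g = h + f - 2 * k" by (simp only: of_int_eq_iff)
  \<comment> \<open>The mode whose term \<open>j = 0\<close> on \<open>?w\<close> is the given
    \<open>cpl \<alpha> i * cpl_prod bs\<close>; the terms \<open>j > 0\<close> have a larger index
    of \<open>cpl \<alpha>\<close> and a smaller \<open>total\<close>, so the induction hypothesis
    kills them.\<close>
  define n where "n = - int i - 1 - g"
  let ?w = "Poly_Mapping.single (\<gamma> - \<alpha>) (cpl_prod bs)"
  have w: "?w \<in> coset_space \<beta>" by (rule single_in_coset[OF \<gamma>\<alpha> cpl_prod_in_fock])
  obtain N where N: "\<And>j. j > N \<Longrightarrow> shift \<alpha> j (cpl_prod bs) = 0"
    using shift_locally_nilpotent[OF \<alpha> cpl_prod_in_fock] by blast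
  have shift_in: "shift \<alpha> j (cpl_prod bs) \<in>
      zspan fscale {cpl_prod bs' |bs'. map fst bs' = map fst bs \<and> total bs' + j = total bs}" for j
    by (rule shift_cpl_prod) (use less.prems(2) \<alpha> in \<open>auto intro!: form_lat_dual lat_in_dual\<close>)
  have F_shift: "shift \<alpha> j (cpl_prod bs) \<in> fock_space \<and>
      (j > 0 \<longrightarrow> F (cpl \<alpha> (j + i) * shift \<alpha> j (cpl_prod bs)) = 0)" for j
    using shift_in[of j]
  proof (induction rule: zspan_induct)
    case (base x)
    then obtain bs' where bs': "x = cpl_prod bs'" "map fst bs' = map fst bs" "total bs' + j = total bs" by blast
    have "set (map fst bs') = set (map fst bs)" by (simp only: bs'(2))
    then have "fst ` set bs' \<subseteq> lat" using less.prems(2) by simp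
    then have "pr (Poly_Mapping.single \<gamma> (cpl \<alpha> (j + i) * cpl_prod bs')) (iota (- \<beta>)) = 0" if "j > 0"
      using that bs' less.prems(1) by (intro less.hyps) auto
    then show ?case using bs'(1) cpl_prod_in_fock by (simp add: F_def)
  qed (auto simp: vector_space_fscale F_zero right_diff_distrib F_diff fock_space_mult cpl_in_fock fock_space_diff)
  have "lattice_vop \<alpha> n ?w = Poly_Mapping.single (\<alpha> + (\<gamma> - \<alpha>)) (fscale (eps \<alpha> (\<gamma> - \<alpha>))
      (\<Sum>j\<le>N. if int j + int i \<ge> 0 then cpl \<alpha> (nat (int j + int i)) * shift \<alpha> j (cpl_prod bs) else 0))"
    by (rule vop_single[OF \<alpha> dual cpl_prod_in_fock]) (use N g in \<open>auto simp: n_def\<close>)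
  also have "(\<Sum>j\<le>N. if int j + int i \<ge> 0 then cpl \<alpha> (nat (int j + int i)) * shift \<alpha> j (cpl_prod bs) else 0)
      = (\<Sum>j\<le>N. cpl \<alpha> (j + i) * shift \<alpha> j (cpl_prod bs))"
    by (intro sum.cong refl) (simp add: nat_add_distrib)
  finally have "pr (lattice_vop \<alpha> n ?w) (iota (- \<beta>)) =
      F (fscale (eps \<alpha> (\<gamma> - \<alpha>)) (\<Sum>j\<le>N. cpl \<alpha> (j + i) * shift \<alpha> j (cpl_prod bs)))"
    by (simp add: F_def)
  also have "\<dots> = eps \<alpha> (\<gamma> - \<alpha>) * (\<Sum>j\<le>N. F (cpl \<alpha> (j + i) * shift \<alpha> j (cpl_prod bs)))"
    by (subst F_scale) (use F_shift in \<open>auto intro!: F_sum fock_space_sum fock_space_mult cpl_in_fock\<close>)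
  also have "(\<Sum>j\<le>N. F (cpl \<alpha> (j + i) * shift \<alpha> j (cpl_prod bs))) = (\<Sum>j\<le>N. if j = 0 then F (cpl \<alpha> i * cpl_prod bs) else 0)"
    by (intro sum.cong refl) (use F_shift in auto)
  finally have 1: "pr (lattice_vop \<alpha> n ?w) (iota (- \<beta>)) = eps \<alpha> (\<gamma> - \<alpha>) * F (cpl \<alpha> i * cpl_prod bs)"
    by simp
  \<comment> \<open>E^+ acts trivially on \<open>iota (- \<beta>)\<close>, so only
    \<open>j = 0\<close> remains, and it would need the E^- coefficient of index
    \<open>- i - h\<close>, negative by the assumption on \<open>i\<close>.\<close>
  have "lattice_vop \<alpha> (2 * k - n - 2) (Poly_Mapping.single (- \<beta>) 1) =
     Poly_Mapping.single (\<alpha> + - \<beta>) (fscale (eps \<alpha> (- \<beta>)) (\<Sum>j\<le>0. if int j + (- int i - h) \<ge> 0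
       then cpl \<alpha> (nat (int j + (- int i - h))) * shift \<alpha> j 1 else 0))"
    by (rule vop_single[OF \<alpha> dual_minus[OF \<beta>] fock_space_one]) (simp_all add: f shift_one n_def gh)
  also have "\<dots> = 0" using less.prems(1) by simp
  finally have "lattice_vop \<alpha> (2 * k - n - 2) (iota (- \<beta>)) = 0" by (simp add: iota_def)
  then have "pr (lattice_vop \<alpha> n ?w) (iota (- \<beta>)) = 0"
    using pairing_vop[OF pr \<beta> \<alpha> w v k, of n] pr_zero_right[OF w] by simp
  then show ?case
    using 1 eps_nonzero[OF lat_in_dual[OF \<alpha>] dual] by (simp add: F_def)
qed

text \<open>At charge \<beta> one has \<open>h = 0\<close>, and any factor with
  \<open>n \<ge> 1\<close> forces zero. Off \<beta>, nondegeneracy supplies a lattice vector with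
  \<open>h \<ge> 1\<close>, which allows \<open>i = 0\<close> and hence the trivial extra factor
  \<open>cpl \<alpha> 0\<close>.\<close>

lemma pr_cpl_prod:
  assumes \<gamma>: "\<gamma> - \<beta> \<in> lat" and bs: "fst ` set bs \<subseteq> lat"
  shows "pr (Poly_Mapping.single \<gamma> (cpl_prod bs)) (iota (- \<beta>)) =
    (if \<gamma> = \<beta> then Poly_Mapping.lookup (cpl_prod bs) 0 else 0)"
proof (cases "\<gamma> = \<beta>")
  case True
  have "pr (Poly_Mapping.single \<beta> (cpl_prod bs)) (iota (- \<beta>)) = Poly_Mapping.lookup (cpl_prod bs) 0"
    using bs
  proof (induction bs)
    case Nil
    have "pr (iota \<beta>) (iota (- \<beta>)) = 1" using pr by (simp add: invariant_pairing_def)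
    then show ?case by (simp add: iota_def)
  next
    case (Cons x bs)
    obtain \<alpha> n where x: "x = (\<alpha>, n)" by (cases x)
    show ?case
    proof (cases "n = 0")
      case False
      have "pr (Poly_Mapping.single \<beta> (cpl \<alpha> n * cpl_prod bs)) (iota (- \<beta>)) = 0"
        by (rule pr_cpl_eq_0[where h=0]) (use Cons.prems x False in auto)
      then show ?thesis using False x by simp
    qed (use Cons x in simp)
  qed
  then show ?thesis using True by simp
next
  case False
  then obtain \<alpha>' where \<alpha>': "\<alpha>' \<in> lat" "form (\<gamma> - \<beta>) \<alpha>' \<noteq> 0"
    using form_nondegenerate[of "\<gamma> - \<beta>"] \<gamma> unfolding lat_def by auto
  obtain h :: int where h: "form \<alpha>' (\<gamma> - \<beta>) = of_int h"
    using form_lat_dual[OF \<alpha>'(1) lat_in_dual[OF \<gamma>]] Ints_cases by blast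
  then have h0: "h \<noteq> 0" using \<alpha>'(2) form_sym by fastforce
  define \<alpha> where "\<alpha> = (if h > 0 then \<alpha>' else - \<alpha>')"
  have "pr (Poly_Mapping.single \<gamma> (cpl \<alpha> 0 * cpl_prod bs)) (iota (- \<beta>)) = 0"
    by (rule pr_cpl_eq_0[OF _ \<gamma>, where h="\<bar>h\<bar>"]) (use \<alpha>' h h0 bs in \<open>auto simp: \<alpha>_def lat_minus\<close>)
  then show ?thesis using False by simp
qed

lemma pr_single:
  assumes \<gamma>: "\<gamma> - \<beta> \<in> lat" and p: "p \<in> fock_space"
  shows "pr (Poly_Mapping.single \<gamma> p) (iota (- \<beta>)) = (if \<gamma> = \<beta> then Poly_Mapping.lookup p 0 else 0)"
proof -
  note v = iota_minus_in_coset
  have "Basis \<subseteq> span lat" using basis_in_lat span_superset by blast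
  then have "p \<in> fock.span {cpl_prod bs |bs. set bs \<subseteq> lat \<times> {1..}}"
    using fock_spanned p by blast
  then have "p \<in> fock_space \<and> pr (Poly_Mapping.single \<gamma> p) (iota (- \<beta>)) = (if \<gamma> = \<beta> then Poly_Mapping.lookup p 0 else 0)"
  proof (induction p rule: fock.span_induct_alt)
    case base
    then show ?case by (simp add: pr_zero_left[OF v])
  next
    case (step c x y)
    then obtain bs where bs: "x = cpl_prod bs" "set bs \<subseteq> lat \<times> {1..}" by blast
    have x: "x \<in> fock_space" using bs cpl_prod_in_fock by simp
    have prx: "pr (Poly_Mapping.single \<gamma> x) (iota (- \<beta>)) = (if \<gamma> = \<beta> then Poly_Mapping.lookup x 0 else 0)"
      unfolding bs(1) by (rule pr_cpl_prod[OF \<gamma>]) (use bs in auto)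
    have "pr (Poly_Mapping.single \<gamma> (fscale c x + y)) (iota (- \<beta>)) =
        c * pr (Poly_Mapping.single \<gamma> x) (iota (- \<beta>)) + pr (Poly_Mapping.single \<gamma> y) (iota (- \<beta>))"
      unfolding single_add vscale_single[symmetric]
      using step x v single_in_coset[OF \<gamma>] by (simp add: pr_add_left pr_scale_left coset_space_scale)
    then show ?case using x step prx by (simp add: lookup_add fock_space_add fock_space_scale)
  qed
  then show ?thesis by simp
qed

lemma pr_iota:
  assumes u: "u \<in> coset_space \<beta>"
  shows "pr u (iota (- \<beta>)) = Poly_Mapping.lookup (Poly_Mapping.lookup u \<beta>) 0"
proof -
  have \<gamma>: "\<gamma> - \<beta> \<in> lat" "Poly_Mapping.lookup u \<gamma> \<in> fock_space" if "\<gamma> \<in> Poly_Mapping.keys u" for \<gamma>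
    using that u by (auto simp: coset_space_def)
  have "pr u (iota (- \<beta>)) = pr (\<Sum>\<gamma>\<in>Poly_Mapping.keys u. Poly_Mapping.single \<gamma> (Poly_Mapping.lookup u \<gamma>)) (iota (- \<beta>))"
    by (simp add: poly_mapping_sum_single)
  also have "\<dots> = (\<Sum>\<gamma>\<in>Poly_Mapping.keys u. if \<gamma> = \<beta> then Poly_Mapping.lookup (Poly_Mapping.lookup u \<beta>) 0 else 0)"
    by (subst pr_sum_left)
      (use \<gamma> in \<open>auto intro!: single_in_coset iota_minus_in_coset sum.cong simp: pr_single\<close>)
  also have "\<dots> = Poly_Mapping.lookup (Poly_Mapping.lookup u \<beta>) 0"
    by (simp add: in_keys_iff)
  finally show ?thesis .
qed

end

subsection \<open>Integral submodules\<close>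

text \<open>The vectors all of whose modes preserve \<open>W\<close> form a vertex subring: the
  Borcherds identity with \<open>m = 0\<close> writes modes of \<open>Y a l b\<close> as integral
  combinations of products of modes of \<open>a\<close> and \<open>b\<close>. Stability under the
  generators therefore suffices.\<close>

lemma V_int_preserves:
  assumes \<beta>: "\<beta> \<in> dual_lat" and W: "W \<subseteq> coset_space \<beta>" "additive_subgroup W"
    and vop: "\<And>w \<alpha> n. w \<in> W \<Longrightarrow> \<alpha> \<in> lat \<Longrightarrow> lattice_vop \<alpha> n w \<in> W"
    and u: "u \<in> V_int" and w: "w \<in> W"
  shows "Y u n w \<in> W"
proof -
  define U where "U = {a \<in> coset_space 0. \<forall>n. \<forall>w\<in>W. Y a n w \<in> W}"
  have U_V: "a \<in> coset_space 0" and U_W: "w \<in> W \<Longrightarrow> Y a n w \<in> W" if "a \<in> U" for a n w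
    using that by (auto simp: U_def)
  have W0: "0 \<in> W" using W(2) by (simp add: additive_subgroup_def)
  have scale: "vscale (of_int k) w \<in> W" if "w \<in> W" for k w
    using additive_subgroup_scale_int[OF vector_space_vscale W(2) that] .
  have "additive_subgroup U"
    unfolding additive_subgroup_def
  proof (intro conjI ballI)
    show "0 \<in> U" using W Y_zero_left[OF \<beta>] by (auto simp: U_def additive_subgroup_def)
    fix a b assume "a \<in> U" "b \<in> U"
    then show "a - b \<in> U"
      using W Y_diff_left[OF \<beta>] by (auto simp: U_def additive_subgroup_def coset_space_diff subset_iff)
  qed
  moreover have "iota 0 \<in> U"
    using W W0 Y_vac[OF \<beta>] by (auto simp: U_def iota_lat subset_iff)
  moreover have "Y a l b \<in> U" if ab: "a \<in> U" "b \<in> U" for a b l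
  proof -
    have "Y (Y a l b) n w \<in> W" if w: "w \<in> W" for n w
    proof -
      have wc: "w \<in> coset_space \<beta>" using w W(1) by blast
      have "Y (Y a l b) n w =
        Sum_any (\<lambda>i::nat. vscale (of_int 0 gchoose i) (Y (Y a (l + int i) b) (0 + n - int i) w))"
        by (subst Sum_any_only_0) (auto simp: gr0_conv_Suc)
      also have "\<dots> = Sum_any (\<lambda>i::nat. vscale ((-1) ^ i * (of_int l gchoose i))
          (Y a (l + 0 - int i) (Y b (n + int i) w)
            - vscale ((-1) powi l) (Y b (l + n - int i) (Y a (0 + int i) w))))"
        by (rule borcherds[OF \<beta> U_V[OF ab(1)] U_V[OF ab(2)] wc])
      also have "\<dots> \<in> W"
      proof (rule additive_subgroup_Sum_any[OF W(2)])
        fix i :: nat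
        obtain c :: int where "(-1) ^ i * (of_int l gchoose i) = (of_int c :: complex)"
          using signed_binom_Ints[of "of_int l" i] Ints_cases Ints_of_int unfolding signed_binom_def by metis
        moreover have "Y a (l + 0 - int i) (Y b (n + int i) w)
            - vscale ((-1) powi l) (Y b (l + n - int i) (Y a (0 + int i) w)) \<in> W"
          unfolding minus_one_powi
          using W(2) ab w by (meson U_W scale additive_subgroup_def)
        ultimately show "vscale ((-1) ^ i * (of_int l gchoose i)) (Y a (l + 0 - int i) (Y b (n + int i) w)
            - vscale ((-1) powi l) (Y b (l + n - int i) (Y a (0 + int i) w))) \<in> W"
          using scale by metis
      qed
      finally show ?thesis .
    qed
    then show ?thesis
      using Y_closed[OF zero_in_dual U_V[OF ab(1)] U_V[OF ab(2)]] by (simp add: U_def)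
  qed
  moreover have "iota ` lat \<subseteq> U"
    using vop W(1) Y_iota[OF _ \<beta>] by (auto simp: U_def iota_lat subset_iff)
  ultimately have "V_int \<subseteq> U"
    unfolding V_int_def vertex_subring_def by (intro Inter_lower) (auto simp: U_def)
  then show ?thesis using u w U_W by blast
qed

lemma iota_V_int: "\<alpha> \<in> lat \<Longrightarrow> iota \<alpha> \<in> V_int"
  by (auto simp: V_int_def)

lemma coset_int_minimal:
  assumes "\<beta> \<in> dual_lat" "W \<subseteq> coset_space \<beta>" "additive_subgroup W" "iota \<beta> \<in> W"
    and "\<And>w \<alpha> n. w \<in> W \<Longrightarrow> \<alpha> \<in> lat \<Longrightarrow> lattice_vop \<alpha> n w \<in> W"
  shows "coset_int \<beta> \<subseteq> W"
  unfolding coset_int_def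
  by (rule Inter_lower) (use assms V_int_preserves[OF assms(1-3,5)] in blast)

text \<open>The whole space is itself admissible, so the defining intersection runs over a nonempty
  family.\<close>

lemma coset_int_subset: "\<beta> \<in> dual_lat \<Longrightarrow> coset_int \<beta> \<subseteq> coset_space \<beta>"
  by (rule coset_int_minimal) (auto simp: coset_space_subgroup iota_in_coset vop_closed)

lemma iota_coset_int: "iota \<beta> \<in> coset_int \<beta>"
  by (simp add: coset_int_def)

lemma coset_int_vop:
  assumes \<beta>: "\<beta> \<in> dual_lat" and v: "v \<in> coset_int \<beta>" and \<alpha>: "\<alpha> \<in> lat"
  shows "lattice_vop \<alpha> n v \<in> coset_int \<beta>"
proof -
  have "Y (iota \<alpha>) n v \<in> coset_int \<beta>"
    using v iota_V_int[OF \<alpha>] by (auto simp: coset_int_def)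
  moreover have "v \<in> coset_space \<beta>" using v coset_int_subset[OF \<beta>] by blast
  ultimately show ?thesis by (simp add: Y_iota[OF \<alpha> \<beta>])
qed

lemma E_minus_span_subgroup: "additive_subgroup (E_minus_span S \<beta>)"
  unfolding E_minus_span_def by (rule additive_subgroup_zspan[OF vector_space_vscale])

lemma E_minus_span_vop:
  assumes \<beta>: "\<beta> \<in> dual_lat" and \<alpha>: "\<alpha> \<in> lat" and u: "u \<in> E_minus_span dual_lat \<beta>"
  shows "lattice_vop \<alpha> n u \<in> E_minus_span dual_lat \<beta>"
proof -
  \<comment> \<open>Additivity of \<open>lattice_vop\<close> is available on
    \<open>coset_space \<beta>\<close>, so membership is carried through the induction.\<close>
  have "u \<in> coset_space \<beta> \<and> lattice_vop \<alpha> n u \<in> E_minus_span dual_lat \<beta>"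
    using u unfolding E_minus_span_charged[of dual_lat \<beta>]
  proof (induction u rule: zspan_induct)
    case (base u)
    then show ?case
      using vop_charged[OF \<beta> \<alpha>] unfolding E_minus_span_charged
      by (auto intro!: charged_in_coset cpl_prod_in_fock)
  next
    case zero
    show ?case
      using vop_diff[OF \<alpha> \<beta>, of 0 0] E_minus_span_subgroup
      by (simp add: additive_subgroup_def E_minus_span_charged[symmetric])
  next
    case (diff u v)
    then show ?case
      using vop_diff[OF \<alpha> \<beta>] E_minus_span_subgroup
      by (simp add: additive_subgroup_def E_minus_span_charged[symmetric] coset_space_diff)
  qed (rule vector_space_vscale)
  then show ?thesis ..
qed

lemma E_minus_span_const:
  assumes \<beta>: "\<beta> \<in> dual_lat" and u: "u \<in> E_minus_span dual_lat \<beta>"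
  shows "Poly_Mapping.lookup (Poly_Mapping.lookup u \<beta>) 0 \<in> \<int>"
  using u unfolding E_minus_span_charged
proof (induction u rule: zspan_induct)
  case (base u)
  then show ?case
    using lookup_cpl_prod_Ints \<beta> by (auto simp: charged_def lookup_single when_def)
qed (auto simp: vector_space_vscale lookup_minus)

section \<open>The graded dual compared with the span of the E^- coefficients\<close>

context
  fixes \<beta> pr
  assumes pr: "invariant_pairing \<beta> pr" and \<beta>: "\<beta> \<in> dual_lat"
begin

lemma graded_dual_subset: "graded_dual pr \<beta> \<subseteq> coset_space \<beta>"
  by (auto simp: graded_dual_def)

lemma minus_in_dual: "- \<beta> \<in> dual_lat"
  using \<beta> by (rule dual_minus)

lemma graded_dual_subgroup: "additive_subgroup (graded_dual pr \<beta>)"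
  using coset_int_subset[OF minus_in_dual]
  by (auto simp: additive_subgroup_def graded_dual_def pr_zero_left[OF pr \<beta>] pr_diff_left[OF pr \<beta>]
      coset_space_diff subset_iff)

lemma graded_dual_vop:
  assumes u: "u \<in> graded_dual pr \<beta>" and \<alpha>: "\<alpha> \<in> lat"
  shows "lattice_vop \<alpha> n u \<in> graded_dual pr \<beta>"
proof -
  obtain k :: int where k: "form \<alpha> \<alpha> = of_int (2 * k)"
    using form_even \<alpha> by (auto simp: lat_def)
  have uc: "u \<in> coset_space \<beta>" using u graded_dual_subset by blast
  have "pr (lattice_vop \<alpha> n u) v \<in> \<int>" if v: "v \<in> coset_int (- \<beta>)" for v
  proof -
    have "v \<in> coset_space (- \<beta>)" using v coset_int_subset[OF minus_in_dual] by blast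
    moreover have "pr u (lattice_vop \<alpha> (2 * k - n - 2) v) \<in> \<int>"
      using u coset_int_vop[OF minus_in_dual v \<alpha>] by (simp add: graded_dual_def)
    ultimately show ?thesis
      using pairing_vop[OF pr \<beta> \<alpha> uc _ k] by simp
  qed
  then show ?thesis using vop_closed[OF \<alpha> \<beta> uc] by (simp add: graded_dual_def)
qed

lemma graded_dual_const: "u \<in> graded_dual pr \<beta> \<Longrightarrow> Poly_Mapping.lookup (Poly_Mapping.lookup u \<beta>) 0 \<in> \<int>"
  using pr_iota[OF pr \<beta>, of u] iota_coset_int[of "- \<beta>"] by (auto simp: graded_dual_def)

text \<open>The vectors pairing integrally with the whole span contain
  \<open>iota (- \<beta>)\<close>, because constant terms are integral, and are stable under the
  vertex operators, because the adjoints preserve the span. By minimality they contain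
  \<open>coset_int (- \<beta>)\<close>.\<close>

lemma E_minus_span_subset_dual: "E_minus_span dual_lat \<beta> \<subseteq> graded_dual pr \<beta>"
proof -
  let ?D = "E_minus_span dual_lat \<beta>"
  have D: "?D \<subseteq> coset_space \<beta>" by (rule E_minus_span_subset_coset)
  define W where "W = {v \<in> coset_space (- \<beta>). \<forall>u\<in>?D. pr u v \<in> \<int>}"
  have "coset_int (- \<beta>) \<subseteq> W"
  proof (rule coset_int_minimal[OF minus_in_dual])
    show "additive_subgroup W"
      using D by (auto simp: additive_subgroup_def W_def pr_zero_right[OF pr \<beta>] pr_diff_right[OF pr \<beta>]
          coset_space_diff subset_iff)
    show "iota (- \<beta>) \<in> W"
      using D E_minus_span_const[OF \<beta>] pr_iota[OF pr \<beta>] by (auto simp: W_def iota_in_coset subset_iff)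
    fix v \<alpha> n assume v: "v \<in> W" and \<alpha>: "\<alpha> \<in> lat"
    then have vc: "v \<in> coset_space (- \<beta>)" by (simp add: W_def)
    obtain k :: int where k: "form \<alpha> \<alpha> = of_int (2 * k)"
      using form_even \<alpha> by (auto simp: lat_def)
    have "pr u (lattice_vop \<alpha> n v) \<in> \<int>" if u: "u \<in> ?D" for u
    proof -
      have "pr (lattice_vop \<alpha> (2 * k - n - 2) u) v \<in> \<int>"
        using v E_minus_span_vop[OF \<beta> \<alpha> u] by (simp add: W_def)
      moreover have "u \<in> coset_space \<beta>" using u D by blast
      ultimately show ?thesis
        using pairing_vop[OF pr \<beta> \<alpha> _ vc k, of u "2 * k - n - 2"]
        by (auto split: if_splits simp: minus_in_Ints_iff)
    qed
    then show "lattice_vop \<alpha> n v \<in> W"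
      using vop_closed[OF \<alpha> minus_in_dual vc] by (simp add: W_def)
  qed (auto simp: W_def)
  then show ?thesis using D by (auto simp: graded_dual_def W_def subset_iff)
qed

lemma dual_elt_in_E_minus_span: "i \<in> lat \<times> dual_indices \<Longrightarrow> dual_elt \<beta> i \<in> E_minus_span dual_lat \<beta>"
proof (cases i)
  case (Pair \<alpha> M)
  assume "i \<in> lat \<times> dual_indices"
  with Pair have "\<alpha> \<in> lat" "M \<in> dual_indices" by auto
  moreover from this(2) obtain bs where "dual_monom M = cpl_prod bs" "fst ` set bs \<subseteq> dual_lat"
    by (rule dual_monom_eq_cpl_prod)
  ultimately show ?thesis
    unfolding E_minus_span_charged Pair dual_elt_def prod.case
    by (intro zspan_base[OF vector_space_vscale] CollectI exI[of _ bs] exI[of _ \<alpha>]) simp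
qed

text \<open>The component at charge \<open>\<alpha> + \<beta>\<close> isolates the coefficients
  belonging to \<alpha>. Its normalization \<open>eps (- \<alpha>) (\<alpha> + \<beta>)\<close>
  combines with \<open>eps \<alpha> \<beta>\<close> to \<open>eps (- \<alpha>) \<alpha>\<close>, a
  sign free of \<beta>.\<close>

lemma graded_dual_coeff_Ints:
  assumes t: "finite t" "t \<subseteq> dual_elt \<beta> ` (lat \<times> dual_indices)"
    and int: "(\<Sum>v\<in>t. vscale (c v) v) \<in> graded_dual pr \<beta>" and v: "v \<in> t"
  shows "c v \<in> \<int>"
proof -
  \<comment> \<open>Different indices are not yet known to give different vectors, so
    \<open>I\<close> selects one index for each vector of \<open>t\<close>.\<close>
  obtain I where I: "I \<subseteq> lat \<times> dual_indices" "inj_on (dual_elt \<beta>) I" "t = dual_elt \<beta> ` I"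
    using t(2) subset_image_inj by metis
  have finI: "finite I" using t(1) I finite_imageD by blast
  define u where "u = (\<Sum>v\<in>t. vscale (c v) v)"
  obtain \<alpha> M where \<alpha>M: "(\<alpha>, M) \<in> I" "v = dual_elt \<beta> (\<alpha>, M)" using v I(3) by auto
  define F where "F = {M. (\<alpha>, M) \<in> I}"
  have \<alpha>: "\<alpha> \<in> lat" using \<alpha>M I by auto
  have dual: "\<alpha> \<in> dual_lat" "- \<alpha> \<in> dual_lat" using lat_in_dual \<alpha> lat_minus by auto
  have F: "finite F" "F \<subseteq> dual_indices" "M \<in> F"
  proof -
    have "F \<subseteq> snd ` I" by (force simp: F_def)
    then show "finite F" using finI finite_surj by blast
  qed (use \<alpha>M I in \<open>auto simp: F_def\<close>)
  let ?c = "\<lambda>M. c (dual_elt \<beta> (\<alpha>, M))"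
  have "Poly_Mapping.lookup u (\<alpha> + \<beta>) = (\<Sum>i\<in>I. Poly_Mapping.lookup (vscale (c (dual_elt \<beta> i)) (dual_elt \<beta> i)) (\<alpha> + \<beta>))"
    by (simp add: u_def I(3) sum.reindex[OF I(2)] lookup_sum)
  also have "\<dots> = (\<Sum>i\<in>Pair \<alpha> ` F. Poly_Mapping.lookup (vscale (c (dual_elt \<beta> i)) (dual_elt \<beta> i)) (\<alpha> + \<beta>))"
    by (rule sum.mono_neutral_right)
      (auto simp: finI F_def dual_elt_def charged_def lookup_single when_def image_iff split: if_splits)
  also have "\<dots> = (\<Sum>M\<in>F. fscale (?c M * eps \<alpha> \<beta>) (dual_monom M))"
    by (subst sum.reindex) (auto simp: inj_on_def dual_elt_def charged_def)
  finally have lookup_u: "Poly_Mapping.lookup u (\<alpha> + \<beta>) = (\<Sum>M\<in>F. fscale (?c M * eps \<alpha> \<beta>) (dual_monom M))" .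
  let ?e = "eps (- \<alpha>) \<alpha>"
  have "eps (- \<alpha>) (\<alpha> + \<beta>) * eps \<alpha> \<beta> = ?e * eps (- \<alpha> + \<alpha>) \<beta>"
    using eps_add_right[OF dual(2,1) \<beta>] eps_add_left[OF dual(2,1) \<beta>] by simp
  then have eps: "eps (- \<alpha>) (\<alpha> + \<beta>) * eps \<alpha> \<beta> = ?e" using \<beta> by simp
  have "fscale (eps (\<beta> - (\<alpha> + \<beta>)) (\<alpha> + \<beta>)) (Poly_Mapping.lookup u (\<alpha> + \<beta>)) \<in> integral_fock"
    by (rule stable_components_integral[OF \<beta> graded_dual_subset graded_dual_vop graded_dual_const])
      (use int \<alpha> in \<open>simp_all add: u_def\<close>)
  also have "fscale (eps (\<beta> - (\<alpha> + \<beta>)) (\<alpha> + \<beta>)) (Poly_Mapping.lookup u (\<alpha> + \<beta>)) =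
      (\<Sum>M\<in>F. fscale (?e * ?c M) (dual_monom M))"
    unfolding lookup_u fock.scale_sum_right
    by (intro sum.cong refl) (simp add: eps[symmetric] mult_ac)
  finally have "(\<Sum>M\<in>F. fscale (?e * ?c M) (dual_monom M)) \<in> integral_fock" .
  moreover obtain N where "\<forall>M\<in>F. degree M < N"
    using finite_nat_set_iff_bounded[of "degree ` F"] F(1) by auto
  ultimately have "?e * ?c M \<in> \<int>"
    using F by (intro dual_monom_coeff_Ints[of F N "\<lambda>M. ?e * ?c M"]) auto
  moreover have "?e \<in> {1, -1}" using eps_sign lat_minus \<alpha> by blast
  ultimately show ?thesis using \<alpha>M(2) by (auto simp: minus_in_Ints_iff)
qed

text \<open>The span of the E^- coefficients lies between the \<int>-span of the
  \<open>dual_elt \<beta> i\<close> and the dual, and integrality of coefficients makes the two ends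
  equal.\<close>

lemma graded_dual_integral_form:
  "integral_form vscale (coset_space \<beta>) (graded_dual pr \<beta>)"
  "graded_dual pr \<beta> = E_minus_span dual_lat \<beta>"
proof -
  let ?B = "dual_elt \<beta> ` (lat \<times> dual_indices)"
  have span: "lspace.span ?B = coset_space \<beta>" by (rule span_dual_elt[OF \<beta>])
  have B: "?B \<subseteq> E_minus_span dual_lat \<beta>" using dual_elt_in_E_minus_span by blast
  note form_intros = integral_formI[OF vector_space_vscale graded_dual_subgroup
      graded_dual_subset[folded span] order.trans[OF B E_minus_span_subset_dual]]
  have form: "lspace.independent ?B" "graded_dual pr \<beta> = zspan vscale ?B"
    by (rule form_intros, rule graded_dual_coeff_Ints, assumption+)+
  show "integral_form vscale (coset_space \<beta>) (graded_dual pr \<beta>)"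
    unfolding integral_form_def using form span by blast
  have "graded_dual pr \<beta> \<subseteq> E_minus_span dual_lat \<beta>"
    using zspan_minimal[OF vector_space_vscale E_minus_span_subgroup B] form(2) by simp
  then show "graded_dual pr \<beta> = E_minus_span dual_lat \<beta>"
    using E_minus_span_subset_dual by blast
qed

end

end

theorem proposition7p5:
  fixes scale :: "complex \<Rightarrow> 'h::ab_group_add \<Rightarrow> 'h"
    and Basis :: "'h set"
    and form eps :: "'h \<Rightarrow> 'h \<Rightarrow> complex"
    and Y :: "'h lspace \<Rightarrow> int \<Rightarrow> 'h lspace \<Rightarrow> 'h lspace"
    and \<beta> :: 'h
    and pr :: "'h lspace \<Rightarrow> 'h lspace \<Rightarrow> complex"
  assumes "lattice_vertex_algebra scale Basis form eps Y"
    and "\<beta> \<in> even_lattice.dual_lat scale Basis form"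
    and "lattice_vertex_algebra.invariant_pairing scale Basis form Y \<beta> pr"
  shows "integral_form vscale (even_lattice.coset_space scale Basis \<beta>)
           (lattice_vertex_algebra.graded_dual scale Basis Y pr \<beta>)
       \<and> lattice_vertex_algebra.graded_dual scale Basis Y pr \<beta> =
           lattice_cocycle.E_minus_span scale Basis form eps
             (even_lattice.dual_lat scale Basis form) \<beta>"
proof -
  interpret lattice_vertex_algebra scale Basis form eps Y by fact
  show ?thesis using graded_dual_integral_form[OF assms(3,2)] by blast
qed

end
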